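(* Let $d\in\{2,3\}$, $Q=\Omega\times I$ with $\Omega\subset\mathbb R^d$, $s\ge1$, and let $\mathbf u$ be a spatially divergence-free target velocity field on $Q$ that admits a potential representation as follows: if $d=2$, there is a stream function $v\in H^s(Q)$ with $\mathbf u(\cdot,t)=\nabla^\perp v(\cdot,t)$; if $d=3$, there is a vector potential $\mathbf v\in H^s(Q)^3$ with $\mathbf u(\cdot,t)=\nabla\times\mathbf v(\cdot,t)$. Put $\mathbf w=v$ if $d=2$ and $\mathbf w=\mathbf v$ if $d=3$. Then there exists an SP-RaNN approximation $\mathbf u_\rho$ such that $$\nabla\cdot\mathbf u_\rho=0\quad\text{pointwise in }Q$$ and $$\|\mathbf u-\mathbf u_\rho\|_{H^{s-1}(Q)}\le C_{\rm sp}\inf_{\mathbf w_\rho\in\mathcal N_\rho^{\rm pot}}\|\mathbf w-\mathbf w_\rho\|_{H^s(Q)},$$ where $C_{\rm sp}>0$ is the operator norm of the spatial map $v\mapsto\nabla^\perp v$ ($d=2$) or $\mathbf v\mapsto\nabla\times\mathbf v$ ($d=3$) from $H^s(Q)$ to $H^{s-1}(Q)$; it depends only on $s$, the dimension, the domain and the norm convention, and is independent of the network width, the random hidden-layer parameters and the output-layer coefficients. In particular, if the potential spaces $\mathcal N_\rho^{\rm pot}$ approximate $\mathbf w$ in $H^s(Q)$ to arbitrary accuracy with high probability as the network width increases, then $\mathbf u_\rho$ approximates $\mathbf u$ in $H^{s-1}(Q)$ with high probability as the network width increases.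
   Context: $\Omega$ is a bounded domain with sufficiently regular (e.g. $C^{1,1}$) boundary and $I$ a bounded time interval. All divergence, curl and $\nabla^\perp$ operators act on spatial variables only; $\nabla^\perp v=(\partial_yv,-\partial_xv)$. Potential RaNN space $\mathcal N_\rho^{\rm pot}$: after random hidden-layer parameters are fixed, it is the finite-dimensional linear space spanned by fixed features. For $d=2$ the features are scalar functions $\Theta^j(h^j)$, $h^j(\mathbf x,t)=w_1^jx+w_2^jy+w_t^jt+b^j$, $j=1,\dots,m$. For $d=3$ each component of the vector potential is approximated by its own span of scalar features $\Theta(w_1x+w_2y+w_3z+w_tt+b)$, so that the space is spanned by vector-valued features with one nonzero component. The scalar features are assumed smooth enough to belong to $H^s(Q)$ and to be twice continuously differentiable. SP-RaNN space: the span of $\nabla^\perp$ (resp. curl) of the potential features. For $d=2$, with $\rho^j=(\Theta^j)'$, the basis functions are $\bm\phi^j=(w_2^j\rho^j(h^j),-w_1^j\rho^j(h^j))$. For $d=3$, for vector features $A^j=(\Theta_1^j(h_1^j),\Theta_2^j(h_2^j),\Theta_3^j(h_3^j))$ with $h_i^j=w_{i1}^jx+w_{i2}^jy+w_{i3}^jz+w_{it}^jt+b_i^j$ and $\rho_i^j=(\Theta_i^j)'$ (some $\Theta_i^j$ may be zero), they are $\bm\phi^j=\nabla\times A^j=(w_{32}^j\rho_3^j(h_3^j)-w_{23}^j\rho_2^j(h_2^j),\ w_{13}^j\rho_1^j(h_1^j)-w_{31}^j\rho_3^j(h_3^j),\ w_{21}^j\rho_2^j(h_2^j)-w_{12}^j\rho_1^j(h_1^j))$.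 An SP-RaNN approximation is an element $\mathbf u_\rho=\sum_j\alpha_j\bm\phi^j$ of this space. *)

theory Defs
  imports "HOL-Analysis.Analysis" "HOL-Probability.Probability" "HOL-Library.Multiset"
begin

section \<open>Classical and weak derivatives\<close>

definition partial_deriv ::
  "'a::euclidean_space \<Rightarrow> ('a \<Rightarrow> 'b::real_normed_vector) \<Rightarrow> 'a \<Rightarrow> 'b" where
  "partial_deriv e f x = frechet_derivative f (at x) e"

primrec Ck_on ::
  "nat \<Rightarrow> ('a::euclidean_space \<Rightarrow> 'b::real_normed_vector) \<Rightarrow> 'a set \<Rightarrow> bool" where
  "Ck_on 0 f U \<longleftrightarrow> continuous_on U f"
| "Ck_on (Suc k) f U \<longleftrightarrow>
     (\<forall>x\<in>U. f differentiable (at x)) \<and> (\<forall>e\<in>Basis. Ck_on k (partial_deriv e f) U)"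

definition test_functions :: "'a::euclidean_space set \<Rightarrow> ('a \<Rightarrow> real) set" where
  "test_functions U =
     {\<phi>. (\<forall>k. Ck_on k \<phi> UNIV) \<and> compact (closure {x. \<phi> x \<noteq> 0}) \<and> closure {x. \<phi> x \<noteq> 0} \<subseteq> U}"

definition locally_integrable ::
  "'a::euclidean_space set \<Rightarrow> ('a \<Rightarrow> 'b::euclidean_space) \<Rightarrow> bool" where
  "locally_integrable U f \<longleftrightarrow> (\<forall>K. compact K \<and> K \<subseteq> U \<longrightarrow> integrable (lebesgue_on K) f)"

text \<open>
  A multi-index of order \<open>k\<close> is a multiset of \<open>k\<close> basis vectors; the multiplicity of \<open>e\<close> is the
  number of derivatives taken in direction \<open>e\<close>. Partial derivatives of a test function commute,
  so all lists \<open>es\<close> enumerating \<open>\<alpha>\<close> below impose the same condition.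
\<close>

definition multi_indices :: "nat \<Rightarrow> 'a::euclidean_space multiset set" where
  "multi_indices k = {\<alpha>. set_mset \<alpha> \<subseteq> Basis \<and> size \<alpha> = k}"

definition has_weak_deriv ::
  "'a::euclidean_space set \<Rightarrow> 'a multiset \<Rightarrow> ('a \<Rightarrow> 'b::euclidean_space) \<Rightarrow> ('a \<Rightarrow> 'b) \<Rightarrow> bool" where
  "has_weak_deriv U \<alpha> f g \<longleftrightarrow>
     locally_integrable U f \<and> locally_integrable U g \<and>
     (\<forall>\<phi>\<in>test_functions U. \<forall>es. mset es = \<alpha> \<longrightarrow>
        (\<integral>x. foldr partial_deriv es \<phi> x *\<^sub>R f x \<partial>lebesgue_on U) =
        (- 1) ^ size \<alpha> *\<^sub>R (\<integral>x. \<phi> x *\<^sub>R g x \<partial>lebesgue_on U))"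

text \<open>The weak derivative, which is determined up to a null set.\<close>

definition weak_deriv ::
  "'a::euclidean_space set \<Rightarrow> 'a multiset \<Rightarrow> ('a \<Rightarrow> 'b::euclidean_space) \<Rightarrow> 'a \<Rightarrow> 'b" where
  "weak_deriv U \<alpha> f = (SOME g. has_weak_deriv U \<alpha> f g)"


section \<open>Sobolev spaces of real order\<close>

definition L2_on :: "'a::euclidean_space set \<Rightarrow> ('a \<Rightarrow> 'b::euclidean_space) \<Rightarrow> bool" where
  "L2_on U f \<longleftrightarrow>
     f \<in> borel_measurable (lebesgue_on U) \<and> integrable (lebesgue_on U) (\<lambda>x. (norm (f x))\<^sup>2)"

text \<open>The square of the Gagliardo (Sobolev--Slobodeckij) seminorm of order \<open>0 < \<sigma> < 1\<close>.\<close>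

definition gagliardo ::
  "real \<Rightarrow> 'a::euclidean_space set \<Rightarrow> ('a \<Rightarrow> 'b::euclidean_space) \<Rightarrow> ennreal" where
  "gagliardo \<sigma> U f =
     (\<integral>\<^sup>+x. \<integral>\<^sup>+y. ennreal ((norm (f x - f y))\<^sup>2 / norm (x - y) powr (real DIM('a) + 2 * \<sigma>))
        \<partial>lebesgue_on U \<partial>lebesgue_on U)"

text \<open>
  The space \<open>H\<^sup>s(U)\<close> for real \<open>s \<ge> 0\<close> and open \<open>U\<close>. For \<open>s \<in> \<nat>\<close> this is the usual space of functions
  with square integrable weak derivatives up to order \<open>s\<close>. For vector-valued functions the squared
  norm is the sum of the squared norms of the components. The real number \<open>sobolev_norm s U f\<close> is
  meaningful only for \<open>f \<in> sobolev s U\<close>.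
\<close>

definition sobolev ::
  "real \<Rightarrow> 'a::euclidean_space set \<Rightarrow> ('a \<Rightarrow> 'b::euclidean_space) set" where
  "sobolev s U =
     {f. (\<forall>k \<le> nat \<lfloor>s\<rfloor>. \<forall>\<alpha>\<in>multi_indices k.
            (\<exists>g. has_weak_deriv U \<alpha> f g) \<and> L2_on U (weak_deriv U \<alpha> f)) \<and>
         (frac s \<noteq> 0 \<longrightarrow>
            (\<forall>\<alpha>\<in>multi_indices (nat \<lfloor>s\<rfloor>). gagliardo (frac s) U (weak_deriv U \<alpha> f) < \<infinity>))}"

definition sobolev_norm ::
  "real \<Rightarrow> 'a::euclidean_space set \<Rightarrow> ('a \<Rightarrow> 'b::euclidean_space) \<Rightarrow> real" where
  "sobolev_norm s U f = sqrt (
     (\<Sum>k \<le> nat \<lfloor>s\<rfloor>. \<Sum>\<alpha>\<in>multi_indices k. \<integral>x. (norm (weak_deriv U \<alpha> f x))\<^sup>2 \<partial>lebesgue_on U) +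
     (if frac s = 0 then 0
      else \<Sum>\<alpha>\<in>multi_indices (nat \<lfloor>s\<rfloor>). enn2real (gagliardo (frac s) U (weak_deriv U \<alpha> f))))"

text \<open>The operator norm of \<open>T : H\<^sup>s(U) \<rightarrow> H\<^sup>s\<^sup>-\<^sup>1(U)\<close>.\<close>

definition operator_norm ::
  "real \<Rightarrow> 'a::euclidean_space set \<Rightarrow>
     (('a \<Rightarrow> 'b::euclidean_space) \<Rightarrow> 'a \<Rightarrow> 'c::euclidean_space) \<Rightarrow> real" where
  "operator_norm s U T =
     Sup {sobolev_norm (s - 1) U (T v) | v. v \<in> sobolev s U \<and> sobolev_norm s U v \<le> 1}"


section \<open>Spatial differential operators on space-time\<close>

text \<open>Points of space-time are pairs \<open>(x, t)\<close>; only the spatial directions are differentiated.\<close>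

definition space_dir :: "'n::finite \<Rightarrow> (real^'n) \<times> real" where
  "space_dir i = (axis i 1, 0)"

definition weak_spatial ::
  "((real^'n::finite) \<times> real) set \<Rightarrow> 'n \<Rightarrow> ((real^'n) \<times> real \<Rightarrow> 'b::euclidean_space)
     \<Rightarrow> (real^'n) \<times> real \<Rightarrow> 'b" where
  "weak_spatial Q i v = weak_deriv Q {#space_dir i#} v"

definition grad_perp ::
  "((real^2) \<times> real) set \<Rightarrow> ((real^2) \<times> real \<Rightarrow> real) \<Rightarrow> (real^2) \<times> real \<Rightarrow> real^2" where
  "grad_perp Q v = (\<lambda>z. vector [weak_spatial Q 2 v z, - weak_spatial Q 1 v z])"

definition curl ::
  "((real^3) \<times> real) set \<Rightarrow> ((real^3) \<times> real \<Rightarrow> real^3) \<Rightarrow> (real^3) \<times> real \<Rightarrow> real^3" where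
  "curl Q v = (\<lambda>z. vector
     [weak_spatial Q 2 v z $ 3 - weak_spatial Q 3 v z $ 2,
      weak_spatial Q 3 v z $ 1 - weak_spatial Q 1 v z $ 3,
      weak_spatial Q 1 v z $ 2 - weak_spatial Q 2 v z $ 1])"

definition spatial_div ::
  "((real^'n::finite) \<times> real \<Rightarrow> real^'n) \<Rightarrow> (real^'n) \<times> real \<Rightarrow> real" where
  "spatial_div u z = (\<Sum>i\<in>UNIV. partial_deriv (space_dir i) u z $ i)"

definition weakly_div_free ::
  "((real^'n::finite) \<times> real) set \<Rightarrow> ((real^'n) \<times> real \<Rightarrow> real^'n) \<Rightarrow> bool" where
  "weakly_div_free Q u \<longleftrightarrow>
     (\<forall>\<phi>\<in>test_functions Q.
        (\<integral>z. (\<Sum>i\<in>UNIV. u z $ i * partial_deriv (space_dir i) \<phi> z) \<partial>lebesgue_on Q) = 0)"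


section \<open>Randomized neural network spaces\<close>

text \<open>Hidden-layer parameters of one scalar feature: spatial weights, time weight, bias.\<close>

type_synonym 'n params = "(real^'n) \<times> real \<times> real"

definition hidden :: "'n::finite params \<Rightarrow> (real^'n) \<times> real \<Rightarrow> real" where
  "hidden = (\<lambda>(w, wt, b) (x, t). w \<bullet> x + wt * t + b)"

definition scalar_feature ::
  "(real \<Rightarrow> real) \<Rightarrow> 'n::finite params \<Rightarrow> (real^'n) \<times> real \<Rightarrow> real" where
  "scalar_feature \<Theta> p z = \<Theta> (hidden p z)"

text \<open>
  In three dimensions the component \<open>i\<close> of a vector feature has its own activation \<open>\<Theta> i\<close> and its own
  parameters \<open>p i\<close>; in particular \<open>fst (p i) $ k\<close> is the weight \<open>w\<^sub>i\<^sub>k\<close>. A vector feature with one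
  nonzero component has \<open>\<Theta> i = (\<lambda>_. 0)\<close> for the other two; a space whose components have their own
  spans of scalar features is the span of a family of such features.
\<close>

definition vector_feature ::
  "(3 \<Rightarrow> real \<Rightarrow> real) \<Rightarrow> (3 \<Rightarrow> 3 params) \<Rightarrow> (real^3) \<times> real \<Rightarrow> real^3" where
  "vector_feature \<Theta> p z = (\<chi> i. scalar_feature (\<Theta> i) (p i) z)"

definition sp_feature2 ::
  "(real \<Rightarrow> real) \<Rightarrow> 2 params \<Rightarrow> (real^2) \<times> real \<Rightarrow> real^2" where
  "sp_feature2 \<Theta> p z =
     vector [fst p $ 2 * deriv \<Theta> (hidden p z), - (fst p $ 1) * deriv \<Theta> (hidden p z)]"

definition sp_feature3 ::
  "(3 \<Rightarrow> real \<Rightarrow> real) \<Rightarrow> (3 \<Rightarrow> 3 params) \<Rightarrow> (real^3) \<times> real \<Rightarrow> real^3" where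
  "sp_feature3 \<Theta> p z =
     (let \<rho> = (\<lambda>i. deriv (\<Theta> i) (hidden (p i) z)); w = (\<lambda>i k. fst (p i) $ k) in
      vector [w 3 2 * \<rho> 3 - w 2 3 * \<rho> 2,
              w 1 3 * \<rho> 1 - w 3 1 * \<rho> 3,
              w 2 1 * \<rho> 2 - w 1 2 * \<rho> 1])"

definition feature_span ::
  "nat \<Rightarrow> (nat \<Rightarrow> 'a \<Rightarrow> 'b::real_vector) \<Rightarrow> ('a \<Rightarrow> 'b) set" where
  "feature_span m F = {(\<lambda>z. \<Sum>j<m. \<alpha> j *\<^sub>R F j z) | \<alpha>. True}"

definition potential_space2 ::
  "nat \<Rightarrow> (nat \<Rightarrow> real \<Rightarrow> real) \<Rightarrow> (nat \<Rightarrow> 2 params) \<Rightarrow> ((real^2) \<times> real \<Rightarrow> real) set" where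
  "potential_space2 m \<Theta> p = feature_span m (\<lambda>j. scalar_feature (\<Theta> j) (p j))"

definition sp_space2 ::
  "nat \<Rightarrow> (nat \<Rightarrow> real \<Rightarrow> real) \<Rightarrow> (nat \<Rightarrow> 2 params) \<Rightarrow> ((real^2) \<times> real \<Rightarrow> real^2) set" where
  "sp_space2 m \<Theta> p = feature_span m (\<lambda>j. sp_feature2 (\<Theta> j) (p j))"

definition potential_space3 ::
  "nat \<Rightarrow> (nat \<Rightarrow> 3 \<Rightarrow> real \<Rightarrow> real) \<Rightarrow> (nat \<Rightarrow> 3 \<Rightarrow> 3 params) \<Rightarrow> ((real^3) \<times> real \<Rightarrow> real^3) set" where
  "potential_space3 m \<Theta> p = feature_span m (\<lambda>j. vector_feature (\<Theta> j) (p j))"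

definition sp_space3 ::
  "nat \<Rightarrow> (nat \<Rightarrow> 3 \<Rightarrow> real \<Rightarrow> real) \<Rightarrow> (nat \<Rightarrow> 3 \<Rightarrow> 3 params) \<Rightarrow> ((real^3) \<times> real \<Rightarrow> real^3) set" where
  "sp_space3 m \<Theta> p = feature_span m (\<lambda>j. sp_feature3 (\<Theta> j) (p j))"

definition admissible_feature ::
  "real \<Rightarrow> ((real^'n::finite) \<times> real) set \<Rightarrow> (real \<Rightarrow> real) \<Rightarrow> 'n params \<Rightarrow> bool" where
  "admissible_feature s Q \<Theta> p \<longleftrightarrow>
     scalar_feature \<Theta> p \<in> sobolev s Q \<and> Ck_on 2 (scalar_feature \<Theta> p) Q"

text \<open>
  The inner probability of \<open>E k\<close> tends to 1; for measurable \<open>E k\<close> this is convergence of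
  the probability of \<open>E k\<close> to 1.
\<close>

definition with_high_prob :: "'w measure \<Rightarrow> (nat \<Rightarrow> 'w \<Rightarrow> bool) \<Rightarrow> bool" where
  "with_high_prob M E \<longleftrightarrow>
     (\<forall>\<delta>>0. \<forall>\<^sub>F k in sequentially.
        \<exists>A\<in>sets M. measure M A \<ge> 1 - \<delta> \<and> (\<forall>\<omega>\<in>A. E k \<omega>))"

end

theory Submission
  imports Defs
begin

text \<open>
  Both \<open>\<nabla>\<^sup>\<bottom>\<close> and \<open>curl\<close> have the form \<open>T v = \<Sum>\<^sub>i A\<^sub>i \<partial>\<^sub>i v\<close> with linear contractions \<open>A\<^sub>i\<close>.  A weak derivative
  of first order maps \<open>H\<^sup>s\<close> to \<open>H\<^sup>s\<^sup>-\<^sup>1\<close> with norm at most one, since its weak derivatives are weak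
  derivatives of the function itself.  Hence \<open>T\<close> is bounded, and \<open>\<parallel>T v\<parallel> \<le> C \<parallel>v\<parallel>\<close> with the operator norm \<open>C\<close>
  (lemma \<open>T_norm_le\<close>).  It is positive because \<open>T\<close> maps some linear function to a nonzero constant,
  and \<open>\<Omega>\<close> is bounded, so that linear functions belong to \<open>H\<^sup>s\<close>.

  The span of the features is finite-dimensional, so the potential \<open>v\<close> has a best approximation \<open>v\<^sub>\<rho>\<close>
  in it with respect to the seminorm of \<open>H\<^sup>s\<close> (lemma \<open>best_approximation\<close>).  The combination \<open>u\<^sub>\<rho>\<close> of
  the divergence-free features with the same coefficients is \<open>T v\<^sub>\<rho>\<close>, because weak and classical
  derivatives of continuously differentiable functions agree.  Therefore \<open>u - u\<^sub>\<rho> = T (v - v\<^sub>\<rho>)\<close> almost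
  everywhere, and the bound for \<open>T\<close> is the error estimate (lemma
  \<open>exists_structure_preserving_approximation\<close>).  In the divergence of \<open>u\<^sub>\<rho>\<close> the second derivatives
  \<open>w\<^sub>i w\<^sub>k \<Theta>''\<close> of a feature with spatial weights \<open>w\<close> cancel in pairs.  The probabilistic statement
  follows from the error estimate event by event.

  All of this rests on weak derivatives being unique up to null sets, hence linear almost everywhere.
  Uniqueness is the fundamental lemma of the calculus of variations (lemma \<open>fundamental_lemma\<close>), for
  which smooth bump functions approximating indicators of boxes are constructed.  That classical
  derivatives are weak derivatives is integration by parts, derived from the translation invariance
  of Lebesgue measure (lemma \<open>integral_partial_deriv_compact_support\<close>).  The triangle inequality of
  the Sobolev norm comes from a weighted estimate that holds for each of its terms (lemma
  \<open>sqrt_triangle_if_weighted\<close>).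
\<close>


section \<open>Continuously differentiable functions\<close>

lemma partial_deriv_eqI:
  assumes "(f has_derivative f') (at x)"
  shows "partial_deriv e f x = f' e"
  using frechet_derivative_at[OF assms] by (simp add: partial_deriv_def)

lemma Ck_on_SucD: "Ck_on (Suc k) f U \<Longrightarrow> Ck_on k f U"
proof (induction k arbitrary: f)
  case 0
  then have "f differentiable_on U"
    by (simp add: differentiable_at_imp_differentiable_on)
  then show ?case by (simp add: differentiable_imp_continuous_on)
next
  case (Suc k)
  then show ?case by auto
qed

lemma Ck_on_const: "Ck_on k (\<lambda>_. c) U"
proof (induction k arbitrary: c)
  case (Suc k)
  have "partial_deriv e (\<lambda>_::'a. c) = (\<lambda>_. 0)" for e
    by (rule ext, rule partial_deriv_eqI[of _ "\<lambda>_. 0"]) auto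
  with Suc show ?case by simp
qed simp

lemma Ck_on_add:
  fixes f g :: "'a::euclidean_space \<Rightarrow> 'b::real_normed_vector"
  shows "Ck_on k f UNIV \<Longrightarrow> Ck_on k g UNIV \<Longrightarrow> Ck_on k (\<lambda>x. f x + g x) UNIV"
proof (induction k arbitrary: f g)
  case 0
  then show ?case by (auto intro: continuous_on_add)
next
  case (Suc k)
  have "partial_deriv e (\<lambda>x. f x + g x) = (\<lambda>x. partial_deriv e f x + partial_deriv e g x)" for e
  proof
    fix x
    have "f differentiable at x" "g differentiable at x" using Suc.prems by auto
    then show "partial_deriv e (\<lambda>x. f x + g x) x = partial_deriv e f x + partial_deriv e g x"
      unfolding frechet_derivative_works by (subst partial_deriv_eqI[OF has_derivative_add]) (auto simp: partial_deriv_def)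
  qed
  then show ?case using Suc by auto
qed

lemma Ck_on_mult:
  fixes f g :: "'a::euclidean_space \<Rightarrow> real"
  shows "Ck_on k f UNIV \<Longrightarrow> Ck_on k g UNIV \<Longrightarrow> Ck_on k (\<lambda>x. f x * g x) UNIV"
proof (induction k arbitrary: f g)
  case 0
  then show ?case by (auto intro: continuous_on_mult)
next
  case (Suc k)
  have eq: "partial_deriv e (\<lambda>x. f x * g x) = (\<lambda>x. f x * partial_deriv e g x + partial_deriv e f x * g x)" for e
  proof
    fix x
    have "f differentiable at x" "g differentiable at x" using Suc.prems by auto
    then show "partial_deriv e (\<lambda>x. f x * g x) x = f x * partial_deriv e g x + partial_deriv e f x * g x"
      unfolding frechet_derivative_works by (subst partial_deriv_eqI[OF has_derivative_mult]) (auto simp: partial_deriv_def)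
  qed
  have "Ck_on k f UNIV" "Ck_on k g UNIV" using Suc.prems Ck_on_SucD by blast+
  then have "Ck_on k (partial_deriv e (\<lambda>x. f x * g x)) UNIV" if "e \<in> Basis" for e
    unfolding eq using Suc.prems that by (auto intro!: Ck_on_add Suc.IH)
  moreover have "(\<lambda>x. f x * g x) differentiable (at x)" for x
    using Suc.prems by auto
  ultimately show ?case by simp
qed

lemma Ck_on_prod:
  fixes f :: "'i \<Rightarrow> 'a::euclidean_space \<Rightarrow> real"
  assumes "finite I" "\<And>i. i \<in> I \<Longrightarrow> Ck_on k (f i) UNIV"
  shows "Ck_on k (\<lambda>x. \<Prod>i\<in>I. f i x) UNIV"
  using assms by (induction I rule: finite_induct) (auto intro: Ck_on_mult Ck_on_const)

lemma Ck_on_compose: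
  fixes h :: "real \<Rightarrow> real" and g :: "'a::euclidean_space \<Rightarrow> real"
  shows "Ck_on k h UNIV \<Longrightarrow> Ck_on k g UNIV \<Longrightarrow> Ck_on k (\<lambda>x. h (g x)) UNIV"
proof (induction k arbitrary: h g)
  case 0
  then show ?case using continuous_on_compose2[of UNIV h UNIV g] by simp
next
  case (Suc k)
  have d: "((\<lambda>x. h (g x)) has_derivative
      (\<lambda>y. frechet_derivative h (at (g x)) (frechet_derivative g (at x) y))) (at x)" for x
  proof -
    have "g differentiable at x" "h differentiable at (g x)" using Suc.prems by auto
    then show ?thesis unfolding frechet_derivative_works
      by (rule has_derivative_compose)
  qed
  have eq: "partial_deriv e (\<lambda>x. h (g x)) = (\<lambda>x. partial_deriv 1 h (g x) * partial_deriv e g x)" for e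
  proof
    fix x
    have "linear (frechet_derivative h (at (g x)))"
      by (rule linear_frechet_derivative) (use Suc.prems in auto)
    from linear_scale[OF this, of "frechet_derivative g (at x) e" 1]
    show "partial_deriv e (\<lambda>x. h (g x)) x = partial_deriv 1 h (g x) * partial_deriv e g x"
      using partial_deriv_eqI[OF d, of e x] by (simp add: partial_deriv_def)
  qed
  have "Ck_on k g UNIV" using Suc.prems Ck_on_SucD by blast
  then have "Ck_on k (partial_deriv e (\<lambda>x. h (g x))) UNIV" if "e \<in> Basis" for e
    unfolding eq using Suc.prems that by (intro Ck_on_mult Suc.IH[of "partial_deriv 1 h" g]) auto
  moreover have "(\<lambda>x. h (g x)) differentiable (at x)" for x
    using d unfolding differentiable_def by blast
  ultimately show ?case by simp
qed

lemma Ck_on_SucI_real: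
  fixes h :: "real \<Rightarrow> real"
  assumes d: "\<And>x. (h has_real_derivative h' x) (at x)" and "Ck_on k h' UNIV"
  shows "Ck_on (Suc k) h UNIV"
proof -
  have "partial_deriv 1 h = h'"
    by (rule ext, subst partial_deriv_eqI[OF d[unfolded has_field_derivative_def]]) simp
  moreover have "h differentiable at x" for x
    using d[of x] by (auto simp: differentiable_def has_field_derivative_def)
  ultimately show ?thesis using assms(2) by simp
qed

lemma Ck_on_exp: "Ck_on k (exp :: real \<Rightarrow> real) UNIV"
proof (induction k)
  case 0
  then show ?case by (auto intro: continuous_intros)
next
  case (Suc k)
  then show ?case by (rule Ck_on_SucI_real[rotated]) (rule DERIV_exp)
qed

lemma Ck_on_inner_right: "Ck_on k (\<lambda>x::'a::euclidean_space. (x :: 'a) \<bullet> c) UNIV"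
proof (cases k)
  case 0
  then show ?thesis by (auto intro: continuous_intros)
next
  case (Suc l)
  have d: "((\<lambda>x. x \<bullet> c) has_derivative (\<lambda>x. x \<bullet> c)) (at x)" for x :: 'a
    by (auto intro: derivative_eq_intros)
  have "partial_deriv e (\<lambda>x. x \<bullet> c) = (\<lambda>x. e \<bullet> c)" for e
    by (rule ext, rule partial_deriv_eqI[OF d])
  moreover have "(\<lambda>x. x \<bullet> c) differentiable at x" for x :: 'a
    using d differentiable_def by blast
  ultimately show ?thesis using Suc by (simp add: Ck_on_const)
qed


section \<open>Smooth bump functions\<close>

text \<open>
  The case \<open>k = 0\<close> is the classical function \<open>exp (-1/x)\<close>, all of whose derivatives vanish at \<open>0\<close>.
  The powers of \<open>1/x\<close> make the span of the family closed under differentiation, so that smoothness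
  of every member follows by induction on the order of differentiability.
\<close>

definition flat :: "nat \<Rightarrow> real \<Rightarrow> real" where
  "flat k x = (if x \<le> 0 then 0 else exp (- (1 / x)) / x ^ k)"

text \<open>
  The quadratic bound gives the derivative at the origin.  It is \<open>y ^ n \<le> n ^ n * exp y\<close> for
  \<open>y = 1/x\<close> and \<open>n = k + 2\<close>.
\<close>

lemma flat_le_square:
  "\<bar>flat k x\<bar> \<le> real (k + 2) ^ (k + 2) * x\<^sup>2"
proof (cases "x \<le> 0")
  case False
  then have x: "x > 0" by simp
  define n where "n = k + 2"
  have n: "n \<ge> 1" "n > 0" by (auto simp: n_def)
  have "(1 / x / real n) ^ n \<le> (1 + (1 / x) / real n) ^ n"
    by (rule power_mono) (use x in auto)
  also have "\<dots> \<le> exp (1 / x)"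
    by (rule exp_ge_one_plus_x_over_n_power_n) (use x n in \<open>auto intro: order_trans[of _ 0]\<close>)
  finally have "1 / (x ^ n * real n ^ n) \<le> exp (1 / x)"
    by (simp add: power_divide field_simps)
  then have "exp (- (1 / x)) \<le> x ^ n * real n ^ n"
    using x n by (simp add: exp_minus field_simps)
  then have "exp (- (1 / x)) / x ^ k \<le> x ^ n * real n ^ n / x ^ k"
    using x by (simp add: divide_right_mono)
  also have "\<dots> = real n ^ n * x\<^sup>2"
    using x by (simp add: n_def power_add power2_eq_square)
  finally show ?thesis using x by (simp add: flat_def n_def)
qed (simp add: flat_def)

lemma flat_has_derivative:
  "(flat k has_real_derivative (flat (k + 2) x - real k * flat (k + 1) x)) (at x)"
proof -
  consider "x < 0" | "x = 0" | "x > 0" by linarith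
  then show ?thesis
  proof cases
    case 1
    have "((\<lambda>x. 0) has_real_derivative 0) (at x)" by simp
    then have "(flat k has_real_derivative 0) (at x)"
      by (rule has_field_derivative_transform_within_open[of _ _ _ "{..<0}"])
        (use 1 in \<open>auto simp: flat_def\<close>)
    then show ?thesis using 1 by (simp add: flat_def)
  next
    case 3
    have "((\<lambda>x. exp (- (1 / x)) / x ^ k) has_real_derivative
        (exp (- (1 / x)) / x ^ (k + 2) - real k * (exp (- (1 / x)) / x ^ (k + 1)))) (at x)"
    proof (cases k)
      case 0
      then show ?thesis using 3
        by (auto intro!: derivative_eq_intros simp: field_simps power2_eq_square)
    next
      case (Suc l)
      have "((\<lambda>x. exp (- (1 / x)) / x ^ Suc l) has_real_derivative
          ((exp (- (1 / x)) * (1 / x\<^sup>2)) * x ^ Suc l - exp (- (1 / x)) * (real (Suc l) * x ^ l))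
            / (x ^ Suc l * x ^ Suc l)) (at x)"
      proof (rule DERIV_divide)
        show "((\<lambda>x. exp (- (1 / x))) has_real_derivative exp (- (1 / x)) * (1 / x\<^sup>2)) (at x)"
          using 3 by (auto intro!: derivative_eq_intros simp: power2_eq_square)
        show "((\<lambda>x. x ^ Suc l) has_real_derivative real (Suc l) * x ^ l) (at x)"
          using DERIV_pow[of "Suc l" x] by simp
      qed (use 3 in simp)
      also have "((exp (- (1 / x)) * (1 / x\<^sup>2)) * x ^ Suc l - exp (- (1 / x)) * (real (Suc l) * x ^ l))
            / (x ^ Suc l * x ^ Suc l)
          = exp (- (1 / x)) / x ^ (Suc l + 2) - real (Suc l) * (exp (- (1 / x)) / x ^ (Suc l + 1))"
        using 3 by (simp add: field_simps power2_eq_square)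
      finally show ?thesis using Suc by simp
    qed
    then have "(flat k has_real_derivative
        (exp (- (1 / x)) / x ^ (k + 2) - real k * (exp (- (1 / x)) / x ^ (k + 1)))) (at x)"
      by (rule has_field_derivative_transform_within_open[of _ _ _ "{0<..}"])
        (use 3 in \<open>auto simp: flat_def\<close>)
    then show ?thesis using 3 by (simp add: flat_def)
  next
    case 2
    define c where "c = real (k + 2) ^ (k + 2)"
    have "(\<lambda>h. flat k h / h) \<midarrow>0\<rightarrow> 0"
    proof (rule Lim_null_comparison)
      show "\<forall>\<^sub>F h in at 0. norm (flat k h / h) \<le> c * \<bar>h\<bar>"
      proof (rule eventually_at_filter[THEN iffD2], rule always_eventually, intro allI impI)
        fix h :: real assume "h \<noteq> 0"
        have "\<bar>flat k h\<bar> \<le> c * \<bar>h\<bar> * \<bar>h\<bar>"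
          using flat_le_square[of k h] by (simp add: c_def power2_eq_square)
        then show "norm (flat k h / h) \<le> c * \<bar>h\<bar>"
          using \<open>h \<noteq> 0\<close> by (simp add: field_simps)
      qed
      show "(\<lambda>h. c * \<bar>h\<bar>) \<midarrow>0\<rightarrow> 0" by (auto intro!: tendsto_eq_intros)
    qed
    then show ?thesis using 2 by (simp add: DERIV_def flat_def)
  qed
qed

lemma Ck_on_flat: "Ck_on n (flat k) UNIV"
proof (induction n arbitrary: k)
  case 0
  have "flat k differentiable (at x)" for x
    using flat_has_derivative[of k x] by (auto simp: differentiable_def has_field_derivative_def)
  then show ?case
    by (auto simp: intro!: continuous_at_imp_continuous_on differentiable_imp_continuous_within)
next
  case (Suc n)
  have "Ck_on n (\<lambda>x. flat (k + 2) x + (- real k) * flat (k + 1) x) UNIV"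
    by (intro Ck_on_add Ck_on_mult Ck_on_const Suc)
  then show ?case
    by (intro Ck_on_SucI_real[OF flat_has_derivative]) simp
qed

text \<open>
  The product is smooth and positive exactly on the open box.  Since \<open>1 - exp (- n c)\<close> tends to \<open>1\<close>
  for \<open>c > 0\<close> and vanishes for \<open>c = 0\<close>, the functions below converge to the indicator of the box.
\<close>

definition box_bump :: "'a::euclidean_space \<Rightarrow> 'a \<Rightarrow> nat \<Rightarrow> 'a \<Rightarrow> real" where
  "box_bump a b n x =
     1 - exp (- real n * (\<Prod>i\<in>Basis. flat 0 ((x - a) \<bullet> i) * flat 0 ((b - x) \<bullet> i)))"

lemma flat_nonneg: "flat k x \<ge> 0"
  by (simp add: flat_def)

lemma flat_eq_0_iff: "flat k x = 0 \<longleftrightarrow> x \<le> 0"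
  by (simp add: flat_def)

lemma box_bump_range: "0 \<le> box_bump a b n x" "box_bump a b n x \<le> 1"
  by (auto simp: box_bump_def intro!: mult_nonneg_nonneg prod_nonneg flat_nonneg)

lemma box_bump_outside:
  assumes "x \<notin> box a b"
  shows "box_bump a b n x = 0"
proof -
  obtain i where "i \<in> Basis" "flat 0 ((x - a) \<bullet> i) * flat 0 ((b - x) \<bullet> i) = 0"
    using assms by (force simp: mem_box flat_eq_0_iff inner_diff_left)
  then have "(\<Prod>i\<in>Basis. flat 0 ((x - a) \<bullet> i) * flat 0 ((b - x) \<bullet> i)) = 0"
    by (intro prod_zero) auto
  then show ?thesis by (simp add: box_bump_def)
qed

lemma box_bump_tendsto: "(\<lambda>n. box_bump a b n x) \<longlonglongrightarrow> indicator (box a b) x"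
proof (cases "x \<in> box a b")
  case True
  define c where "c = (\<Prod>i\<in>Basis. flat 0 ((x - a) \<bullet> i) * flat 0 ((b - x) \<bullet> i))"
  have "c > 0" unfolding c_def
    using True by (auto simp: mem_box flat_def inner_diff_left intro!: prod_pos)
  then have "(\<lambda>n. 1 - exp (- c) ^ n) \<longlonglongrightarrow> 1 - 0"
    by (intro tendsto_intros LIMSEQ_realpow_zero) auto
  then have "(\<lambda>n. 1 - exp (- real n * c)) \<longlonglongrightarrow> 1"
    by (simp add: exp_of_nat_mult[symmetric])
  then show ?thesis using True by (simp add: box_bump_def c_def)
qed (simp add: box_bump_outside)

lemma box_bump_test_function:
  assumes "cbox a b \<subseteq> U"
  shows "box_bump a b n \<in> test_functions U"
proof -
  have "Ck_on k (box_bump a b n) UNIV" for k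
  proof -
    have 1: "Ck_on k (\<lambda>x. flat 0 (x \<bullet> i + - (a \<bullet> i)) * flat 0 (b \<bullet> i + (-1) * (x \<bullet> i))) UNIV" for i
      by (intro Ck_on_mult Ck_on_compose[OF Ck_on_flat] Ck_on_add Ck_on_const Ck_on_inner_right)
    have "Ck_on k (\<lambda>x. 1 + (-1) * exp (- real n *
        (\<Prod>i\<in>Basis. flat 0 (x \<bullet> i + - (a \<bullet> i)) * flat 0 (b \<bullet> i + (-1) * (x \<bullet> i))))) UNIV"
      by (intro Ck_on_add Ck_on_mult Ck_on_const Ck_on_compose[OF Ck_on_exp] Ck_on_prod 1) auto
    then show ?thesis
      by (simp add: box_bump_def[abs_def] inner_diff_left)
  qed
  moreover have "{x. box_bump a b n x \<noteq> 0} \<subseteq> box a b"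
    using box_bump_outside by blast
  then have "{x. box_bump a b n x \<noteq> 0} \<subseteq> cbox a b"
    using box_subset_cbox by blast
  then have "closure {x. box_bump a b n x \<noteq> 0} \<subseteq> cbox a b"
    by (rule closure_minimal) (rule closed_cbox)
  moreover from this have "compact (closure {x. box_bump a b n x \<noteq> 0})"
    using bounded_subset[OF bounded_cbox] by (auto simp: compact_eq_bounded_closed)
  ultimately show ?thesis using assms by (auto simp: test_functions_def)
qed


section \<open>Test functions\<close>

lemma test_functions_zero_outside:
  assumes "\<phi> \<in> test_functions U" "x \<notin> closure {x. \<phi> x \<noteq> 0}"
  shows "\<phi> x = 0"
  using assms(2) closure_subset[of "{x. \<phi> x \<noteq> 0}"] by auto

lemma test_functions_continuous: "\<phi> \<in> test_functions U \<Longrightarrow> continuous_on UNIV \<phi>"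
  unfolding test_functions_def mem_Collect_eq using Ck_on.simps(1) by metis

lemma test_functions_differentiable: "\<phi> \<in> test_functions U \<Longrightarrow> \<phi> differentiable (at x)"
  unfolding test_functions_def mem_Collect_eq using Ck_on.simps(2) by blast

lemma partial_deriv_cong_open:
  assumes "open S" "x \<in> S" "\<And>y. y \<in> S \<Longrightarrow> f y = g y"
  shows "partial_deriv e f x = partial_deriv e g x"
proof -
  have "(f has_derivative d) (at x) \<longleftrightarrow> (g has_derivative d) (at x)" for d
    by (rule iffI; erule has_derivative_transform_within_open[OF _ assms(1,2)]) (simp_all add: assms(3))
  then show ?thesis by (simp add: partial_deriv_def frechet_derivative_def)
qed

lemma partial_deriv_support:
  "{x. partial_deriv e f x \<noteq> 0} \<subseteq> closure {x. f x \<noteq> 0}"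
proof clarify
  fix x assume ne: "partial_deriv e f x \<noteq> 0"
  show "x \<in> closure {x. f x \<noteq> 0}"
  proof (rule ccontr)
    assume x: "x \<notin> closure {x. f x \<noteq> 0}"
    have "partial_deriv e f x = partial_deriv e (\<lambda>_. 0) x"
      by (rule partial_deriv_cong_open[of "- closure {x. f x \<noteq> 0}"])
        (use x closure_subset[of "{x. f x \<noteq> 0}"] in auto)
    also have "\<dots> = 0" by (rule partial_deriv_eqI) simp
    finally show False using ne by simp
  qed
qed

lemma test_functions_partial_deriv:
  assumes "\<phi> \<in> test_functions U" "e \<in> Basis"
  shows "partial_deriv e \<phi> \<in> test_functions U"
proof -
  have "Ck_on (Suc k) \<phi> UNIV" for k using assms by (auto simp only: test_functions_def mem_Collect_eq)
  then have "Ck_on k (partial_deriv e \<phi>) UNIV" for k using assms by auto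
  moreover have "closure {x. partial_deriv e \<phi> x \<noteq> 0} \<subseteq> closure {x. \<phi> x \<noteq> 0}"
    by (rule closure_minimal[OF partial_deriv_support]) simp
  ultimately show ?thesis using assms
    using compact_Int_closed[of "closure {x. \<phi> x \<noteq> 0}" "closure {x. partial_deriv e \<phi> x \<noteq> 0}"]
    unfolding test_functions_def by (auto simp: inf.absorb2)
qed

lemma test_functions_foldr:
  assumes "\<phi> \<in> test_functions U" "set es \<subseteq> Basis"
  shows "foldr partial_deriv es \<phi> \<in> test_functions U"
  using assms(2) by (induction es) (auto intro: assms(1) test_functions_partial_deriv)


section \<open>The fundamental lemma of the calculus of variations\<close>

lemma sigma_finite_lebesgue: "sigma_finite_measure (lebesgue :: 'a::euclidean_space measure)"
proof -
  obtain A :: "'a set set" where A: "countable A" "A \<subseteq> sets lborel" "\<Union>A = space lborel"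
      "\<forall>a\<in>A. emeasure lborel a \<noteq> \<infinity>"
    using sigma_finite_measure.sigma_finite_countable[OF sigma_finite_lborel] by metis
  then have "A \<subseteq> sets lebesgue" "\<forall>a\<in>A. emeasure lebesgue a \<noteq> \<infinity>"
    by (auto simp: subset_eq)
  with A show ?thesis by (intro sigma_finite_measure.intro exI[of _ A]) auto
qed

lemma sigma_finite_lebesgue_on:
  "U \<in> sets lebesgue \<Longrightarrow> sigma_finite_measure (lebesgue_on U)"
  by (rule sigma_finite_measure_restrict_space[OF sigma_finite_lebesgue])

text \<open>
  Boxes form a \<open>\<pi>\<close>-system that generates the Borel sets, and every Lebesgue set differs from a Borel
  set by a null set; so all set integrals of \<open>f\<close> vanish, and a density is determined by them.
\<close>

lemma AE_zero_if_box_integrals_zero: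
  fixes f :: "'a::euclidean_space \<Rightarrow> 'b::euclidean_space"
  assumes f: "integrable lebesgue f"
    and box: "\<And>c d. (\<integral>x. indicator (box c d) x *\<^sub>R f x \<partial>lebesgue) = 0"
  shows "AE x in lebesgue. f x = 0"
proof -
  let ?I = "\<lambda>A. set_lebesgue_integral lebesgue A f"
  let ?G = "range (\<lambda>(a, b). box a b) :: 'a set set"
  have G: "borel = sigma UNIV ?G" by (rule borel_eq_box)
  have "sets borel = sigma_sets UNIV ?G" by (subst G) (rule sets_measure_of, simp)
  then have sets: "A \<in> sets lebesgue" if "A \<in> sigma_sets UNIV ?G" for A
    using that by (intro sets_completionI_sets) simp
  have int: "set_integrable lebesgue A f" if "A \<in> sets lebesgue" for A
    using f that by (simp add: set_integrable_def integrable_mult_indicator)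
  have "Int_stable ?G"
    by (force simp: Int_stable_def box_Int_box)
  moreover have univ: "?I UNIV = 0"
  proof -
    have "(\<lambda>n. \<integral>x. indicator (box (- real n *\<^sub>R One) (real n *\<^sub>R One)) x *\<^sub>R f x \<partial>lebesgue)
        \<longlonglongrightarrow> (\<integral>x. f x \<partial>lebesgue)"
    proof (rule integral_dominated_convergence[where w = "\<lambda>x. norm (f x)"])
      show "AE x in lebesgue. (\<lambda>n. indicator (box (- real n *\<^sub>R One) (real n *\<^sub>R One)) x *\<^sub>R f x)
          \<longlonglongrightarrow> f x"
      proof (intro AE_I2)
        fix x :: 'a
        have ev: "\<forall>\<^sub>F n in sequentially. \<forall>i\<in>Basis. \<bar>x \<bullet> i\<bar> < real n"
          using filterlim_real_sequentially unfolding filterlim_at_top_dense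
          by (simp add: eventually_ball_finite)
        have "\<forall>\<^sub>F n in sequentially. indicator (box (- real n *\<^sub>R One) (real n *\<^sub>R One)) x *\<^sub>R f x = f x"
          using ev
        proof eventually_elim
          case (elim n)
          then have "x \<in> box (- real n *\<^sub>R One) (real n *\<^sub>R One)"
            by (force simp: mem_box abs_less_iff)
          then show ?case by simp
        qed
        then show "(\<lambda>n. indicator (box (- real n *\<^sub>R One) (real n *\<^sub>R One)) x *\<^sub>R f x) \<longlonglongrightarrow> f x"
          by (rule tendsto_eventually)
      qed
    qed (use f in \<open>auto split: split_indicator intro!: borel_measurable_scaleR borel_measurable_indicator\<close>)
    then show ?thesis using box by (simp add: LIMSEQ_const_iff set_lebesgue_integral_def)
  qed
  have borel: "?I A = 0" if "A \<in> sets borel" for A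
  proof -
    have "A \<in> sigma_sets UNIV ?G" using that unfolding G by simp
    from \<open>Int_stable ?G\<close> Pow_UNIV[symmetric, THEN equalityD1, THEN subset_trans[OF subset_UNIV]] this show ?thesis
    proof (induction rule: sigma_sets_induct_disjoint)
      case (basic A)
      then show ?case using box by (auto simp: set_lebesgue_integral_def)
    next
      case empty
      then show ?case by (simp add: set_lebesgue_integral_def)
    next
      case (compl A)
      then have A: "A \<in> sets lebesgue" using sets by blast
      have "?I (A \<union> (UNIV - A)) = ?I A + ?I (UNIV - A)"
        by (rule set_integral_Un[OF _ int[OF A] int]) (use A in auto)
      then show ?case using univ compl by simp
    next
      case (union A)
      then have A: "A i \<in> sets lebesgue" for i using sets by blast
      have "?I (\<Union>i. A i) = (\<Sum>i. ?I (A i))"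
        by (rule lebesgue_integral_countable_add)
          (use union(1) A int in \<open>auto simp: disjoint_family_on_def\<close>)
      then show ?case using union by simp
    qed
  qed
  have "?I A = 0" if A: "A \<in> sets lebesgue" for A
  proof -
    obtain S N N' where S: "A = S \<union> N" "N \<subseteq> N'" "N' \<in> null_sets lborel" "S \<in> sets lborel"
      using A by (rule sets_completionE)
    have "N' \<in> null_sets lebesgue" using S by (simp add: null_sets_completionI)
    then have "AE x in lebesgue. x \<notin> N'" by (rule AE_not_in)
    then have "AE x in lebesgue. indicator A x *\<^sub>R f x = indicator S x *\<^sub>R f x"
      by eventually_elim (use S in \<open>auto simp: indicator_def\<close>)
    then have "?I A = ?I S" unfolding set_lebesgue_integral_def
      by (rule integral_cong_AE[rotated 2])
        (use f A S in \<open>auto intro!: borel_measurable_scaleR borel_measurable_indicator\<close>)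
    then show ?thesis using borel S by simp
  qed
  then show ?thesis
    by (rule sigma_finite_measure.density_zero[OF sigma_finite_lebesgue f])
qed

text \<open>
  On a box whose closure lies in \<open>U\<close> the bump functions are test functions that converge to the
  indicator of the box.  Dominated convergence turns the hypothesis into vanishing integrals over
  boxes, and countably many boxes cover \<open>U\<close>.
\<close>

lemma fundamental_lemma:
  fixes g :: "'a::euclidean_space \<Rightarrow> 'b::euclidean_space"
  assumes U: "open U" and g: "locally_integrable U g"
    and test: "\<And>\<phi>. \<phi> \<in> test_functions U \<Longrightarrow> (\<integral>x. \<phi> x *\<^sub>R g x \<partial>lebesgue_on U) = 0"
  shows "AE x in lebesgue_on U. g x = 0"
proof -
  have Ul: "U \<in> sets lebesgue" using U by auto
  have cbox: "AE x in lebesgue. x \<in> cbox a b \<longrightarrow> g x = 0" if ab: "cbox a b \<subseteq> U" for a b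
  proof -
    define h where "h x = indicator (cbox a b) x *\<^sub>R g x" for x
    have h: "integrable lebesgue h"
      using g ab unfolding locally_integrable_def h_def[abs_def]
      by (subst integrable_restrict_space[symmetric]) auto
    have "(\<integral>x. indicator (box c d) x *\<^sub>R (indicator (box a b) x *\<^sub>R h x) \<partial>lebesgue) = 0" for c d
    proof -
      obtain p q where pq: "box c d \<inter> box a b = box p q"
        unfolding box_Int_box by blast
      show ?thesis
      proof (cases "box p q = {}")
        case True
        then have "indicator (box c d) x *\<^sub>R (indicator (box a b) x *\<^sub>R h x) = 0" for x
          using pq by (auto simp: indicator_def)
        then have "(\<integral>x. indicator (box c d) x *\<^sub>R (indicator (box a b) x *\<^sub>R h x) \<partial>lebesgue) = integral\<^sup>L (lebesgue :: 'a measure) (\<lambda>_. 0 :: 'b)"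
          by (intro Bochner_Integration.integral_cong) (rule refl)
        then show ?thesis by simp
      next
        case False
        have "cbox p q \<subseteq> cbox a b"
        proof -
          have "box p q \<subseteq> cbox a b" using pq box_subset_cbox by blast
          then have "closure (box p q) \<subseteq> cbox a b" by (rule closure_minimal) (rule closed_cbox)
          then show ?thesis using False by (simp add: closure_box)
        qed
        then have test0: "(\<integral>x. box_bump p q n x *\<^sub>R h x \<partial>lebesgue) = 0" for n
        proof -
          have "box_bump p q n x *\<^sub>R h x = indicator U x *\<^sub>R (box_bump p q n x *\<^sub>R g x)" for x
            using \<open>cbox p q \<subseteq> cbox a b\<close> ab box_subset_cbox[of p q] box_bump_outside[of x p q n]
            by (cases "x \<in> box p q") (auto simp: h_def indicator_def)
          then have "(\<integral>x. box_bump p q n x *\<^sub>R h x \<partial>lebesgue)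
              = (\<integral>x. box_bump p q n x *\<^sub>R g x \<partial>lebesgue_on U)"
            using Ul by (simp add: integral_restrict_space)
          also have "\<dots> = 0"
            by (intro test box_bump_test_function) (use \<open>cbox p q \<subseteq> cbox a b\<close> ab in auto)
          finally show ?thesis .
        qed
        have meas: "box_bump p q n \<in> borel_measurable lebesgue" for n
          using box_bump_test_function[of p q UNIV n]
          by (intro measurable_completion) (auto intro!: borel_measurable_continuous_onI test_functions_continuous)
        have "(\<lambda>n. \<integral>x. box_bump p q n x *\<^sub>R h x \<partial>lebesgue)
            \<longlonglongrightarrow> (\<integral>x. indicator (box p q) x *\<^sub>R h x \<partial>lebesgue)"
        proof (rule integral_dominated_convergence[where w = "\<lambda>x. norm (h x)"])
          show "AE x in lebesgue. (\<lambda>n. box_bump p q n x *\<^sub>R h x) \<longlonglongrightarrow> indicator (box p q) x *\<^sub>R h x"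
            by (intro AE_I2 tendsto_scaleR box_bump_tendsto tendsto_const)
          show "AE x in lebesgue. norm (box_bump p q n x *\<^sub>R h x) \<le> norm (h x)" for n
            using box_bump_range[of p q n] by (intro AE_I2) (simp add: mult_left_le_one_le)
        qed (use h meas in \<open>auto intro!: borel_measurable_scaleR borel_measurable_indicator\<close>)
        then have "(\<integral>x. indicator (box p q) x *\<^sub>R h x \<partial>lebesgue) = 0"
          using test0 by (simp add: LIMSEQ_const_iff)
        moreover have "indicator (box c d) x *\<^sub>R (indicator (box a b) x *\<^sub>R h x) = indicator (box p q) x *\<^sub>R h x" for x
          using pq by (auto simp: indicator_def)
        ultimately show ?thesis by (simp only:)
      qed
    qed
    then have "AE x in lebesgue. indicator (box a b) x *\<^sub>R h x = 0"
      by (intro AE_zero_if_box_integrals_zero integrable_mult_indicator h) auto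
    moreover have "AE x in lebesgue. x \<notin> cbox a b - box a b"
      using negligible_frontier_interval[of a b] by (intro AE_not_in) (simp add: negligible_iff_null_sets)
    ultimately show ?thesis
      by eventually_elim (auto simp: h_def indicator_def split: if_splits)
  qed
  obtain D where D: "countable D" "D \<subseteq> Pow U" "\<And>X. X \<in> D \<Longrightarrow> \<exists>a b. X = cbox a b" "\<Union>D = U"
    using open_countable_Union_open_cbox[OF U] by metis
  have "AE x in lebesgue. \<forall>X\<in>D. x \<in> X \<longrightarrow> g x = 0"
    unfolding AE_ball_countable[OF D(1)] using D(2,3) cbox by blast
  then have "AE x in lebesgue. x \<in> U \<longrightarrow> g x = 0"
    by eventually_elim (use D(4) in blast)
  then show ?thesis using Ul by (subst AE_restrict_space_iff) auto
qed

section \<open>Integration by parts\<close>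

lemma integral_lborel_translation:
  fixes f :: "'a::euclidean_space \<Rightarrow> 'b::euclidean_space"
  assumes "f \<in> borel_measurable borel"
  shows "(\<integral>x. f (x + h) \<partial>lborel) = (\<integral>x. f x \<partial>lborel)"
proof -
  have "(\<integral>x. f x \<partial>lborel) = (\<integral>x. f x \<partial>distr lborel borel ((+) h))"
    by (simp add: lborel_distr_plus)
  also have "\<dots> = (\<integral>x. f (h + x) \<partial>lborel)"
    using assms by (subst integral_distr) auto
  finally show ?thesis by (simp add: add.commute)
qed

lemma integrable_continuous_compact_support:
  fixes f :: "'a::euclidean_space \<Rightarrow> 'b::euclidean_space"
  assumes "continuous_on UNIV f" "compact K" "\<And>x. x \<notin> K \<Longrightarrow> f x = 0"
  shows "integrable lborel f"
proof -
  have "integrable lborel (\<lambda>x. indicator K x *\<^sub>R f x)"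
    using borel_integrable_compact[OF assms(2), of f] continuous_on_subset[OF assms(1)]
    by (simp add: set_integrable_def)
  moreover have "(\<lambda>x. indicator K x *\<^sub>R f x) = f"
    using assms(3) by (auto simp: indicator_def)
  ultimately show ?thesis by simp
qed

text \<open>
  By translation invariance every difference quotient of \<open>F\<close> has integral zero.  The quotients are
  bounded by the supremum of the derivative and live on a fixed compact set, so the integral of
  their limit is zero as well.
\<close>

lemma integral_partial_deriv_compact_support:
  fixes F :: "'a::euclidean_space \<Rightarrow> 'b::euclidean_space"
  assumes d: "\<And>x. F differentiable (at x)" and c: "continuous_on UNIV (partial_deriv e F)"
    and K: "compact K" "\<And>x. x \<notin> K \<Longrightarrow> F x = 0" and e: "e \<in> Basis"
  shows "(\<integral>x. partial_deriv e F x \<partial>lborel) = 0"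
proof -
  have cF: "continuous_on UNIV F"
    using d by (intro continuous_at_imp_continuous_on) (auto intro: differentiable_imp_continuous_within)
  have Fi: "integrable lborel F" using integrable_continuous_compact_support[OF cF K] .
  have supp: "partial_deriv e F x = 0" if "x \<notin> K" for x
  proof -
    have "{x. F x \<noteq> 0} \<subseteq> K" using K(2) by blast
    then have "closure {x. F x \<noteq> 0} \<subseteq> K"
      by (rule closure_minimal) (use K(1) compact_imp_closed in blast)
    then show ?thesis using partial_deriv_support[of e F] that by blast
  qed
  have line: "((\<lambda>t. F (x + t *\<^sub>R e)) has_vector_derivative partial_deriv e F (x + t *\<^sub>R e)) (at t within S)" for x t S
  proof -
    let ?D = "frechet_derivative F (at (x + t *\<^sub>R e))"
    have "(F has_derivative ?D) (at (x + t *\<^sub>R e))"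
      using d frechet_derivative_works by blast
    moreover have "((\<lambda>t. x + t *\<^sub>R e) has_derivative (\<lambda>s. s *\<^sub>R e)) (at t within S)"
      by (auto intro!: derivative_eq_intros)
    ultimately have "((\<lambda>t. F (x + t *\<^sub>R e)) has_derivative (\<lambda>s. ?D (s *\<^sub>R e))) (at t within S)"
      by (rule has_derivative_compose[rotated])
    moreover have "linear ?D" using d by (rule linear_frechet_derivative)
    ultimately show ?thesis
      by (simp add: has_vector_derivative_def partial_deriv_def linear_scale)
  qed
  have "bounded (partial_deriv e F ` K)"
    using K(1) c by (intro compact_imp_bounded compact_continuous_image continuous_on_subset[OF c]) auto
  then obtain B where B: "\<And>x. x \<in> K \<Longrightarrow> norm (partial_deriv e F x) \<le> B" and "B > 0"
    unfolding bounded_pos by blast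
  then have B': "norm (partial_deriv e F x) \<le> B" for x
    using supp[of x] by (cases "x \<in> K") auto
  let ?h = "\<lambda>n. 1 / real (Suc n)"
  \<comment> \<open>All step sizes are at most \<open>1\<close>, so this set contains the supports of all quotients.\<close>
  define K' where "K' = {x + y | x y. x \<in> K \<and> y \<in> cball (0::'a) 1}"
  have K': "compact K'" unfolding K'_def by (intro compact_sums K compact_cball)
  let ?q = "\<lambda>n x. (F (x + ?h n *\<^sub>R e) - F x) /\<^sub>R ?h n"
  have lim: "(\<lambda>n. ?q n x) \<longlonglongrightarrow> partial_deriv e F x" for x
  proof -
    have "(\<lambda>t. norm (F (x + t *\<^sub>R e) - F x - t *\<^sub>R partial_deriv e F x) / norm t) \<midarrow>0\<rightarrow> 0"
      using line[of x 0 UNIV] unfolding has_vector_derivative_def has_derivative_at by simp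
    moreover have "norm (F (x + t *\<^sub>R e) - F x - t *\<^sub>R partial_deriv e F x) / norm t
        = norm ((F (x + t *\<^sub>R e) - F x) /\<^sub>R t - partial_deriv e F x)" if "t \<noteq> 0" for t
    proof -
      have "(F (x + t *\<^sub>R e) - F x) /\<^sub>R t - partial_deriv e F x
          = (F (x + t *\<^sub>R e) - F x - t *\<^sub>R partial_deriv e F x) /\<^sub>R t"
        using that by (simp add: scaleR_diff_right)
      then show ?thesis by (simp add: divide_inverse mult.commute)
    qed
    then have "\<forall>\<^sub>F t in at 0. norm (F (x + t *\<^sub>R e) - F x - t *\<^sub>R partial_deriv e F x) / norm t
        = norm ((F (x + t *\<^sub>R e) - F x) /\<^sub>R t - partial_deriv e F x)"
      by (auto simp: eventually_at_filter)
    ultimately have "(\<lambda>t. norm ((F (x + t *\<^sub>R e) - F x) /\<^sub>R t - partial_deriv e F x)) \<midarrow>0\<rightarrow> 0"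
      by (rule Lim_transform_eventually)
    then have "(\<lambda>t. (F (x + t *\<^sub>R e) - F x) /\<^sub>R t) \<midarrow>0\<rightarrow> partial_deriv e F x"
      by (rule LIM_zero_cancel[OF tendsto_norm_zero_cancel])
    moreover have "filterlim ?h (at 0) sequentially"
      using LIMSEQ_inverse_real_of_nat by (intro filterlim_atI) (auto simp: inverse_eq_divide)
    ultimately show ?thesis by (rule filterlim_compose)
  qed
  have bound: "norm (?q n x) \<le> B" for n x
  proof -
    have "norm (F (x + ?h n *\<^sub>R e) - F (x + 0 *\<^sub>R e)) \<le> B * norm (?h n - 0)"
    proof (rule differentiable_bound[of UNIV "\<lambda>t. F (x + t *\<^sub>R e)" "\<lambda>t s. s *\<^sub>R partial_deriv e F (x + t *\<^sub>R e)"])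
      show "onorm (\<lambda>s. s *\<^sub>R partial_deriv e F (x + t *\<^sub>R e)) \<le> B" for t
        using B'[of "x + t *\<^sub>R e"] by (intro onorm_le) (simp add: mult.commute[of B] mult_left_mono)
    qed (use line in \<open>auto simp: has_vector_derivative_def\<close>)
    then have "norm (F (x + ?h n *\<^sub>R e) - F x) / ?h n \<le> B"
      by (subst pos_divide_le_eq) (auto simp del: of_nat_Suc)
    moreover have "norm (?q n x) = norm (F (x + ?h n *\<^sub>R e) - F x) / ?h n"
      by (simp add: divide_inverse mult.commute)
    ultimately show ?thesis by (simp only:)
  qed
  have outside: "x \<notin> K" "x + ?h n *\<^sub>R e \<notin> K" if "x \<notin> K'" for x n
  proof -
    have "x = x + 0" "x = (x + ?h n *\<^sub>R e) + (- ?h n *\<^sub>R e)" by auto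
    moreover have "0 \<in> cball (0::'a) 1" "- ?h n *\<^sub>R e \<in> cball 0 1"
      using e by auto
    ultimately show "x \<notin> K" "x + ?h n *\<^sub>R e \<notin> K" using that unfolding K'_def by blast+
  qed
  have shift: "continuous_on UNIV (\<lambda>x. F (x + ?h n *\<^sub>R e))" for n
    by (intro continuous_on_compose2[OF cF] continuous_intros) auto
  have "(\<lambda>n. \<integral>x. ?q n x \<partial>lborel) \<longlonglongrightarrow> (\<integral>x. partial_deriv e F x \<partial>lborel)"
  proof (rule integral_dominated_convergence[where w = "\<lambda>x. B * indicator K' x"])
    show "integrable lborel (\<lambda>x. B * indicator K' x)"
      using K' emeasure_bounded_finite[OF compact_imp_bounded[OF K']]
      by (intro integrable_mult_right integrable_real_indicator) (auto intro: borel_compact)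
    show "AE x in lborel. norm (?q n x) \<le> B * indicator K' x" for n
    proof (intro AE_I2)
      fix x
      show "norm (?q n x) \<le> B * indicator K' x"
      proof (cases "x \<in> K'")
        case True
        then show ?thesis using bound[of n x] by simp
      next
        case False
        then show ?thesis using outside(1)[OF False] outside(2)[OF False, of n] K(2) by simp
      qed
    qed
    show "AE x in lborel. (\<lambda>n. ?q n x) \<longlonglongrightarrow> partial_deriv e F x" using lim by simp
    show "partial_deriv e F \<in> borel_measurable lborel"
      using borel_measurable_continuous_onI[OF c] by simp
    show "?q n \<in> borel_measurable lborel" for n
      by (intro borel_measurable_scaleR borel_measurable_diff)
        (auto intro: borel_measurable_continuous_onI cF shift[simplified])
  qed
  moreover have "(\<integral>x. ?q n x \<partial>lborel) = 0" for n
  proof -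
    have meas: "F \<in> borel_measurable borel" using cF by (rule borel_measurable_continuous_onI)
    have "integrable lborel (\<lambda>x. F (x + ?h n *\<^sub>R e))"
      by (rule integrable_continuous_compact_support[OF shift K']) (use outside K(2) in blast)
    then show ?thesis using Fi integral_lborel_translation[OF meas, where h="?h n *\<^sub>R e"] by simp
  qed
  ultimately show ?thesis by (simp add: LIMSEQ_const_iff)
qed


section \<open>Weak derivatives\<close>

lemma locally_integrable_iff:
  "locally_integrable U f \<longleftrightarrow>
    (\<forall>K. compact K \<and> K \<subseteq> U \<longrightarrow> integrable lebesgue (\<lambda>x. indicator K x *\<^sub>R f x))"
proof -
  have "integrable (lebesgue_on K) f \<longleftrightarrow> integrable lebesgue (\<lambda>x. indicator K x *\<^sub>R f x)"
    if "compact K" for K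
    by (rule integrable_restrict_space) (use lmeasurable_compact[OF that] in auto)
  then show ?thesis unfolding locally_integrable_def by auto
qed

lemma locally_integrable_linear:
  "bounded_linear A \<Longrightarrow> locally_integrable U f \<Longrightarrow> locally_integrable U (\<lambda>x. A (f x))"
  unfolding locally_integrable_def by (auto intro: integrable_bounded_linear)

lemma locally_integrable_add:
  "locally_integrable U f \<Longrightarrow> locally_integrable U g \<Longrightarrow> locally_integrable U (\<lambda>x. f x + g x)"
  unfolding locally_integrable_def by auto

lemma locally_integrable_diff:
  "locally_integrable U f \<Longrightarrow> locally_integrable U g \<Longrightarrow> locally_integrable U (\<lambda>x. f x - g x)"
  unfolding locally_integrable_def by auto

lemma AE_lebesgue_on_iff:
  "U \<in> sets lebesgue \<Longrightarrow> (AE x in lebesgue_on U. P x) \<longleftrightarrow> (AE x in lebesgue. x \<in> U \<longrightarrow> P x)"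
  by (rule AE_restrict_space_iff) simp

text \<open>Lebesgue measure is complete, so measurability passes to functions that agree almost everywhere.\<close>

lemma measurable_lebesgue_on_cong_AE:
  fixes f g :: "'a::euclidean_space \<Rightarrow> 'b::euclidean_space"
  assumes U: "U \<in> sets lebesgue" and f: "f \<in> borel_measurable (lebesgue_on U)"
    and ae: "AE x in lebesgue_on U. f x = g x"
  shows "g \<in> borel_measurable (lebesgue_on U)"
proof -
  have "(\<lambda>x. if x \<in> U then f x else 0) \<in> borel_measurable lebesgue"
    using f U by (simp add: borel_measurable_if)
  moreover have "AE x in lebesgue. (if x \<in> U then f x else 0) = (if x \<in> U then g x else 0)"
    using ae unfolding AE_lebesgue_on_iff[OF U] by eventually_elim auto
  ultimately have "(\<lambda>x. if x \<in> U then g x else 0) \<in> borel_measurable lebesgue"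
    by (rule borel_measurable_AE)
  then show ?thesis using U by (simp add: borel_measurable_if)
qed

lemma locally_integrable_cong_AE:
  fixes f g :: "'a::euclidean_space \<Rightarrow> 'b::euclidean_space"
  assumes U: "U \<in> sets lebesgue" and f: "locally_integrable U f"
    and ae: "AE x in lebesgue_on U. f x = g x"
  shows "locally_integrable U g"
  unfolding locally_integrable_iff
proof (intro allI impI)
  fix K assume K: "compact K \<and> K \<subseteq> U"
  have i: "integrable lebesgue (\<lambda>x. indicator K x *\<^sub>R f x)"
    using f K unfolding locally_integrable_iff by blast
  have ae': "AE x in lebesgue. indicator K x *\<^sub>R f x = indicator K x *\<^sub>R g x"
    using ae unfolding AE_lebesgue_on_iff[OF U] by eventually_elim (use K in \<open>auto simp: indicator_def\<close>)
  have m: "(\<lambda>x. indicator K x *\<^sub>R f x) \<in> borel_measurable lebesgue" using i by auto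
  show "integrable lebesgue (\<lambda>x. indicator K x *\<^sub>R g x)"
    using i integrable_cong_AE[OF m borel_measurable_AE[OF m ae'] ae'] by blast
qed

lemma test_function_scaleR_integrable:
  fixes f :: "'a::euclidean_space \<Rightarrow> 'b::euclidean_space"
  assumes U: "U \<in> sets lebesgue" and \<phi>: "\<phi> \<in> test_functions U" and f: "locally_integrable U f"
  shows "integrable (lebesgue_on U) (\<lambda>x. \<phi> x *\<^sub>R f x)"
proof -
  define K where "K = closure {x. \<phi> x \<noteq> 0}"
  have K: "compact K" "K \<subseteq> U" using \<phi> by (auto simp: K_def test_functions_def)
  have \<phi>0: "\<phi> x = 0" if "x \<notin> K" for x
    using test_functions_zero_outside[OF \<phi>] that K_def by blast
  have c: "continuous_on UNIV \<phi>" using \<phi> by (rule test_functions_continuous)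
  have "bounded (\<phi> ` K)"
    using K by (intro compact_imp_bounded compact_continuous_image continuous_on_subset[OF c]) auto
  then obtain B where B: "\<And>x. x \<in> K \<Longrightarrow> norm (\<phi> x) \<le> B" and "B > 0"
    unfolding bounded_pos by blast
  have Kf: "integrable lebesgue (\<lambda>x. indicator K x *\<^sub>R f x)"
    using f K unfolding locally_integrable_iff by blast
  have "integrable lebesgue (\<lambda>x. \<phi> x *\<^sub>R (indicator K x *\<^sub>R f x))"
  proof (rule Bochner_Integration.integrable_bound)
    show "integrable lebesgue (\<lambda>x. B *\<^sub>R (indicator K x *\<^sub>R f x))" using Kf by (rule integrable_scaleR_right)
    have "\<phi> \<in> borel_measurable lebesgue"
      using c by (intro measurable_completion) (auto intro: borel_measurable_continuous_onI)
    then show "(\<lambda>x. \<phi> x *\<^sub>R (indicator K x *\<^sub>R f x)) \<in> borel_measurable lebesgue"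
      using borel_measurable_integrable[OF Kf] by (rule borel_measurable_scaleR)
    show "AE x in lebesgue. norm (\<phi> x *\<^sub>R (indicator K x *\<^sub>R f x)) \<le> norm (B *\<^sub>R (indicator K x *\<^sub>R f x))"
      using B \<open>B > 0\<close> by (intro AE_I2) (auto simp: indicator_def intro: mult_right_mono)
  qed
  also have "(\<lambda>x. \<phi> x *\<^sub>R (indicator K x *\<^sub>R f x)) = (\<lambda>x. indicator U x *\<^sub>R (\<phi> x *\<^sub>R f x))"
    using K \<phi>0 by (auto simp: indicator_def fun_eq_iff)
  finally show ?thesis using U by (subst integrable_restrict_space) auto
qed

lemma has_weak_deriv_locally_integrable:
  assumes "has_weak_deriv U \<alpha> f g"
  shows "locally_integrable U f" "locally_integrable U g"
  using assms by (auto simp: has_weak_deriv_def)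

lemma has_weak_derivD:
  assumes "has_weak_deriv U \<alpha> f g" "\<phi> \<in> test_functions U" "mset es = \<alpha>"
  shows "(\<integral>x. foldr partial_deriv es \<phi> x *\<^sub>R f x \<partial>lebesgue_on U) =
    (- 1) ^ size \<alpha> *\<^sub>R (\<integral>x. \<phi> x *\<^sub>R g x \<partial>lebesgue_on U)"
  using assms by (auto simp: has_weak_deriv_def)

text \<open>
  Any enumeration of \<open>\<alpha>\<close> shows that both candidates have the same integral against every test
  function.
\<close>

lemma has_weak_deriv_unique:
  fixes f :: "'a::euclidean_space \<Rightarrow> 'b::euclidean_space"
  assumes U: "open U" and g: "has_weak_deriv U \<alpha> f g" and h: "has_weak_deriv U \<alpha> f h"
  shows "AE x in lebesgue_on U. g x = h x"
proof -
  have Ul: "U \<in> sets lebesgue" using U by auto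
  note li = has_weak_deriv_locally_integrable[OF g] has_weak_deriv_locally_integrable[OF h]
  obtain es where es: "mset es = \<alpha>" using ex_mset by blast
  have "AE x in lebesgue_on U. g x - h x = 0"
  proof (rule fundamental_lemma[OF U])
    show "locally_integrable U (\<lambda>x. g x - h x)" using li by (intro locally_integrable_diff)
    fix \<phi> :: "'a \<Rightarrow> real" assume \<phi>: "\<phi> \<in> test_functions U"
    have "(- 1) ^ size \<alpha> *\<^sub>R (\<integral>x. \<phi> x *\<^sub>R g x \<partial>lebesgue_on U)
        = (- 1) ^ size \<alpha> *\<^sub>R (\<integral>x. \<phi> x *\<^sub>R h x \<partial>lebesgue_on U)"
      using has_weak_derivD[OF g \<phi> es] has_weak_derivD[OF h \<phi> es] by simp
    then have "(\<integral>x. \<phi> x *\<^sub>R g x \<partial>lebesgue_on U) = (\<integral>x. \<phi> x *\<^sub>R h x \<partial>lebesgue_on U)" by simp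
    then show "(\<integral>x. \<phi> x *\<^sub>R (g x - h x) \<partial>lebesgue_on U) = 0"
      using test_function_scaleR_integrable[OF Ul \<phi> li(2)] test_function_scaleR_integrable[OF Ul \<phi> li(4)]
      by (simp add: scaleR_diff_right)
  qed
  then show ?thesis by eventually_elim simp
qed

lemma has_weak_deriv_weak_deriv:
  "has_weak_deriv U \<alpha> f g \<Longrightarrow> has_weak_deriv U \<alpha> f (weak_deriv U \<alpha> f)"
  unfolding weak_deriv_def by (rule someI[where P = "has_weak_deriv U \<alpha> f"])

lemma weak_deriv_AE:
  "open U \<Longrightarrow> has_weak_deriv U \<alpha> f g \<Longrightarrow> AE x in lebesgue_on U. weak_deriv U \<alpha> f x = g x"
  by (rule has_weak_deriv_unique[OF _ has_weak_deriv_weak_deriv])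

lemma integral_cong_AE_lebesgue_on:
  fixes f g :: "'a::euclidean_space \<Rightarrow> 'b::euclidean_space"
  assumes U: "U \<in> sets lebesgue" and ae: "AE x in lebesgue_on U. f x = g x"
  shows "(\<integral>x. f x \<partial>lebesgue_on U) = (\<integral>x. g x \<partial>lebesgue_on U)"
proof (cases "f \<in> borel_measurable (lebesgue_on U)")
  case True
  then show ?thesis using measurable_lebesgue_on_cong_AE[OF U True ae] ae by (rule integral_cong_AE)
next
  case False
  have "AE x in lebesgue_on U. g x = f x" using ae by eventually_elim simp
  then have "g \<notin> borel_measurable (lebesgue_on U)"
    using False measurable_lebesgue_on_cong_AE[OF U] by blast
  then show ?thesis using False borel_measurable_integrable not_integrable_integral_eq by metis
qed

lemma has_weak_deriv_cong_AE:
  fixes f g :: "'a::euclidean_space \<Rightarrow> 'b::euclidean_space"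
  assumes U: "U \<in> sets lebesgue" and w: "has_weak_deriv U \<alpha> f g"
    and f: "AE x in lebesgue_on U. f x = f' x" and g: "AE x in lebesgue_on U. g x = g' x"
  shows "has_weak_deriv U \<alpha> f' g'"
proof -
  have "(\<integral>x. \<psi> x *\<^sub>R f x \<partial>lebesgue_on U) = (\<integral>x. \<psi> x *\<^sub>R f' x \<partial>lebesgue_on U)" for \<psi> :: "'a \<Rightarrow> real"
    by (rule integral_cong_AE_lebesgue_on[OF U]) (use f in \<open>eventually_elim, simp\<close>)
  moreover have "(\<integral>x. \<psi> x *\<^sub>R g x \<partial>lebesgue_on U) = (\<integral>x. \<psi> x *\<^sub>R g' x \<partial>lebesgue_on U)" for \<psi> :: "'a \<Rightarrow> real"
    by (rule integral_cong_AE_lebesgue_on[OF U]) (use g in \<open>eventually_elim, simp\<close>)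
  ultimately show ?thesis
    using w locally_integrable_cong_AE[OF U _ f] locally_integrable_cong_AE[OF U _ g]
    by (simp add: has_weak_deriv_def)
qed

lemma has_weak_deriv_linear:
  fixes f :: "'a::euclidean_space \<Rightarrow> 'b::euclidean_space"
  assumes U: "U \<in> sets lebesgue" and \<alpha>: "set_mset \<alpha> \<subseteq> Basis"
    and A: "bounded_linear A" and w: "has_weak_deriv U \<alpha> f g"
  shows "has_weak_deriv U \<alpha> (\<lambda>x. A (f x)) (\<lambda>x. A (g x))"
proof -
  note li = has_weak_deriv_locally_integrable[OF w]
  interpret A: bounded_linear A by fact
  have pull: "(\<integral>x. \<psi> x *\<^sub>R A (h x) \<partial>lebesgue_on U) = A (\<integral>x. \<psi> x *\<^sub>R h x \<partial>lebesgue_on U)"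
    if "\<psi> \<in> test_functions U" "locally_integrable U h" for \<psi> h
    using integral_bounded_linear[OF A test_function_scaleR_integrable[OF U that]]
    by (simp add: A.scaleR)
  have "(\<integral>x. foldr partial_deriv es \<phi> x *\<^sub>R A (f x) \<partial>lebesgue_on U) =
      (- 1) ^ size \<alpha> *\<^sub>R (\<integral>x. \<phi> x *\<^sub>R A (g x) \<partial>lebesgue_on U)"
    if "\<phi> \<in> test_functions U" "mset es = \<alpha>" for \<phi> es
  proof -
    have "set es \<subseteq> Basis" using that \<alpha> by auto
    then show ?thesis
      using test_functions_foldr[OF that(1)] that li has_weak_derivD[OF w that]
      by (simp add: pull A.scaleR)
  qed
  then show ?thesis unfolding has_weak_deriv_def
    using locally_integrable_linear[OF A] li by blast
qed

lemma has_weak_deriv_add: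
  fixes f :: "'a::euclidean_space \<Rightarrow> 'b::euclidean_space"
  assumes U: "U \<in> sets lebesgue" and \<alpha>: "set_mset \<alpha> \<subseteq> Basis"
    and w: "has_weak_deriv U \<alpha> f g" and w': "has_weak_deriv U \<alpha> f' g'"
  shows "has_weak_deriv U \<alpha> (\<lambda>x. f x + f' x) (\<lambda>x. g x + g' x)"
proof -
  note li = has_weak_deriv_locally_integrable[OF w] has_weak_deriv_locally_integrable[OF w']
  have "(\<integral>x. foldr partial_deriv es \<phi> x *\<^sub>R (f x + f' x) \<partial>lebesgue_on U) =
      (- 1) ^ size \<alpha> *\<^sub>R (\<integral>x. \<phi> x *\<^sub>R (g x + g' x) \<partial>lebesgue_on U)"
    if \<phi>: "\<phi> \<in> test_functions U" and es: "mset es = \<alpha>" for \<phi> es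
  proof -
    have "set es \<subseteq> Basis" using es \<alpha> by auto
    then have \<psi>: "foldr partial_deriv es \<phi> \<in> test_functions U" by (rule test_functions_foldr[OF \<phi>])
    show ?thesis
      using has_weak_derivD[OF w \<phi> es] has_weak_derivD[OF w' \<phi> es]
        test_function_scaleR_integrable[OF U \<psi> li(1)] test_function_scaleR_integrable[OF U \<psi> li(3)]
        test_function_scaleR_integrable[OF U \<phi> li(2)] test_function_scaleR_integrable[OF U \<phi> li(4)]
      by (simp add: scaleR_add_right)
  qed
  then show ?thesis unfolding has_weak_deriv_def
    using locally_integrable_add li by blast
qed

text \<open>
  Testing \<open>w\<close> against the test function \<open>D\<^sup>\<beta> \<phi>\<close> is testing \<open>f\<close> against \<open>\<partial>\<^sub>e D\<^sup>\<beta> \<phi>\<close>.  The definition of a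
  weak derivative ranges over all enumerations of the multi-index, in particular over those that
  begin with \<open>e\<close>.
\<close>

lemma has_weak_deriv_shift:
  assumes \<beta>: "set_mset \<beta> \<subseteq> Basis" and w: "has_weak_deriv U {#e#} f w"
    and g: "has_weak_deriv U (add_mset e \<beta>) f g"
  shows "has_weak_deriv U \<beta> w g"
proof -
  have "(\<integral>x. foldr partial_deriv es \<phi> x *\<^sub>R w x \<partial>lebesgue_on U) =
      (- 1) ^ size \<beta> *\<^sub>R (\<integral>x. \<phi> x *\<^sub>R g x \<partial>lebesgue_on U)"
    if \<phi>: "\<phi> \<in> test_functions U" and es: "mset es = \<beta>" for \<phi> es
  proof -
    have "set es \<subseteq> Basis" using es \<beta> by auto
    then have \<psi>: "foldr partial_deriv es \<phi> \<in> test_functions U" by (rule test_functions_foldr[OF \<phi>])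
    show ?thesis
      using has_weak_derivD[OF w \<psi>, of "[e]"] has_weak_derivD[OF g \<phi>, of "e # es"] es
      by simp
  qed
  then show ?thesis unfolding has_weak_deriv_def
    using has_weak_deriv_locally_integrable[OF w] has_weak_deriv_locally_integrable[OF g] by blast
qed

lemma has_weak_deriv_empty: "locally_integrable U f \<Longrightarrow> has_weak_deriv U {#} f f"
  by (simp add: has_weak_deriv_def)

lemma locally_integrable_continuous:
  fixes f :: "'a::euclidean_space \<Rightarrow> 'b::euclidean_space"
  assumes "continuous_on U f"
  shows "locally_integrable U f"
  unfolding locally_integrable_iff
proof (intro allI impI)
  fix K assume K: "compact K \<and> K \<subseteq> U"
  then have "integrable lborel (\<lambda>x. indicator K x *\<^sub>R f x)"
    using borel_integrable_compact[of K f] continuous_on_subset[OF assms]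
    by (simp add: set_integrable_def)
  then show "integrable lebesgue (\<lambda>x. indicator K x *\<^sub>R f x)"
    by (subst integrable_completion) auto
qed

text \<open>
  A test function cuts \<open>f\<close> off to a compactly supported function on the whole space; the product
  rule and the vanishing integral of its derivative are integration by parts.
\<close>

lemma has_weak_deriv_classical:
  fixes f :: "'a::euclidean_space \<Rightarrow> 'b::euclidean_space"
  assumes U: "open U" and e: "e \<in> Basis" and d: "\<And>x. x \<in> U \<Longrightarrow> f differentiable (at x)"
    and c: "continuous_on U (partial_deriv e f)"
  shows "has_weak_deriv U {#e#} f (partial_deriv e f)"
proof -
  have Ul: "U \<in> sets lebesgue" using U by auto
  have cf: "continuous_on U f"
    using d by (intro continuous_at_imp_continuous_on) (auto intro: differentiable_imp_continuous_within)
  have li: "locally_integrable U f" "locally_integrable U (partial_deriv e f)"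
    using cf c by (auto intro: locally_integrable_continuous)
  have "(\<integral>x. partial_deriv e \<phi> x *\<^sub>R f x \<partial>lebesgue_on U) =
      - (\<integral>x. \<phi> x *\<^sub>R partial_deriv e f x \<partial>lebesgue_on U)"
    if \<phi>: "\<phi> \<in> test_functions U" for \<phi>
  proof -
    define K where "K = closure {x. \<phi> x \<noteq> 0}"
    have K: "compact K" "K \<subseteq> U" using \<phi> by (auto simp: K_def test_functions_def)
    then have oK: "open (- K)" by (simp add: compact_imp_closed open_Compl)
    have cov: "U \<union> - K = UNIV" using K by blast
    have \<phi>0: "\<phi> x = 0" if "x \<notin> K" for x
      using test_functions_zero_outside[OF \<phi>] that K_def by blast
    have dphi0: "partial_deriv e \<phi> x = 0" if "x \<notin> K" for x
      using partial_deriv_support[of e \<phi>] that K_def by blast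
    have dphi: "partial_deriv e \<phi> \<in> test_functions U" using \<phi> e by (rule test_functions_partial_deriv)
    define F where "F x = (if x \<in> U then \<phi> x *\<^sub>R f x else 0)" for x
    define G where "G x = (if x \<in> U then \<phi> x *\<^sub>R partial_deriv e f x + partial_deriv e \<phi> x *\<^sub>R f x else 0)" for x
    have F0: "F x = 0" if "x \<notin> K" for x using \<phi>0 that by (simp add: F_def)
    have FU: "F differentiable (at x) \<and> partial_deriv e F x = G x" if "x \<in> U" for x
    proof -
      have "((\<lambda>x. \<phi> x *\<^sub>R f x) has_derivative
          (\<lambda>h. \<phi> x *\<^sub>R frechet_derivative f (at x) h + frechet_derivative \<phi> (at x) h *\<^sub>R f x)) (at x)"
        using d[OF that] test_functions_differentiable[OF \<phi>, of x]
        unfolding frechet_derivative_works by (rule has_derivative_scaleR[rotated])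
      then have "(F has_derivative
          (\<lambda>h. \<phi> x *\<^sub>R frechet_derivative f (at x) h + frechet_derivative \<phi> (at x) h *\<^sub>R f x)) (at x)"
        by (rule has_derivative_transform_within_open[OF _ U that]) (simp add: F_def)
      from this partial_deriv_eqI[OF this] show ?thesis
        using that by (auto simp: G_def partial_deriv_def differentiable_def)
    qed
    have FK: "F differentiable (at x) \<and> partial_deriv e F x = G x" if "x \<notin> K" for x
    proof -
      have "(F has_derivative (\<lambda>_. 0)) (at x)"
        by (rule has_derivative_transform_within_open[OF has_derivative_const oK]) (use that F0 in auto)
      from this partial_deriv_eqI[OF this] show ?thesis
        using that \<phi>0 dphi0 by (auto simp: G_def differentiable_def)
    qed
    have FG: "F differentiable (at x)" "partial_deriv e F = G" for x
      using FU FK cov by blast+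
    have "continuous_on U G"
    proof -
      have "continuous_on U (\<lambda>x. \<phi> x *\<^sub>R partial_deriv e f x + partial_deriv e \<phi> x *\<^sub>R f x)"
        using test_functions_continuous[OF \<phi>] test_functions_continuous[OF dphi]
        by (intro continuous_intros c cf) (auto intro: continuous_on_subset)
      then show ?thesis by (subst continuous_on_cong[OF refl]) (auto simp: G_def)
    qed
    moreover have "continuous_on (- K) G"
    proof -
      have "G x = 0" if "x \<in> - K" for x using \<phi>0 dphi0 that by (simp add: G_def)
      then show ?thesis using continuous_on_cong[of "- K" "- K" G "\<lambda>_. 0"] by simp
    qed
    ultimately have cG: "continuous_on UNIV G"
      using continuous_on_open_Un[OF U oK] cov by simp
    have "(\<integral>x. G x \<partial>lborel) = 0"
      using integral_partial_deriv_compact_support[OF FG(1) _ K(1) F0 e] cG FG(2) by simp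
    then have "(\<integral>x. G x \<partial>lebesgue) = 0"
      using borel_measurable_continuous_onI[OF cG] by (simp add: integral_completion)
    moreover have "G = (\<lambda>x. indicator U x *\<^sub>R (\<phi> x *\<^sub>R partial_deriv e f x + partial_deriv e \<phi> x *\<^sub>R f x))"
      by (auto simp: G_def fun_eq_iff)
    ultimately have "(\<integral>x. \<phi> x *\<^sub>R partial_deriv e f x + partial_deriv e \<phi> x *\<^sub>R f x \<partial>lebesgue_on U) = 0"
      using Ul by (simp add: integral_restrict_space)
    then show ?thesis
      using test_function_scaleR_integrable[OF Ul \<phi> li(2)] test_function_scaleR_integrable[OF Ul dphi li(1)]
      by (simp add: eq_neg_iff_add_eq_0 add.commute)
  qed
  then show ?thesis using li by (auto simp: has_weak_deriv_def)
qed


section \<open>The Sobolev norm as a seminorm\<close>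

lemma finite_multi_indices: "finite (multi_indices k :: 'a::euclidean_space multiset set)"
proof -
  have "finite {\<alpha> :: 'a multiset. set_mset \<alpha> \<subseteq> Basis \<and> size \<alpha> = k}"
    using finite_multisets_of_size[of "Basis :: 'a set" k] by (simp add: multisets_of_size_def)
  then show ?thesis by (simp add: multi_indices_def)
qed

lemma multi_indices_subset: "\<alpha> \<in> multi_indices k \<Longrightarrow> set_mset \<alpha> \<subseteq> Basis"
  by (simp add: multi_indices_def)

lemma multi_indices_0: "multi_indices 0 = {{#}}"
  by (auto simp: multi_indices_def)

lemma add_mset_multi_indices:
  "e \<in> Basis \<Longrightarrow> \<beta> \<in> multi_indices k \<Longrightarrow> add_mset e \<beta> \<in> multi_indices (Suc k)"
  by (simp add: multi_indices_def)

text \<open>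
  Weak derivatives are determined only up to null sets, and the chosen representative is not
  linear in the function.  The constructions below therefore work with an explicit family \<open>g \<alpha>\<close> of
  representatives.
\<close>

definition sobolev_derivs ::
  "real \<Rightarrow> 'a::euclidean_space set \<Rightarrow> ('a \<Rightarrow> 'b::euclidean_space) \<Rightarrow> ('a multiset \<Rightarrow> 'a \<Rightarrow> 'b) \<Rightarrow> bool"
  where
  "sobolev_derivs s U f g \<longleftrightarrow>
     (\<forall>k \<le> nat \<lfloor>s\<rfloor>. \<forall>\<alpha>\<in>multi_indices k. has_weak_deriv U \<alpha> f (g \<alpha>) \<and> L2_on U (g \<alpha>)) \<and>
     (frac s \<noteq> 0 \<longrightarrow> (\<forall>\<alpha>\<in>multi_indices (nat \<lfloor>s\<rfloor>). gagliardo (frac s) U (g \<alpha>) < \<infinity>))"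

definition sobolev_energy ::
  "real \<Rightarrow> 'a::euclidean_space set \<Rightarrow> ('a multiset \<Rightarrow> 'a \<Rightarrow> 'b::euclidean_space) \<Rightarrow> real" where
  "sobolev_energy s U g =
     (\<Sum>k \<le> nat \<lfloor>s\<rfloor>. \<Sum>\<alpha>\<in>multi_indices k. \<integral>x. (norm (g \<alpha> x))\<^sup>2 \<partial>lebesgue_on U) +
     (if frac s = 0 then 0
      else \<Sum>\<alpha>\<in>multi_indices (nat \<lfloor>s\<rfloor>). enn2real (gagliardo (frac s) U (g \<alpha>)))"

lemma sobolev_norm_eq_energy:
  "sobolev_norm s U f = sqrt (sobolev_energy s U (\<lambda>\<alpha>. weak_deriv U \<alpha> f))"
  by (simp add: sobolev_norm_def sobolev_energy_def)

lemma sobolev_energy_nonneg: "sobolev_energy s U g \<ge> 0"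
  unfolding sobolev_energy_def by (auto intro!: add_nonneg_nonneg sum_nonneg)

lemma sobolev_norm_nonneg: "sobolev_norm s U f \<ge> 0"
  unfolding sobolev_norm_eq_energy using sobolev_energy_nonneg by simp

lemma L2_on_cong_AE:
  fixes f g :: "'a::euclidean_space \<Rightarrow> 'b::euclidean_space"
  assumes U: "U \<in> sets lebesgue" and f: "L2_on U f" and ae: "AE x in lebesgue_on U. f x = g x"
  shows "L2_on U g"
proof -
  have g: "g \<in> borel_measurable (lebesgue_on U)"
    using measurable_lebesgue_on_cong_AE[OF U _ ae] f by (simp add: L2_on_def)
  have "integrable (lebesgue_on U) (\<lambda>x. (norm (f x))\<^sup>2) \<longleftrightarrow> integrable (lebesgue_on U) (\<lambda>x. (norm (g x))\<^sup>2)"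
  proof (rule integrable_cong_AE)
    show "AE x in lebesgue_on U. (norm (f x))\<^sup>2 = (norm (g x))\<^sup>2" using ae by eventually_elim simp
  qed (use f g in \<open>auto simp: L2_on_def\<close>)
  then show ?thesis using f g by (simp add: L2_on_def)
qed

lemma gagliardo_cong_AE:
  assumes ae: "AE x in lebesgue_on U. f x = g x"
  shows "gagliardo \<sigma> U f = gagliardo \<sigma> U g"
  unfolding gagliardo_def
proof (rule nn_integral_cong_AE)
  show "AE x in lebesgue_on U.
      (\<integral>\<^sup>+y. ennreal ((norm (f x - f y))\<^sup>2 / norm (x - y) powr (real DIM('a) + 2 * \<sigma>)) \<partial>lebesgue_on U) =
      (\<integral>\<^sup>+y. ennreal ((norm (g x - g y))\<^sup>2 / norm (x - y) powr (real DIM('a) + 2 * \<sigma>)) \<partial>lebesgue_on U)"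
    using ae
  proof eventually_elim
    case (elim x)
    show ?case by (rule nn_integral_cong_AE) (use ae in \<open>eventually_elim, simp add: elim\<close>)
  qed
qed

lemma sobolev_energy_cong_AE:
  assumes U: "U \<in> sets lebesgue"
    and ae: "\<And>k \<alpha>. k \<le> nat \<lfloor>s\<rfloor> \<Longrightarrow> \<alpha> \<in> multi_indices k \<Longrightarrow> AE x in lebesgue_on U. g \<alpha> x = h \<alpha> x"
  shows "sobolev_energy s U g = sobolev_energy s U h"
proof -
  have "(\<integral>x. (norm (g \<alpha> x))\<^sup>2 \<partial>lebesgue_on U) = (\<integral>x. (norm (h \<alpha> x))\<^sup>2 \<partial>lebesgue_on U)"
    if "k \<le> nat \<lfloor>s\<rfloor>" "\<alpha> \<in> multi_indices k" for k \<alpha>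
    by (rule integral_cong_AE_lebesgue_on[OF U]) (use ae[OF that] in \<open>eventually_elim, simp\<close>)
  moreover have "gagliardo (frac s) U (g \<alpha>) = gagliardo (frac s) U (h \<alpha>)"
    if "\<alpha> \<in> multi_indices (nat \<lfloor>s\<rfloor>)" for \<alpha>
    by (rule gagliardo_cong_AE) (use ae[OF order_refl that] in simp)
  ultimately show ?thesis by (simp add: sobolev_energy_def)
qed

lemma sobolev_derivs_weak_deriv:
  assumes "f \<in> sobolev s U"
  shows "sobolev_derivs s U f (\<lambda>\<alpha>. weak_deriv U \<alpha> f)"
  using assms has_weak_deriv_weak_deriv[of U _ f] unfolding sobolev_def sobolev_derivs_def by blast

lemma sobolev_derivs_imp_sobolev:
  assumes U: "open U" and g: "sobolev_derivs s U f g"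
  shows "f \<in> sobolev s U" and "sobolev_norm s U f = sqrt (sobolev_energy s U g)"
proof -
  have Ul: "U \<in> sets lebesgue" using U by auto
  have w: "has_weak_deriv U \<alpha> f (g \<alpha>)" "L2_on U (g \<alpha>)"
    if "k \<le> nat \<lfloor>s\<rfloor>" "\<alpha> \<in> multi_indices k" for k \<alpha>
    using g that by (auto simp: sobolev_derivs_def)
  have ae: "AE x in lebesgue_on U. weak_deriv U \<alpha> f x = g \<alpha> x"
    if "k \<le> nat \<lfloor>s\<rfloor>" "\<alpha> \<in> multi_indices k" for k \<alpha>
    by (rule weak_deriv_AE[OF U w(1)[OF that]])
  have ae': "AE x in lebesgue_on U. g \<alpha> x = weak_deriv U \<alpha> f x"
    if "k \<le> nat \<lfloor>s\<rfloor>" "\<alpha> \<in> multi_indices k" for k \<alpha>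
    using ae[OF that] by eventually_elim simp
  have "L2_on U (weak_deriv U \<alpha> f)" if "k \<le> nat \<lfloor>s\<rfloor>" "\<alpha> \<in> multi_indices k" for k \<alpha>
    by (rule L2_on_cong_AE[OF Ul w(2)[OF that] ae'[OF that]])
  moreover have "gagliardo (frac s) U (weak_deriv U \<alpha> f) = gagliardo (frac s) U (g \<alpha>)"
    if "\<alpha> \<in> multi_indices (nat \<lfloor>s\<rfloor>)" for \<alpha>
    by (rule gagliardo_cong_AE[OF ae[OF order_refl that]])
  ultimately show "f \<in> sobolev s U"
    using w g unfolding sobolev_def sobolev_derivs_def by (simp; blast)
  show "sobolev_norm s U f = sqrt (sobolev_energy s U g)"
    unfolding sobolev_norm_eq_energy using sobolev_energy_cong_AE[OF Ul ae] by simp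
qed

lemma sobolev_derivs_cong_AE:
  assumes U: "U \<in> sets lebesgue" and g: "sobolev_derivs s U f g"
    and ae: "AE x in lebesgue_on U. f x = f' x"
  shows "sobolev_derivs s U f' g"
proof -
  have "has_weak_deriv U \<alpha> f' (g \<alpha>)" if "has_weak_deriv U \<alpha> f (g \<alpha>)" for \<alpha>
    by (rule has_weak_deriv_cong_AE[OF U that ae]) simp
  then show ?thesis using g unfolding sobolev_derivs_def by blast
qed

lemma norm_add_square_le:
  fixes a b :: "'a::real_inner"
  assumes "t > 0"
  shows "(norm (a + b))\<^sup>2 \<le> (1 + t) * (norm a)\<^sup>2 + (1 + 1 / t) * (norm b)\<^sup>2"
proof -
  have "0 \<le> (norm (t *\<^sub>R a - b))\<^sup>2 / t" using assms by simp
  also have "(norm (t *\<^sub>R a - b))\<^sup>2 / t = t * (norm a)\<^sup>2 - 2 * (a \<bullet> b) + (norm b)\<^sup>2 / t"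
    using assms unfolding power2_norm_eq_inner
    by (simp add: inner_diff_left inner_diff_right inner_commute[of b a] field_simps)
  finally have "2 * (a \<bullet> b) \<le> t * (norm a)\<^sup>2 + (norm b)\<^sup>2 / t" by simp
  moreover have "(norm (a + b))\<^sup>2 = (norm a)\<^sup>2 + 2 * (a \<bullet> b) + (norm b)\<^sup>2"
    unfolding power2_norm_eq_inner by (simp add: inner_add_left inner_add_right inner_commute[of b a])
  ultimately show ?thesis by (simp add: algebra_simps)
qed

text \<open>
  The weighted estimate \<open>|a + b|\<^sup>2 \<le> (1 + t) |a|\<^sup>2 + (1 + 1/t) |b|\<^sup>2\<close> holds pointwise, and integration
  and summation preserve it.  Optimizing the weight \<open>t\<close> at the end turns it into the triangle
  inequality of the norm, uniformly for the integer and the fractional part.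
\<close>

lemma sqrt_triangle_if_weighted:
  fixes q a b :: real
  assumes "a \<ge> 0" "b \<ge> 0" and q: "\<And>t. t > 0 \<Longrightarrow> q \<le> (1 + t) * a + (1 + 1 / t) * b"
  shows "sqrt q \<le> sqrt a + sqrt b"
proof (rule field_le_epsilon)
  fix \<epsilon> :: real assume "\<epsilon> > 0"
  define x y where "x = sqrt a + \<epsilon> / 2" and "y = sqrt b + \<epsilon> / 2"
  have pos: "x > 0" "y > 0" using assms \<open>\<epsilon> > 0\<close> by (auto simp: x_def y_def add_nonneg_pos)
  have le: "a \<le> x\<^sup>2" "b \<le> y\<^sup>2"
    using assms \<open>\<epsilon> > 0\<close> by (auto simp: x_def y_def intro!: sqrt_le_D)
  \<comment> \<open>The optimal weight is \<open>sqrt b / sqrt a\<close>; the shift by \<open>\<epsilon> / 2\<close> keeps it defined if \<open>a\<close> or \<open>b\<close> is zero.\<close>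
  have "q \<le> (1 + y / x) * a + (1 + 1 / (y / x)) * b" using pos by (intro q) simp
  also have "\<dots> \<le> (1 + y / x) * x\<^sup>2 + (1 + 1 / (y / x)) * y\<^sup>2"
    using pos le by (intro add_mono mult_left_mono) auto
  also have "\<dots> = (x + y)\<^sup>2" using pos by (simp add: power2_eq_square field_simps)
  finally have "sqrt q \<le> x + y" using pos by (simp add: real_le_lsqrt)
  then show "sqrt q \<le> sqrt a + sqrt b + \<epsilon>" by (simp add: x_def y_def)
qed

lemma L2_on_add:
  assumes f: "L2_on U f" and g: "L2_on U g"
  shows "L2_on U (\<lambda>x. f x + g x)"
proof -
  have m: "f \<in> borel_measurable (lebesgue_on U)" "g \<in> borel_measurable (lebesgue_on U)"
    using f g by (auto simp: L2_on_def)
  have "integrable (lebesgue_on U) (\<lambda>x. (norm (f x + g x))\<^sup>2)"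
  proof (rule Bochner_Integration.integrable_bound)
    show "integrable (lebesgue_on U) (\<lambda>x. 2 * (norm (f x))\<^sup>2 + 2 * (norm (g x))\<^sup>2)"
      using f g by (auto simp: L2_on_def)
    show "AE x in lebesgue_on U. norm ((norm (f x + g x))\<^sup>2) \<le> norm (2 * (norm (f x))\<^sup>2 + 2 * (norm (g x))\<^sup>2)"
      using norm_add_square_le[of 1 "f _" "g _"] by (intro AE_I2) simp
  qed (use m in auto)
  then show ?thesis using m by (auto simp: L2_on_def)
qed

lemma L2_on_linear:
  assumes f: "L2_on U f" and A: "bounded_linear A"
  shows "L2_on U (\<lambda>x. A (f x))"
proof -
  obtain B where B: "\<And>w. norm (A w) \<le> norm w * B" "B > 0"
    using bounded_linear.pos_bounded[OF A] by blast
  have "A \<in> borel_measurable borel"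
    using A by (intro borel_measurable_continuous_onI linear_continuous_on)
  moreover have "f \<in> borel_measurable (lebesgue_on U)" using f by (simp add: L2_on_def)
  ultimately have m: "(\<lambda>x. A (f x)) \<in> borel_measurable (lebesgue_on U)"
    by (rule measurable_compose[rotated])
  have "integrable (lebesgue_on U) (\<lambda>x. (norm (A (f x)))\<^sup>2)"
  proof (rule Bochner_Integration.integrable_bound)
    show "integrable (lebesgue_on U) (\<lambda>x. B\<^sup>2 * (norm (f x))\<^sup>2)"
      using f by (auto simp: L2_on_def)
    show "AE x in lebesgue_on U. norm ((norm (A (f x)))\<^sup>2) \<le> norm (B\<^sup>2 * (norm (f x))\<^sup>2)"
    proof (intro AE_I2)
      fix x
      have "(norm (A (f x)))\<^sup>2 \<le> (norm (f x) * B)\<^sup>2" by (rule power_mono[OF B(1)]) simp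
      then show "norm ((norm (A (f x)))\<^sup>2) \<le> norm (B\<^sup>2 * (norm (f x))\<^sup>2)"
        by (simp add: power_mult_distrib mult.commute)
    qed
  qed (use m in auto)
  then show ?thesis using m by (simp add: L2_on_def)
qed

text \<open>The inner integral is measurable because Lebesgue measure on \<open>U\<close> is \<open>\<sigma>\<close>-finite.\<close>

lemma gagliardo_measurable:
  fixes f :: "'a::euclidean_space \<Rightarrow> 'b::euclidean_space"
  assumes U: "U \<in> sets lebesgue" and f[measurable]: "f \<in> borel_measurable (lebesgue_on U)"
  shows "(\<lambda>y. ennreal ((norm (f x - f y))\<^sup>2 / norm (x - y) powr c)) \<in> borel_measurable (lebesgue_on U)"
    and "(\<lambda>x. \<integral>\<^sup>+y. ennreal ((norm (f x - f y))\<^sup>2 / norm (x - y) powr c) \<partial>lebesgue_on U)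
      \<in> borel_measurable (lebesgue_on U)"
proof -
  have id[measurable]: "(\<lambda>y. y) \<in> borel_measurable (lebesgue_on U)"
    using id_borel_measurable_lebesgue_on[of U] by (simp add: id_def)
  show "(\<lambda>y. ennreal ((norm (f x - f y))\<^sup>2 / norm (x - y) powr c)) \<in> borel_measurable (lebesgue_on U)"
    by measurable
  have [measurable]: "(\<lambda>z. fst z) \<in> borel_measurable (lebesgue_on U \<Otimes>\<^sub>M lebesgue_on U)"
      "(\<lambda>z. snd z) \<in> borel_measurable (lebesgue_on U \<Otimes>\<^sub>M lebesgue_on U)"
    using measurable_compose[OF measurable_fst id] measurable_compose[OF measurable_snd id] by auto
  have [measurable]: "(\<lambda>z. f (fst z)) \<in> borel_measurable (lebesgue_on U \<Otimes>\<^sub>M lebesgue_on U)"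
      "(\<lambda>z. f (snd z)) \<in> borel_measurable (lebesgue_on U \<Otimes>\<^sub>M lebesgue_on U)"
    using measurable_compose[OF measurable_fst f] measurable_compose[OF measurable_snd f] by auto
  show "(\<lambda>x. \<integral>\<^sup>+y. ennreal ((norm (f x - f y))\<^sup>2 / norm (x - y) powr c) \<partial>lebesgue_on U)
      \<in> borel_measurable (lebesgue_on U)"
  proof (rule sigma_finite_measure.borel_measurable_nn_integral[OF sigma_finite_lebesgue_on[OF U]])
    show "(\<lambda>(x, y). ennreal ((norm (f x - f y))\<^sup>2 / norm (x - y) powr c))
        \<in> borel_measurable (lebesgue_on U \<Otimes>\<^sub>M lebesgue_on U)"
      unfolding split_beta by measurable
  qed
qed

lemma gagliardo_add_le:
  fixes f g :: "'a::euclidean_space \<Rightarrow> 'b::euclidean_space"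
  assumes U: "U \<in> sets lebesgue" and f: "f \<in> borel_measurable (lebesgue_on U)"
    and g: "g \<in> borel_measurable (lebesgue_on U)" and t: "t > 0"
  shows "gagliardo \<sigma> U (\<lambda>x. f x + g x) \<le>
    ennreal (1 + t) * gagliardo \<sigma> U f + ennreal (1 + 1 / t) * gagliardo \<sigma> U g"
proof -
  define c where "c = real DIM('a) + 2 * \<sigma>"
  let ?k = "\<lambda>f x y. ennreal ((norm (f x - f y :: 'b))\<^sup>2 / norm (x - y) powr c)"
  note m = gagliardo_measurable(1)[OF U f, of _ c] gagliardo_measurable(1)[OF U g, of _ c]
    gagliardo_measurable(2)[OF U f, of c] gagliardo_measurable(2)[OF U g, of c]
  have "?k (\<lambda>x. f x + g x) x y \<le> ennreal (1 + t) * ?k f x y + ennreal (1 + 1 / t) * ?k g x y" for x y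
  proof -
    have "(norm (f x + g x - (f y + g y)))\<^sup>2
        \<le> (1 + t) * (norm (f x - f y))\<^sup>2 + (1 + 1 / t) * (norm (g x - g y))\<^sup>2"
      using norm_add_square_le[OF t, of "f x - f y" "g x - g y"] by (simp add: algebra_simps)
    then have "(norm (f x + g x - (f y + g y)))\<^sup>2 / norm (x - y) powr c
        \<le> (1 + t) * ((norm (f x - f y))\<^sup>2 / norm (x - y) powr c)
          + (1 + 1 / t) * ((norm (g x - g y))\<^sup>2 / norm (x - y) powr c)"
      using divide_right_mono[of _ _ "norm (x - y) powr c"] by (fastforce simp: add_divide_distrib)
    then show ?thesis
      using t by (subst (1 2) ennreal_mult'[symmetric]) (auto simp flip: ennreal_plus intro!: ennreal_leI)
  qed
  then have "gagliardo \<sigma> U (\<lambda>x. f x + g x) \<le>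
      (\<integral>\<^sup>+x. \<integral>\<^sup>+y. ennreal (1 + t) * ?k f x y + ennreal (1 + 1 / t) * ?k g x y \<partial>lebesgue_on U \<partial>lebesgue_on U)"
    unfolding gagliardo_def c_def by (intro nn_integral_mono) simp
  also have "\<dots> = ennreal (1 + t) * gagliardo \<sigma> U f + ennreal (1 + 1 / t) * gagliardo \<sigma> U g"
    using m by (simp add: nn_integral_add nn_integral_cmult gagliardo_def c_def)
  finally show ?thesis .
qed

lemma gagliardo_linear_le:
  fixes f :: "'a::euclidean_space \<Rightarrow> 'b::euclidean_space" and A :: "'b \<Rightarrow> 'c::euclidean_space"
  assumes U: "U \<in> sets lebesgue" and f: "f \<in> borel_measurable (lebesgue_on U)"
    and A: "bounded_linear A" and B: "\<And>w. norm (A w) \<le> B * norm w"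
  shows "gagliardo \<sigma> U (\<lambda>x. A (f x)) \<le> ennreal (B\<^sup>2) * gagliardo \<sigma> U f"
proof -
  define c where "c = real DIM('a) + 2 * \<sigma>"
  note m = gagliardo_measurable(1)[OF U f, of _ c] gagliardo_measurable(2)[OF U f, of c]
  have "ennreal ((norm (A (f x) - A (f y)))\<^sup>2 / norm (x - y) powr c)
      \<le> ennreal (B\<^sup>2) * ennreal ((norm (f x - f y))\<^sup>2 / norm (x - y) powr c)" for x y
  proof -
    have "norm (A (f x) - A (f y)) \<le> B * norm (f x - f y)"
      using B[of "f x - f y"] by (simp add: linear_diff bounded_linear.linear[OF A])
    then have "(norm (A (f x) - A (f y)))\<^sup>2 \<le> B\<^sup>2 * (norm (f x - f y))\<^sup>2"
      unfolding power_mult_distrib[symmetric] by (rule power_mono) simp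
    then have "(norm (A (f x) - A (f y)))\<^sup>2 / norm (x - y) powr c
        \<le> B\<^sup>2 * ((norm (f x - f y))\<^sup>2 / norm (x - y) powr c)"
      using divide_right_mono[of _ _ "norm (x - y) powr c"] by fastforce
    then show ?thesis by (subst ennreal_mult'[symmetric]) (auto intro!: ennreal_leI)
  qed
  then have "gagliardo \<sigma> U (\<lambda>x. A (f x)) \<le> (\<integral>\<^sup>+x. \<integral>\<^sup>+y. ennreal (B\<^sup>2) *
      ennreal ((norm (f x - f y))\<^sup>2 / norm (x - y) powr c) \<partial>lebesgue_on U \<partial>lebesgue_on U)"
    unfolding gagliardo_def c_def by (intro nn_integral_mono) simp
  also have "\<dots> = ennreal (B\<^sup>2) * gagliardo \<sigma> U f"
    using m by (simp add: nn_integral_cmult gagliardo_def c_def)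
  finally show ?thesis .
qed

lemma sobolev_derivsD:
  assumes "sobolev_derivs s U f g" "k \<le> nat \<lfloor>s\<rfloor>" "\<alpha> \<in> multi_indices k"
  shows "has_weak_deriv U \<alpha> f (g \<alpha>)" "L2_on U (g \<alpha>)" "g \<alpha> \<in> borel_measurable (lebesgue_on U)"
    "integrable (lebesgue_on U) (\<lambda>x. (norm (g \<alpha> x))\<^sup>2)"
  using assms by (auto simp: sobolev_derivs_def L2_on_def)

lemma sobolev_derivs_add:
  fixes f :: "'a::euclidean_space \<Rightarrow> 'b::euclidean_space"
  assumes U: "U \<in> sets lebesgue" and g: "sobolev_derivs s U f g" and h: "sobolev_derivs s U f' h"
  shows "sobolev_derivs s U (\<lambda>x. f x + f' x) (\<lambda>\<alpha> x. g \<alpha> x + h \<alpha> x)"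
    and "t > 0 \<Longrightarrow> sobolev_energy s U (\<lambda>\<alpha> x. g \<alpha> x + h \<alpha> x)
      \<le> (1 + t) * sobolev_energy s U g + (1 + 1 / t) * sobolev_energy s U h"
proof -
  note g' = sobolev_derivsD[OF g] and h' = sobolev_derivsD[OF h]
  let ?n = "nat \<lfloor>s\<rfloor>"
  have gag: "gagliardo (frac s) U (\<lambda>x. g \<alpha> x + h \<alpha> x)
      \<le> ennreal (1 + t) * gagliardo (frac s) U (g \<alpha>) + ennreal (1 + 1 / t) * gagliardo (frac s) U (h \<alpha>)"
    if "\<alpha> \<in> multi_indices ?n" "t > 0" for \<alpha> t
    using that by (intro gagliardo_add_le U g'(3)[OF order_refl] h'(3)[OF order_refl])
  have fin: "gagliardo (frac s) U (g \<alpha>) < \<infinity>" "gagliardo (frac s) U (h \<alpha>) < \<infinity>"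
    if "\<alpha> \<in> multi_indices ?n" "frac s \<noteq> 0" for \<alpha>
    using that g h by (auto simp: sobolev_derivs_def)
  have "gagliardo (frac s) U (\<lambda>x. g \<alpha> x + h \<alpha> x) < \<infinity>"
    if "\<alpha> \<in> multi_indices ?n" "frac s \<noteq> 0" for \<alpha>
    using gag[OF that(1), of 1] fin[OF that]
    by (auto simp: ennreal_mult_less_top intro: le_less_trans)
  then show "sobolev_derivs s U (\<lambda>x. f x + f' x) (\<lambda>\<alpha> x. g \<alpha> x + h \<alpha> x)"
    unfolding sobolev_derivs_def
    by (intro conjI allI ballI impI has_weak_deriv_add[OF U] L2_on_add g' h')
      (auto dest: multi_indices_subset)
  assume t: "t > 0"
  have "(\<integral>x. (norm (g \<alpha> x + h \<alpha> x))\<^sup>2 \<partial>lebesgue_on U)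
      \<le> (1 + t) * (\<integral>x. (norm (g \<alpha> x))\<^sup>2 \<partial>lebesgue_on U) + (1 + 1 / t) * (\<integral>x. (norm (h \<alpha> x))\<^sup>2 \<partial>lebesgue_on U)"
    if "k \<le> ?n" "\<alpha> \<in> multi_indices k" for k \<alpha>
  proof -
    have "(\<integral>x. (norm (g \<alpha> x + h \<alpha> x))\<^sup>2 \<partial>lebesgue_on U)
        \<le> (\<integral>x. (1 + t) * (norm (g \<alpha> x))\<^sup>2 + (1 + 1 / t) * (norm (h \<alpha> x))\<^sup>2 \<partial>lebesgue_on U)"
      using L2_on_add[OF g'(2)[OF that] h'(2)[OF that]] g'(4)[OF that] h'(4)[OF that]
      by (intro integral_mono norm_add_square_le[OF t]) (auto simp: L2_on_def)
    then show ?thesis using g'(4)[OF that] h'(4)[OF that] by simp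
  qed
  then have 1: "(\<Sum>k \<le> ?n. \<Sum>\<alpha>\<in>multi_indices k. \<integral>x. (norm (g \<alpha> x + h \<alpha> x))\<^sup>2 \<partial>lebesgue_on U)
      \<le> (\<Sum>k \<le> ?n. \<Sum>\<alpha>\<in>multi_indices k. (1 + t) * (\<integral>x. (norm (g \<alpha> x))\<^sup>2 \<partial>lebesgue_on U)
         + (1 + 1 / t) * (\<integral>x. (norm (h \<alpha> x))\<^sup>2 \<partial>lebesgue_on U))"
    by (intro sum_mono) auto
  have "enn2real (gagliardo (frac s) U (\<lambda>x. g \<alpha> x + h \<alpha> x))
      \<le> (1 + t) * enn2real (gagliardo (frac s) U (g \<alpha>)) + (1 + 1 / t) * enn2real (gagliardo (frac s) U (h \<alpha>))"
    if "\<alpha> \<in> multi_indices ?n" "frac s \<noteq> 0" for \<alpha>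
  proof -
    have "enn2real (gagliardo (frac s) U (\<lambda>x. g \<alpha> x + h \<alpha> x))
        \<le> enn2real (ennreal (1 + t) * gagliardo (frac s) U (g \<alpha>) + ennreal (1 + 1 / t) * gagliardo (frac s) U (h \<alpha>))"
      using fin[OF that] by (intro enn2real_mono gag that t) (auto simp: ennreal_mult_less_top)
    also have "\<dots> = (1 + t) * enn2real (gagliardo (frac s) U (g \<alpha>)) + (1 + 1 / t) * enn2real (gagliardo (frac s) U (h \<alpha>))"
      using fin[OF that] t
      by (subst enn2real_plus) (auto simp: ennreal_mult_less_top enn2real_mult simp del: ennreal_plus)
    finally show ?thesis .
  qed
  then have 2: "frac s \<noteq> 0 \<Longrightarrow> (\<Sum>\<alpha>\<in>multi_indices ?n. enn2real (gagliardo (frac s) U (\<lambda>x. g \<alpha> x + h \<alpha> x)))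
     \<le> (\<Sum>\<alpha>\<in>multi_indices ?n. (1 + t) * enn2real (gagliardo (frac s) U (g \<alpha>))
        + (1 + 1 / t) * enn2real (gagliardo (frac s) U (h \<alpha>)))"
    by (intro sum_mono) auto
  show "sobolev_energy s U (\<lambda>\<alpha> x. g \<alpha> x + h \<alpha> x)
      \<le> (1 + t) * sobolev_energy s U g + (1 + 1 / t) * sobolev_energy s U h"
    using 1 2 unfolding sobolev_energy_def
    by (cases "frac s = 0") (simp_all add: sum.distrib sum_distrib_left[symmetric] distrib_left)
qed

lemma sobolev_derivs_linear:
  fixes f :: "'a::euclidean_space \<Rightarrow> 'b::euclidean_space" and A :: "'b \<Rightarrow> 'c::euclidean_space"
  assumes U: "U \<in> sets lebesgue" and g: "sobolev_derivs s U f g"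
    and A: "bounded_linear A" and B: "\<And>w. norm (A w) \<le> B * norm w"
  shows "sobolev_derivs s U (\<lambda>x. A (f x)) (\<lambda>\<alpha> x. A (g \<alpha> x))"
    and "sobolev_energy s U (\<lambda>\<alpha> x. A (g \<alpha> x)) \<le> B\<^sup>2 * sobolev_energy s U g"
proof -
  note g' = sobolev_derivsD[OF g]
  let ?n = "nat \<lfloor>s\<rfloor>"
  have gag: "gagliardo (frac s) U (\<lambda>x. A (g \<alpha> x)) \<le> ennreal (B\<^sup>2) * gagliardo (frac s) U (g \<alpha>)"
    if "\<alpha> \<in> multi_indices ?n" for \<alpha>
    using that by (intro gagliardo_linear_le U g'(3)[OF order_refl] A B)
  have fin: "gagliardo (frac s) U (g \<alpha>) < \<infinity>" if "\<alpha> \<in> multi_indices ?n" "frac s \<noteq> 0" for \<alpha>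
    using that g by (auto simp: sobolev_derivs_def)
  have "gagliardo (frac s) U (\<lambda>x. A (g \<alpha> x)) < \<infinity>"
    if "\<alpha> \<in> multi_indices ?n" "frac s \<noteq> 0" for \<alpha>
    using gag[OF that(1)] fin[OF that]
    by (auto simp: ennreal_mult_less_top intro: le_less_trans)
  then show "sobolev_derivs s U (\<lambda>x. A (f x)) (\<lambda>\<alpha> x. A (g \<alpha> x))"
    unfolding sobolev_derivs_def
    by (intro conjI allI ballI impI has_weak_deriv_linear[OF U _ A] L2_on_linear[OF _ A] g')
      (auto dest: multi_indices_subset)
  have "(\<integral>x. (norm (A (g \<alpha> x)))\<^sup>2 \<partial>lebesgue_on U) \<le> B\<^sup>2 * (\<integral>x. (norm (g \<alpha> x))\<^sup>2 \<partial>lebesgue_on U)"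
    if "k \<le> ?n" "\<alpha> \<in> multi_indices k" for k \<alpha>
  proof -
    have "(norm (A w))\<^sup>2 \<le> B\<^sup>2 * (norm w)\<^sup>2" for w
      using power_mono[OF B[of w] norm_ge_zero, of 2] by (simp add: power_mult_distrib)
    then have "(\<integral>x. (norm (A (g \<alpha> x)))\<^sup>2 \<partial>lebesgue_on U) \<le> (\<integral>x. B\<^sup>2 * (norm (g \<alpha> x))\<^sup>2 \<partial>lebesgue_on U)"
      using L2_on_linear[OF g'(2)[OF that] A] g'(4)[OF that]
      by (intro integral_mono) (auto simp: L2_on_def)
    then show ?thesis by simp
  qed
  then have 1: "(\<Sum>k \<le> ?n. \<Sum>\<alpha>\<in>multi_indices k. \<integral>x. (norm (A (g \<alpha> x)))\<^sup>2 \<partial>lebesgue_on U)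
      \<le> (\<Sum>k \<le> ?n. \<Sum>\<alpha>\<in>multi_indices k. B\<^sup>2 * (\<integral>x. (norm (g \<alpha> x))\<^sup>2 \<partial>lebesgue_on U))"
    by (intro sum_mono) auto
  have "enn2real (gagliardo (frac s) U (\<lambda>x. A (g \<alpha> x))) \<le> B\<^sup>2 * enn2real (gagliardo (frac s) U (g \<alpha>))"
    if "\<alpha> \<in> multi_indices ?n" "frac s \<noteq> 0" for \<alpha>
  proof -
    have "enn2real (gagliardo (frac s) U (\<lambda>x. A (g \<alpha> x)))
        \<le> enn2real (ennreal (B\<^sup>2) * gagliardo (frac s) U (g \<alpha>))"
      using fin[OF that] by (intro enn2real_mono gag that) (auto simp: ennreal_mult_less_top)
    then show ?thesis by (simp add: enn2real_mult)
  qed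
  then have 2: "frac s \<noteq> 0 \<Longrightarrow> (\<Sum>\<alpha>\<in>multi_indices ?n. enn2real (gagliardo (frac s) U (\<lambda>x. A (g \<alpha> x))))
     \<le> (\<Sum>\<alpha>\<in>multi_indices ?n. B\<^sup>2 * enn2real (gagliardo (frac s) U (g \<alpha>)))"
    by (intro sum_mono) auto
  show "sobolev_energy s U (\<lambda>\<alpha> x. A (g \<alpha> x)) \<le> B\<^sup>2 * sobolev_energy s U g"
    using 1 2 unfolding sobolev_energy_def
    by (cases "frac s = 0") (simp_all add: sum_distrib_left[symmetric] distrib_left)
qed

lemma sobolev_add:
  assumes U: "open U" and f: "f \<in> sobolev s U" and g: "g \<in> sobolev s U"
  shows "(\<lambda>x. f x + g x) \<in> sobolev s U"
    and "sobolev_norm s U (\<lambda>x. f x + g x) \<le> sobolev_norm s U f + sobolev_norm s U g"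
proof -
  have Ul: "U \<in> sets lebesgue" using U by auto
  note d = sobolev_derivs_add[OF Ul sobolev_derivs_weak_deriv[OF f] sobolev_derivs_weak_deriv[OF g]]
  show "(\<lambda>x. f x + g x) \<in> sobolev s U"
    by (rule sobolev_derivs_imp_sobolev(1)[OF U d(1)])
  show "sobolev_norm s U (\<lambda>x. f x + g x) \<le> sobolev_norm s U f + sobolev_norm s U g"
    unfolding sobolev_derivs_imp_sobolev(2)[OF U d(1)] sobolev_norm_eq_energy[of s U f]
      sobolev_norm_eq_energy[of s U g]
    by (rule sqrt_triangle_if_weighted[OF sobolev_energy_nonneg sobolev_energy_nonneg d(2)])
qed

lemma sobolev_linear:
  assumes U: "open U" and f: "f \<in> sobolev s U"
    and A: "bounded_linear A" and B: "\<And>w. norm (A w) \<le> B * norm w" and "B \<ge> 0"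
  shows "(\<lambda>x. A (f x)) \<in> sobolev s U"
    and "sobolev_norm s U (\<lambda>x. A (f x)) \<le> B * sobolev_norm s U f"
proof -
  have Ul: "U \<in> sets lebesgue" using U by auto
  note d = sobolev_derivs_linear[OF Ul sobolev_derivs_weak_deriv[OF f] A B]
  show "(\<lambda>x. A (f x)) \<in> sobolev s U"
    by (rule sobolev_derivs_imp_sobolev(1)[OF U d(1)])
  have "sqrt (sobolev_energy s U (\<lambda>\<alpha> x. A (weak_deriv U \<alpha> f x)))
      \<le> sqrt (B\<^sup>2 * sobolev_energy s U (\<lambda>\<alpha>. weak_deriv U \<alpha> f))"
    using d(2) by simp
  then show "sobolev_norm s U (\<lambda>x. A (f x)) \<le> B * sobolev_norm s U f"
    unfolding sobolev_derivs_imp_sobolev(2)[OF U d(1)] sobolev_norm_eq_energy[of s U f]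
    using \<open>B \<ge> 0\<close> by (simp add: real_sqrt_mult)
qed

lemma sobolev_scaleR:
  assumes U: "open U" and f: "f \<in> sobolev s U"
  shows "(\<lambda>x. c *\<^sub>R f x) \<in> sobolev s U"
    and "sobolev_norm s U (\<lambda>x. c *\<^sub>R f x) \<le> \<bar>c\<bar> * sobolev_norm s U f"
  using sobolev_linear[OF U f bounded_linear_scaleR_right[of c], of "\<bar>c\<bar>"] by auto

lemma sobolev_cong_AE:
  assumes U: "open U" and f: "f \<in> sobolev s U" and ae: "AE x in lebesgue_on U. f x = g x"
  shows "g \<in> sobolev s U" and "sobolev_norm s U g = sobolev_norm s U f"
proof -
  have Ul: "U \<in> sets lebesgue" using U by auto
  note d = sobolev_derivs_cong_AE[OF Ul sobolev_derivs_weak_deriv[OF f] ae]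
  show "g \<in> sobolev s U" by (rule sobolev_derivs_imp_sobolev(1)[OF U d])
  show "sobolev_norm s U g = sobolev_norm s U f"
    unfolding sobolev_derivs_imp_sobolev(2)[OF U d] sobolev_norm_eq_energy[of s U f] ..
qed

lemma nat_floor_minus_one: "(s::real) \<ge> 1 \<Longrightarrow> nat \<lfloor>s\<rfloor> = Suc (nat \<lfloor>s - 1\<rfloor>)"
proof -
  assume "s \<ge> 1"
  then have "\<lfloor>s\<rfloor> \<ge> 1" by (simp add: le_floor_iff)
  moreover have "\<lfloor>s - 1\<rfloor> = \<lfloor>s\<rfloor> - 1" by simp
  ultimately show ?thesis by linarith
qed

text \<open>
  The multi-indices \<open>\<beta> + e\<close> are distinct multi-indices of one order more, so the energy of the
  derivative is part of the energy of the function.  The fractional part of the order is unchanged.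
\<close>

lemma sobolev_derivs_shift:
  fixes f :: "'a::euclidean_space \<Rightarrow> 'b::euclidean_space"
  assumes s: "s \<ge> 1" and e: "e \<in> Basis" and g: "sobolev_derivs s U f g"
  shows "sobolev_derivs (s - 1) U (g {#e#}) (\<lambda>\<beta>. g (add_mset e \<beta>))"
    and "sobolev_energy (s - 1) U (\<lambda>\<beta>. g (add_mset e \<beta>)) \<le> sobolev_energy s U g"
proof -
  note g' = sobolev_derivsD[OF g]
  let ?n = "nat \<lfloor>s - 1\<rfloor>"
  have n: "nat \<lfloor>s\<rfloor> = Suc ?n" using s by (rule nat_floor_minus_one)
  have fr: "frac (s - 1) = frac s" by (simp add: frac_def)
  have w: "has_weak_deriv U {#e#} f (g {#e#})"
    by (rule g'(1)[of 1]) (use n e in \<open>auto simp: multi_indices_def\<close>)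
  have "has_weak_deriv U \<beta> (g {#e#}) (g (add_mset e \<beta>)) \<and> L2_on U (g (add_mset e \<beta>))"
    if "k \<le> ?n" "\<beta> \<in> multi_indices k" for k \<beta>
    using g'(1,2)[OF _ add_mset_multi_indices[OF e that(2)]] that n
    by (auto intro: has_weak_deriv_shift[OF multi_indices_subset w])
  then show "sobolev_derivs (s - 1) U (g {#e#}) (\<lambda>\<beta>. g (add_mset e \<beta>))"
    using g add_mset_multi_indices[OF e] unfolding sobolev_derivs_def fr n by auto
  have sub: "(\<Sum>\<beta>\<in>multi_indices k. F (add_mset e \<beta>)) \<le> sum F (multi_indices (Suc k))"
    if "\<And>\<alpha>. F \<alpha> \<ge> 0" for F :: "'a multiset \<Rightarrow> real" and k
  proof -
    have "(\<Sum>\<beta>\<in>multi_indices k. F (add_mset e \<beta>)) = sum F (add_mset e ` multi_indices k)"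
      by (subst sum.reindex) (auto simp: inj_on_def)
    also have "\<dots> \<le> sum F (multi_indices (Suc k))"
      by (rule sum_mono2) (use that add_mset_multi_indices[OF e] finite_multi_indices in auto)
    finally show ?thesis .
  qed
  have "(\<Sum>k \<le> ?n. \<Sum>\<beta>\<in>multi_indices k. \<integral>x. (norm (g (add_mset e \<beta>) x))\<^sup>2 \<partial>lebesgue_on U)
      \<le> (\<Sum>k \<le> ?n. \<Sum>\<alpha>\<in>multi_indices (Suc k). \<integral>x. (norm (g \<alpha> x))\<^sup>2 \<partial>lebesgue_on U)"
    by (intro sum_mono sub) simp
  also have "\<dots> \<le> (\<Sum>k \<le> Suc ?n. \<Sum>\<alpha>\<in>multi_indices k. \<integral>x. (norm (g \<alpha> x))\<^sup>2 \<partial>lebesgue_on U)"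
    by (subst sum.atMost_Suc_shift) (simp add: sum_nonneg)
  finally have 1: "(\<Sum>k \<le> ?n. \<Sum>\<beta>\<in>multi_indices k. \<integral>x. (norm (g (add_mset e \<beta>) x))\<^sup>2 \<partial>lebesgue_on U)
      \<le> (\<Sum>k \<le> nat \<lfloor>s\<rfloor>. \<Sum>\<alpha>\<in>multi_indices k. \<integral>x. (norm (g \<alpha> x))\<^sup>2 \<partial>lebesgue_on U)" unfolding n .
  have 2: "(\<Sum>\<beta>\<in>multi_indices ?n. enn2real (gagliardo (frac s) U (g (add_mset e \<beta>))))
      \<le> (\<Sum>\<alpha>\<in>multi_indices (nat \<lfloor>s\<rfloor>). enn2real (gagliardo (frac s) U (g \<alpha>)))"
    unfolding n by (rule sub) simp
  show "sobolev_energy (s - 1) U (\<lambda>\<beta>. g (add_mset e \<beta>)) \<le> sobolev_energy s U g"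
    unfolding sobolev_energy_def fr using 1 2 by auto
qed

lemma sobolev_weak_deriv:
  assumes s: "s \<ge> 1" and U: "open U" and e: "e \<in> Basis" and f: "f \<in> sobolev s U"
  shows "weak_deriv U {#e#} f \<in> sobolev (s - 1) U"
    and "sobolev_norm (s - 1) U (weak_deriv U {#e#} f) \<le> sobolev_norm s U f"
proof -
  note d = sobolev_derivs_shift[OF s e sobolev_derivs_weak_deriv[OF f]]
  show "weak_deriv U {#e#} f \<in> sobolev (s - 1) U"
    by (rule sobolev_derivs_imp_sobolev(1)[OF U d(1)])
  show "sobolev_norm (s - 1) U (weak_deriv U {#e#} f) \<le> sobolev_norm s U f"
    unfolding sobolev_derivs_imp_sobolev(2)[OF U d(1)] sobolev_norm_eq_energy[of s U f]
    using d(2) by simp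
qed


section \<open>Best approximation in a finite-dimensional space\<close>

text \<open>
  For a seminorm, and for linearly dependent features, minimizing coefficients need not stay in a
  compact set.  The features are therefore treated one after the other: the distance \<open>D\<close> to the span
  of the first \<open>m\<close> features is again a seminorm, and \<open>c \<mapsto> D (v - c f)\<close> along the next feature \<open>f\<close> is
  either constant or coercive, according to whether \<open>D f\<close> vanishes.
\<close>

lemma best_approximation:
  fixes S :: "('a \<Rightarrow> 'b::real_vector) set" and p :: "('a \<Rightarrow> 'b) \<Rightarrow> real"
    and F :: "nat \<Rightarrow> 'a \<Rightarrow> 'b"
  assumes add: "\<And>f g. f \<in> S \<Longrightarrow> g \<in> S \<Longrightarrow> (\<lambda>x. f x + g x) \<in> S"
    and scale: "\<And>c f. f \<in> S \<Longrightarrow> (\<lambda>x. c *\<^sub>R f x) \<in> S"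
    and tri: "\<And>f g. f \<in> S \<Longrightarrow> g \<in> S \<Longrightarrow> p (\<lambda>x. f x + g x) \<le> p f + p g"
    and hom: "\<And>c f. f \<in> S \<Longrightarrow> p (\<lambda>x. c *\<^sub>R f x) \<le> \<bar>c\<bar> * p f"
    and nonneg: "\<And>f. p f \<ge> 0"
    and F: "\<And>j. j < m \<Longrightarrow> F j \<in> S" and v: "v \<in> S"
  shows "\<exists>\<alpha>. \<forall>\<beta>. p (\<lambda>x. v x - (\<Sum>j<m. \<alpha> j *\<^sub>R F j x)) \<le> p (\<lambda>x. v x - (\<Sum>j<m. \<beta> j *\<^sub>R F j x))"
  using F v
proof (induction m arbitrary: v)
  case 0
  then show ?case by simp
next
  case (Suc m)
  define L where "L \<beta> x = (\<Sum>j<m. \<beta> j *\<^sub>R F j x)" for \<beta> :: "nat \<Rightarrow> real" and x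
  have "\<exists>\<alpha>. \<forall>\<beta>. p (\<lambda>x. w x - L \<alpha> x) \<le> p (\<lambda>x. w x - L \<beta> x)" if "w \<in> S" for w
    unfolding L_def using Suc.IH[of w] Suc.prems(1) that by simp
  then obtain a where a: "\<And>w \<beta>. w \<in> S \<Longrightarrow> p (\<lambda>x. w x - L (a w) x) \<le> p (\<lambda>x. w x - L \<beta> x)"
    by metis
  define D where "D w = p (\<lambda>x. w x - L (a w) x)" for w
  have zero: "(\<lambda>x. 0) \<in> S" using scale[OF Suc.prems(2), of 0] by simp
  have LS: "L \<beta> \<in> S" for \<beta>
  proof -
    have "k \<le> m \<Longrightarrow> (\<lambda>x. \<Sum>j<k. \<beta> j *\<^sub>R F j x) \<in> S" for k
      by (induction k) (auto intro!: zero add scale Suc.prems(1))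
    then show ?thesis unfolding L_def[abs_def] by simp
  qed
  have diff: "(\<lambda>x. f x - c *\<^sub>R g x) \<in> S" if "f \<in> S" "g \<in> S" for f g c
    using add[OF that(1) scale[OF that(2), of "- c"]] by simp
  have dist: "(\<lambda>x. w x - L \<beta> x) \<in> S" if "w \<in> S" for w \<beta>
    using diff[OF that LS, of 1] by simp
  have D_le: "D w \<le> p (\<lambda>x. w x - L \<beta> x)" if "w \<in> S" for w \<beta>
    unfolding D_def by (rule a[OF that])
  have D_nonneg: "D w \<ge> 0" for w unfolding D_def by (rule nonneg)
  have D_add: "D (\<lambda>x. x1 x + x2 x) \<le> D x1 + D x2" if "x1 \<in> S" "x2 \<in> S" for x1 x2
  proof -
    have "D (\<lambda>x. x1 x + x2 x) \<le> p (\<lambda>x. (x1 x + x2 x) - L (\<lambda>j. a x1 j + a x2 j) x)"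
      by (rule D_le[OF add[OF that]])
    also have "(\<lambda>x. (x1 x + x2 x) - L (\<lambda>j. a x1 j + a x2 j) x)
        = (\<lambda>x. (x1 x - L (a x1) x) + (x2 x - L (a x2) x))"
      by (simp add: L_def scaleR_add_left sum.distrib algebra_simps)
    also have "p \<dots> \<le> D x1 + D x2" unfolding D_def by (intro tri dist that)
    finally show ?thesis .
  qed
  have D_scale: "D (\<lambda>x. c *\<^sub>R w x) \<le> \<bar>c\<bar> * D w" if "w \<in> S" for w c
  proof -
    have "D (\<lambda>x. c *\<^sub>R w x) \<le> p (\<lambda>x. c *\<^sub>R w x - L (\<lambda>j. c * a w j) x)"
      by (rule D_le[OF scale[OF that]])
    also have "(\<lambda>x. c *\<^sub>R w x - L (\<lambda>j. c * a w j) x) = (\<lambda>x. c *\<^sub>R (w x - L (a w) x))"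
      by (simp add: L_def scaleR_diff_right scaleR_sum_right)
    also have "p \<dots> \<le> \<bar>c\<bar> * D w" unfolding D_def by (intro hom dist that)
    finally show ?thesis .
  qed
  define f where "f = F m"
  have f: "f \<in> S" using Suc.prems(1) by (simp add: f_def)
  have v: "v \<in> S" by fact
  define h where "h c = D (\<lambda>x. v x - c *\<^sub>R f x)" for c
  have lip: "h c \<le> h c' + \<bar>c - c'\<bar> * D f" for c c'
  proof -
    have "h c = D (\<lambda>x. (v x - c' *\<^sub>R f x) + (c' - c) *\<^sub>R f x)"
      unfolding h_def by (simp add: algebra_simps)
    also have "\<dots> \<le> h c' + D (\<lambda>x. (c' - c) *\<^sub>R f x)"
      unfolding h_def by (intro D_add diff scale v f)
    also have "D (\<lambda>x. (c' - c) *\<^sub>R f x) \<le> \<bar>c - c'\<bar> * D f"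
      using D_scale[OF f, of "c' - c"] by (simp add: abs_minus_commute)
    finally show ?thesis by simp
  qed
  have coercive: "\<bar>c\<bar> * D f \<le> h c + h 0" for c
  proof (cases "c = 0")
    case False
    have "D f = D (\<lambda>x. (1 / c) *\<^sub>R (c *\<^sub>R f x))" using False by simp
    also have "\<dots> \<le> \<bar>1 / c\<bar> * D (\<lambda>x. c *\<^sub>R f x)" by (rule D_scale[OF scale[OF f]])
    finally have "\<bar>c\<bar> * D f \<le> D (\<lambda>x. c *\<^sub>R f x)" using False by (simp add: field_simps)
    also have "\<dots> = D (\<lambda>x. v x + (- 1) *\<^sub>R (v x - c *\<^sub>R f x))" by simp
    also have "\<dots> \<le> D v + D (\<lambda>x. (- 1) *\<^sub>R (v x - c *\<^sub>R f x))"
      by (intro D_add diff scale v f)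
    also have "D (\<lambda>x. (- 1) *\<^sub>R (v x - c *\<^sub>R f x)) \<le> h c"
      unfolding h_def using D_scale[OF diff[OF v f], of "- 1" c] by simp
    finally show ?thesis by (simp add: h_def)
  qed (use D_nonneg in \<open>simp add: h_def\<close>)
  have "\<exists>c0. \<forall>c. h c0 \<le> h c"
  proof (cases "D f = 0")
    case True
    then have "h 0 \<le> h c" for c using lip[of 0 c] by simp
    then show ?thesis by blast
  next
    case False
    then have Df: "D f > 0" using D_nonneg[of f] by simp
    \<comment> \<open>Outside \<open>[-R, R]\<close> the coercivity estimate gives \<open>h c > h 0\<close>.\<close>
    define R where "R = 2 * h 0 / D f"
    have "R \<ge> 0" using Df D_nonneg by (simp add: R_def h_def)
    have "(D f)-lipschitz_on UNIV h"
    proof (rule lipschitz_onI)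
      show "dist (h x) (h y) \<le> D f * dist x y" for x y
        using lip[of x y] lip[of y x] by (simp add: dist_real_def abs_minus_commute mult.commute abs_le_iff)
    qed (use Df in simp)
    then have "continuous_on UNIV h" by (rule lipschitz_on_continuous_on)
    then have "continuous_on {- R..R} h" by (rule continuous_on_subset) simp
    then have "\<exists>c0\<in>{- R..R}. \<forall>c\<in>{- R..R}. h c0 \<le> h c"
      using \<open>R \<ge> 0\<close> by (intro continuous_attains_inf) auto
    then obtain c0 where c0: "\<And>c. c \<in> {- R..R} \<Longrightarrow> h c0 \<le> h c" by blast
    have "h c0 \<le> h c" for c
    proof (cases "c \<in> {- R..R}")
      case False
      then have "R < \<bar>c\<bar>" by auto
      then have "2 * h 0 < \<bar>c\<bar> * D f" using Df by (simp add: R_def field_simps)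
      then have "h 0 < h c" using coercive[of c] by simp
      moreover have "h c0 \<le> h 0" using c0[of 0] \<open>R \<ge> 0\<close> by simp
      ultimately show ?thesis by simp
    qed (rule c0)
    then show ?thesis by blast
  qed
  then obtain c0 where c0: "\<And>c. h c0 \<le> h c" by blast
  define \<alpha> where "\<alpha> = (a (\<lambda>x. v x - c0 *\<^sub>R f x))(m := c0)"
  have split: "(\<lambda>x. v x - (\<Sum>j<Suc m. \<beta> j *\<^sub>R F j x)) = (\<lambda>x. (v x - \<beta> m *\<^sub>R f x) - L \<beta> x)" for \<beta>
    by (simp add: L_def f_def algebra_simps)
  have "p (\<lambda>x. v x - (\<Sum>j<Suc m. \<alpha> j *\<^sub>R F j x)) = h c0"
  proof -
    have "L \<alpha> = L (a (\<lambda>x. v x - c0 *\<^sub>R f x))" by (simp add: L_def fun_eq_iff \<alpha>_def)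
    moreover have "\<alpha> m = c0" by (simp add: \<alpha>_def)
    ultimately show ?thesis unfolding split h_def D_def by (simp only:)
  qed
  moreover have "h (\<beta> m) \<le> p (\<lambda>x. v x - (\<Sum>j<Suc m. \<beta> j *\<^sub>R F j x))" for \<beta>
    unfolding split h_def by (rule D_le[OF diff[OF v f]])
  ultimately have "p (\<lambda>x. v x - (\<Sum>j<Suc m. \<alpha> j *\<^sub>R F j x))
      \<le> p (\<lambda>x. v x - (\<Sum>j<Suc m. \<beta> j *\<^sub>R F j x))" for \<beta>
    using order_trans[OF c0[of "\<beta> m"]] by (simp only:)
  then show ?case by blast
qed


section \<open>Sums, affine functions and the square norm in Sobolev spaces\<close>

lemma has_weak_deriv_zero:
  "has_weak_deriv U \<alpha> (\<lambda>_. 0 :: 'b::euclidean_space) (\<lambda>_. 0)"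
  by (simp add: has_weak_deriv_def locally_integrable_def)

lemma sobolevI:
  fixes f :: "'a::euclidean_space \<Rightarrow> 'b::euclidean_space"
  assumes U: "open U"
    and ex: "\<And>k \<alpha>. k \<le> nat \<lfloor>s\<rfloor> \<Longrightarrow> \<alpha> \<in> multi_indices k \<Longrightarrow>
      \<exists>h. has_weak_deriv U \<alpha> f h \<and> L2_on U h \<and> (k = nat \<lfloor>s\<rfloor> \<longrightarrow> gagliardo (frac s) U h < \<infinity>)"
  shows "f \<in> sobolev s U"
proof -
  have Ul: "U \<in> sets lebesgue" using U by auto
  have "(\<exists>g. has_weak_deriv U \<alpha> f g) \<and> L2_on U (weak_deriv U \<alpha> f) \<and>
      (k = nat \<lfloor>s\<rfloor> \<longrightarrow> gagliardo (frac s) U (weak_deriv U \<alpha> f) < \<infinity>)"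
    if k: "k \<le> nat \<lfloor>s\<rfloor>" "\<alpha> \<in> multi_indices k" for k \<alpha>
  proof -
    obtain h where h: "has_weak_deriv U \<alpha> f h" "L2_on U h"
        "k = nat \<lfloor>s\<rfloor> \<Longrightarrow> gagliardo (frac s) U h < \<infinity>"
      using ex[OF k] by blast
    have ae: "AE x in lebesgue_on U. h x = weak_deriv U \<alpha> f x"
      using weak_deriv_AE[OF U h(1)] by eventually_elim simp
    show ?thesis
      using h L2_on_cong_AE[OF Ul h(2) ae] gagliardo_cong_AE[OF ae] by auto
  qed
  then show ?thesis unfolding sobolev_def by blast
qed

lemma gagliardo_const: "gagliardo \<sigma> U (\<lambda>_. c) = 0"
  by (simp add: gagliardo_def)

lemma zero_in_sobolev: "open U \<Longrightarrow> (\<lambda>_. 0) \<in> sobolev s U"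
  by (rule sobolevI) (auto intro!: exI[of _ "\<lambda>_. 0"] has_weak_deriv_zero simp: L2_on_def gagliardo_const)

lemma sobolev_sum:
  assumes U: "open U" and I: "finite I" "I \<noteq> {}" and f: "\<And>i. i \<in> I \<Longrightarrow> f i \<in> sobolev s U"
  shows "(\<lambda>x. \<Sum>i\<in>I. f i x) \<in> sobolev s U"
    and "sobolev_norm s U (\<lambda>x. \<Sum>i\<in>I. f i x) \<le> (\<Sum>i\<in>I. sobolev_norm s U (f i))"
proof -
  have "(\<lambda>x. \<Sum>i\<in>I. f i x) \<in> sobolev s U \<and>
      sobolev_norm s U (\<lambda>x. \<Sum>i\<in>I. f i x) \<le> (\<Sum>i\<in>I. sobolev_norm s U (f i))"
    using I f
  proof (induction I rule: finite_ne_induct)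
    case (insert i I)
    then show ?case
      using sobolev_add[OF U, of "f i" s "\<lambda>x. \<Sum>i\<in>I. f i x"] by auto
  qed auto
  then show "(\<lambda>x. \<Sum>i\<in>I. f i x) \<in> sobolev s U"
    and "sobolev_norm s U (\<lambda>x. \<Sum>i\<in>I. f i x) \<le> (\<Sum>i\<in>I. sobolev_norm s U (f i))"
    by auto
qed

lemma L2_on_continuous_bounded:
  fixes f :: "'a::euclidean_space \<Rightarrow> 'b::euclidean_space"
  assumes U: "open U" "bounded U" and f: "continuous_on UNIV f"
  shows "L2_on U f"
proof -
  have Ul: "U \<in> sets lebesgue" using U by auto
  have m: "f \<in> borel_measurable (lebesgue_on U)"
    by (intro continuous_imp_measurable_on_sets_lebesgue continuous_on_subset[OF f] Ul) simp
  have "compact (closure U)" using U by simp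
  then have "bounded (f ` closure U)"
    by (intro compact_imp_bounded compact_continuous_image continuous_on_subset[OF f]) auto
  then obtain B where "\<And>x. x \<in> closure U \<Longrightarrow> norm (f x) \<le> B"
    unfolding bounded_iff by blast
  then have B: "norm (f x) \<le> B" if "x \<in> U" for x using that closure_subset by blast
  have "U \<in> lmeasurable" using U by (simp add: lmeasurable_open)
  then interpret finite_measure "lebesgue_on U" by (rule finite_measure_lebesgue_on)
  have "integrable (lebesgue_on U) (\<lambda>x. (norm (f x))\<^sup>2)"
  proof (rule integrable_const_bound[of _ "B\<^sup>2"])
    show "AE x in lebesgue_on U. norm ((norm (f x))\<^sup>2) \<le> B\<^sup>2"
      using B by (intro AE_I2) (auto intro: power_mono)
  qed (use m in auto)
  then show ?thesis using m by (simp add: L2_on_def)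
qed

text \<open>
  The first weak derivatives of a linear function are constant.  The higher ones vanish: two
  integrations by parts end in the derivative of a constant.
\<close>

lemma linear_in_sobolev:
  fixes L :: "'a::euclidean_space \<Rightarrow> 'b::euclidean_space"
  assumes s: "s \<ge> 1" and U: "open U" "bounded U" and L: "bounded_linear L"
  shows "L \<in> sobolev s U"
    and "e \<in> Basis \<Longrightarrow> has_weak_deriv U {#e#} L (\<lambda>_. L e)"
proof -
  have d: "(L has_derivative L) (at x)" for x
    using L by (rule bounded_linear_imp_has_derivative)
  have pd: "partial_deriv e L = (\<lambda>_. L e)" for e
    using partial_deriv_eqI[OF d] by auto
  have pdc: "partial_deriv e (\<lambda>_::'a. c) = (\<lambda>_. 0)" for e and c :: 'b
    by (rule ext, rule partial_deriv_eqI[of _ "\<lambda>_. 0"]) simp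
  have cL: "continuous_on A L" for A using L by (rule linear_continuous_on)
  have one: "has_weak_deriv U {#e#} L (\<lambda>_. L e)" if "e \<in> Basis" for e
    using has_weak_deriv_classical[OF U(1) that, of L] d by (auto simp: pd differentiable_def)
  then show "e \<in> Basis \<Longrightarrow> has_weak_deriv U {#e#} L (\<lambda>_. L e)" .
  have const: "has_weak_deriv U {#e#} (\<lambda>_. c) (\<lambda>_. 0)" if "e \<in> Basis" for e and c :: 'b
    using has_weak_deriv_classical[OF U(1) that, of "\<lambda>_. c"] by (simp add: pdc)
  have two: "has_weak_deriv U \<alpha> L (\<lambda>_. 0)" if \<alpha>: "set_mset \<alpha> \<subseteq> Basis" "size \<alpha> \<ge> 2" for \<alpha>
  proof -
    have "(\<integral>x. foldr partial_deriv es \<phi> x *\<^sub>R L x \<partial>lebesgue_on U) = 0"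
      if \<phi>: "\<phi> \<in> test_functions U" and es: "mset es = \<alpha>" for \<phi> es
    proof -
      have "length es \<ge> 2" "set es \<subseteq> Basis" using es \<alpha> by auto
      then obtain e e' es' where es': "es = e # e' # es'" "e \<in> Basis" "e' \<in> Basis" "set es' \<subseteq> Basis"
        by (auto simp: numeral_2_eq_2 Suc_le_length_iff)
      let ?\<psi> = "foldr partial_deriv es' \<phi>"
      have \<psi>: "?\<psi> \<in> test_functions U" by (rule test_functions_foldr[OF \<phi> es'(4)])
      have "(\<integral>x. partial_deriv e (partial_deriv e' ?\<psi>) x *\<^sub>R L x \<partial>lebesgue_on U)
          = - (\<integral>x. partial_deriv e' ?\<psi> x *\<^sub>R L e \<partial>lebesgue_on U)"
        using has_weak_derivD[OF one[OF es'(2)] test_functions_partial_deriv[OF \<psi> es'(3)], of "[e]"] by simp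
      also have "(\<integral>x. partial_deriv e' ?\<psi> x *\<^sub>R L e \<partial>lebesgue_on U) = 0"
        using has_weak_derivD[OF const[OF es'(3)] \<psi>, of "[e']"] by simp
      finally show ?thesis by (simp add: es'(1))
    qed
    then show ?thesis
      using locally_integrable_continuous[OF cL, of U] locally_integrable_continuous[of U "\<lambda>_. 0 :: 'b"]
      by (auto simp: has_weak_deriv_def)
  qed
  show "L \<in> sobolev s U"
  proof (rule sobolevI[OF U(1)])
    fix k and \<alpha> :: "'a multiset" assume k: "k \<le> nat \<lfloor>s\<rfloor>" and \<alpha>: "\<alpha> \<in> multi_indices k"
    consider "k = 0" | "k = 1" | "k \<ge> 2" by linarith
    then show "\<exists>h. has_weak_deriv U \<alpha> L h \<and> L2_on U h \<and> (k = nat \<lfloor>s\<rfloor> \<longrightarrow> gagliardo (frac s) U h < \<infinity>)"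
    proof cases
      case 1
      then have "\<alpha> = {#}" using \<alpha> by (simp add: multi_indices_0)
      then show ?thesis
        using 1 s has_weak_deriv_empty[OF locally_integrable_continuous[OF cL]]
          L2_on_continuous_bounded[OF U cL] by auto
    next
      case 2
      then have "size \<alpha> = 1" "set_mset \<alpha> \<subseteq> Basis" using \<alpha> by (auto simp: multi_indices_def)
      then obtain e where "\<alpha> = {#e#}" "e \<in> Basis"
        by (metis size_1_singleton_mset set_mset_single singletonI subsetD)
      then show ?thesis
        using one[of e] L2_on_continuous_bounded[OF U, of "\<lambda>_. L e"] gagliardo_const[of "frac s" U "L e"] by auto
    next
      case 3
      then have "has_weak_deriv U \<alpha> L (\<lambda>_. 0)"
        using \<alpha> by (intro two) (auto simp: multi_indices_def)
      then show ?thesis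
        using L2_on_continuous_bounded[OF U, of "\<lambda>_. 0 :: 'b"] gagliardo_const[of "frac s" U "0 :: 'b"] by auto
    qed
  qed
qed

lemma L2_norm_le_sobolev_norm:
  fixes f :: "'a::euclidean_space \<Rightarrow> 'b::euclidean_space"
  assumes U: "open U" and f: "f \<in> sobolev s U"
  shows "(\<integral>x. (norm (f x))\<^sup>2 \<partial>lebesgue_on U) \<le> (sobolev_norm s U f)\<^sup>2"
proof -
  have Ul: "U \<in> sets lebesgue" using U by auto
  let ?I = "\<lambda>\<alpha>. \<integral>x. (norm (weak_deriv U \<alpha> f x))\<^sup>2 \<partial>lebesgue_on U"
  have "{#} \<in> multi_indices 0" by (simp add: multi_indices_0)
  then obtain g where g: "has_weak_deriv U {#} f g" using f unfolding sobolev_def by blast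
  have ae: "AE x in lebesgue_on U. weak_deriv U {#} f x = f x"
    by (rule weak_deriv_AE[OF U has_weak_deriv_empty[OF has_weak_deriv_locally_integrable(1)[OF g]]])
  have "(\<integral>x. (norm (f x))\<^sup>2 \<partial>lebesgue_on U) = ?I {#}"
    by (rule integral_cong_AE_lebesgue_on[OF Ul]) (use ae in \<open>eventually_elim, simp\<close>)
  also have "\<dots> = (\<Sum>\<alpha>\<in>multi_indices 0. ?I \<alpha>)" by (simp add: multi_indices_0)
  also have "\<dots> \<le> (\<Sum>k \<le> nat \<lfloor>s\<rfloor>. \<Sum>\<alpha>\<in>multi_indices k. ?I \<alpha>)"
    by (rule member_le_sum[of 0 _ "\<lambda>k. \<Sum>\<alpha>\<in>multi_indices k. ?I \<alpha>"]) (auto intro: sum_nonneg)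
  also have "\<dots> \<le> sobolev_energy s U (\<lambda>\<alpha>. weak_deriv U \<alpha> f)"
    unfolding sobolev_energy_def by (auto intro!: sum_nonneg)
  also have "\<dots> = (sobolev_norm s U f)\<^sup>2"
    unfolding sobolev_norm_eq_energy by (simp add: sobolev_energy_nonneg)
  finally show ?thesis .
qed

lemma sobolev_norm_pos:
  fixes f :: "'a::euclidean_space \<Rightarrow> 'b::euclidean_space"
  assumes U: "open U" "bounded U" "U \<noteq> {}" and f: "f \<in> sobolev s U"
    and ae: "AE x in lebesgue_on U. f x = c" and c: "c \<noteq> 0"
  shows "sobolev_norm s U f > 0"
proof -
  have Ul: "U \<in> sets lebesgue" using U by auto
  have Um: "U \<in> lmeasurable" using U by (simp add: lmeasurable_open)
  have "measure lebesgue U \<noteq> 0"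
    using Um U open_not_negligible negligible_iff_measure by blast
  then have pos: "measure lebesgue U > 0" by (simp add: zero_less_measure_iff)
  have "0 < (norm c)\<^sup>2 * measure lebesgue U" using pos c by simp
  also have "\<dots> = (\<integral>x. (norm c)\<^sup>2 \<partial>lebesgue_on U)"
    using Um by (simp add: measure_restrict_space)
  also have "\<dots> = (\<integral>x. (norm (f x))\<^sup>2 \<partial>lebesgue_on U)"
    by (rule integral_cong_AE_lebesgue_on[OF Ul]) (use ae in \<open>eventually_elim, simp\<close>)
  also have "\<dots> \<le> (sobolev_norm s U f)\<^sup>2" by (rule L2_norm_le_sobolev_norm[OF U(1) f])
  finally show ?thesis using sobolev_norm_nonneg[of s U f] by (simp add: order_less_le)
qed


section \<open>First-order operators between Sobolev spaces\<close>

text \<open>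
  Boundedness by some \<open>K\<close> makes the supremum in the definition of the operator norm finite, and
  homogeneity, which holds only almost everywhere, reduces to the unit ball.  If the norm of \<open>v\<close> is
  zero, so is that of \<open>T v\<close>, again by the bound with \<open>K\<close>.
\<close>

lemma operator_norm_bound:
  fixes T :: "('a::euclidean_space \<Rightarrow> 'b::euclidean_space) \<Rightarrow> 'a \<Rightarrow> 'c::euclidean_space"
  assumes U: "open U"
    and T: "\<And>v. v \<in> sobolev s U \<Longrightarrow> T v \<in> sobolev (s - 1) U"
    and bound: "\<And>v. v \<in> sobolev s U \<Longrightarrow> sobolev_norm (s - 1) U (T v) \<le> K * sobolev_norm s U v"
    and hom: "\<And>c v. v \<in> sobolev s U \<Longrightarrow>
      AE z in lebesgue_on U. T (\<lambda>z. c *\<^sub>R v z) z = c *\<^sub>R T v z"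
    and v: "v \<in> sobolev s U"
  shows "sobolev_norm (s - 1) U (T v) \<le> operator_norm s U T * sobolev_norm s U v"
proof -
  let ?N = "sobolev_norm s U" and ?N' = "sobolev_norm (s - 1) U"
  let ?S = "{?N' (T v) | v. v \<in> sobolev s U \<and> ?N v \<le> 1}"
  have bdd: "bdd_above ?S"
  proof (rule bdd_aboveI)
    fix x assume "x \<in> ?S"
    then obtain w where w: "x = ?N' (T w)" "w \<in> sobolev s U" "?N w \<le> 1" by blast
    have "x \<le> K * ?N w" using bound w by simp
    also have "\<dots> \<le> \<bar>K\<bar> * 1"
      using w(3) sobolev_norm_nonneg[of s U w] by (intro mult_mono) auto
    finally show "x \<le> \<bar>K\<bar>" by simp
  qed
  show ?thesis
  proof (cases "?N v = 0")
    case True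
    then show ?thesis using bound[OF v] by simp
  next
    case False
    define r where "r = ?N v"
    have r: "r > 0" using False sobolev_norm_nonneg[of s U v] by (simp add: r_def)
    define w where "w = (\<lambda>z. (1 / r) *\<^sub>R v z)"
    have w: "w \<in> sobolev s U" unfolding w_def by (rule sobolev_scaleR(1)[OF U v])
    have "?N w \<le> 1"
      using sobolev_scaleR(2)[OF U v, of "1 / r"] r by (simp add: w_def r_def)
    then have C: "?N' (T w) \<le> operator_norm s U T"
      unfolding operator_norm_def using w bdd by (intro cSup_upper) auto
    have "(\<lambda>z. r *\<^sub>R w z) = v" using r by (simp add: w_def)
    then have "AE z in lebesgue_on U. r *\<^sub>R T w z = T v z"
      using hom[OF w, of r] by (auto elim: eventually_mono)
    then have "?N' (T v) = ?N' (\<lambda>z. r *\<^sub>R T w z)"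
      by (rule sobolev_cong_AE(2)[OF U sobolev_scaleR(1)[OF U T[OF w]]])
    also have "\<dots> \<le> r * ?N' (T w)"
      using sobolev_scaleR(2)[OF U T[OF w], of r] r by simp
    also have "\<dots> \<le> r * operator_norm s U T" using C r by simp
    finally show ?thesis by (simp add: r_def mult.commute)
  qed
qed

text \<open>
  The operators \<open>\<nabla>\<^sup>\<bottom>\<close> and \<open>curl\<close> are both of the form \<open>v \<mapsto> \<Sum>\<^sub>i A\<^sub>i \<partial>\<^sub>i v\<close> with linear contractions
  \<open>A\<^sub>i\<close>: multiples of a unit vector for \<open>\<nabla>\<^sup>\<bottom>\<close>, and \<open>w \<mapsto> e\<^sub>i \<times> w\<close> for \<open>curl\<close>.  A linear function \<open>L\<close>
  with constant nonzero image certifies that the operator norm is positive.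
\<close>

locale first_order_operator =
  fixes s :: real and Q :: "((real^'n::finite) \<times> real) set"
    and A :: "'n \<Rightarrow> 'b::euclidean_space \<Rightarrow> 'c::euclidean_space"
    and T :: "((real^'n) \<times> real \<Rightarrow> 'b) \<Rightarrow> (real^'n) \<times> real \<Rightarrow> 'c"
  assumes s: "s \<ge> 1" and Q: "open Q" "bounded Q" "Q \<noteq> {}"
    and A: "\<And>i. bounded_linear (A i)" "\<And>i w. norm (A i w) \<le> norm w"
    and T: "\<And>v. T v = (\<lambda>z. \<Sum>i\<in>UNIV. A i (weak_spatial Q i v z))"
    and nontrivial: "\<exists>L. bounded_linear L \<and> (\<Sum>i\<in>UNIV. A i (L (space_dir i))) \<noteq> 0"
begin

abbreviation C where "C \<equiv> operator_norm s Q T"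

lemma Q_lebesgue: "Q \<in> sets lebesgue"
  using Q by auto

lemma space_dir_Basis: "space_dir (i::'n) \<in> Basis"
  by (simp add: space_dir_def Basis_prod_def axis_in_Basis_iff)

lemma has_weak_deriv_spatial:
  assumes "v \<in> sobolev s Q"
  shows "has_weak_deriv Q {#space_dir i#} v (weak_spatial Q i v)"
proof -
  have "{#space_dir i#} \<in> multi_indices 1" by (simp add: multi_indices_def space_dir_Basis)
  moreover have "1 \<le> nat \<lfloor>s\<rfloor>" using nat_floor_minus_one[OF s] by simp
  ultimately show ?thesis
    using assms sobolev_derivsD(1)[OF sobolev_derivs_weak_deriv] unfolding weak_spatial_def by blast
qed

lemma T_cong:
  assumes "\<And>i. has_weak_deriv Q {#space_dir i#} v (g i)"
  shows "AE z in lebesgue_on Q. T v z = (\<Sum>i\<in>UNIV. A i (g i z))"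
proof -
  have "AE z in lebesgue_on Q. \<forall>i\<in>UNIV. weak_spatial Q i v z = g i z"
    unfolding weak_spatial_def by (intro AE_finite_allI weak_deriv_AE Q assms) simp
  then show ?thesis by eventually_elim (simp add: T)
qed

lemma T_scale:
  assumes "v \<in> sobolev s Q"
  shows "AE z in lebesgue_on Q. T (\<lambda>z. c *\<^sub>R v z) z = c *\<^sub>R T v z"
proof -
  have "AE z in lebesgue_on Q. T (\<lambda>z. c *\<^sub>R v z) z = (\<Sum>i\<in>UNIV. A i (c *\<^sub>R weak_spatial Q i v z))"
    by (intro T_cong has_weak_deriv_linear[where A = "\<lambda>x. c *\<^sub>R x"] Q_lebesgue
        bounded_linear_scaleR_right has_weak_deriv_spatial assms) (simp add: space_dir_Basis)
  then show ?thesis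
    by eventually_elim (simp add: T scaleR_sum_right linear_scale bounded_linear.linear[OF A(1)])
qed

lemma T_diff:
  assumes v: "v \<in> sobolev s Q" and w: "\<And>i. has_weak_deriv Q {#space_dir i#} w (g i)"
  shows "AE z in lebesgue_on Q. T (\<lambda>z. v z - w z) z = T v z - (\<Sum>i\<in>UNIV. A i (g i z))"
proof -
  have "has_weak_deriv Q {#space_dir i#} (\<lambda>z. v z + - w z) (\<lambda>z. weak_spatial Q i v z + - g i z)" for i
    by (intro has_weak_deriv_add has_weak_deriv_linear[where A = uminus] Q_lebesgue
        has_weak_deriv_spatial v w bounded_linear_minus bounded_linear_ident)
      (simp_all add: space_dir_Basis)
  from T_cong[OF this] show ?thesis
    by eventually_elim (simp add: T linear_diff bounded_linear.linear[OF A(1)] sum_subtractf)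
qed

lemma T_sobolev:
  assumes v: "v \<in> sobolev s Q"
  shows "T v \<in> sobolev (s - 1) Q"
    and "sobolev_norm (s - 1) Q (T v) \<le> real CARD('n) * sobolev_norm s Q v"
proof -
  have D: "weak_spatial Q i v \<in> sobolev (s - 1) Q"
    "sobolev_norm (s - 1) Q (weak_spatial Q i v) \<le> sobolev_norm s Q v" for i
    unfolding weak_spatial_def using sobolev_weak_deriv[OF s Q(1) space_dir_Basis v] by auto
  have AD: "(\<lambda>z. A i (weak_spatial Q i v z)) \<in> sobolev (s - 1) Q"
    "sobolev_norm (s - 1) Q (\<lambda>z. A i (weak_spatial Q i v z)) \<le> sobolev_norm s Q v" for i
    using sobolev_linear[OF Q(1) D(1)[of i] A(1)[of i], where B = 1] A(2)[of i] D(2)[of i] by auto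
  show "T v \<in> sobolev (s - 1) Q"
    unfolding T by (intro sobolev_sum Q AD) auto
  have "sobolev_norm (s - 1) Q (T v) \<le> (\<Sum>i\<in>UNIV. sobolev_norm (s - 1) Q (\<lambda>z. A i (weak_spatial Q i v z)))"
    unfolding T by (intro sobolev_sum(2) Q AD) auto
  also have "\<dots> \<le> (\<Sum>i\<in>(UNIV :: 'n set). sobolev_norm s Q v)"
    by (intro sum_mono AD)
  finally show "sobolev_norm (s - 1) Q (T v) \<le> real CARD('n) * sobolev_norm s Q v" by simp
qed

lemma T_norm_le:
  "v \<in> sobolev s Q \<Longrightarrow> sobolev_norm (s - 1) Q (T v) \<le> C * sobolev_norm s Q v"
  by (rule operator_norm_bound[OF Q(1) T_sobolev T_scale])

lemma C_pos: "C > 0"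
proof -
  obtain L where L: "bounded_linear L" and ne: "(\<Sum>i\<in>UNIV. A i (L (space_dir i))) \<noteq> 0"
    using nontrivial by blast
  note L' = linear_in_sobolev[OF s Q(1,2) L]
  have "AE z in lebesgue_on Q. T L z = (\<Sum>i\<in>UNIV. A i (L (space_dir i)))"
    by (rule T_cong[OF L'(2)[OF space_dir_Basis]])
  then have "0 < sobolev_norm (s - 1) Q (T L)"
    by (rule sobolev_norm_pos[OF Q T_sobolev(1)[OF L'(1)] _ ne])
  also have "\<dots> \<le> C * sobolev_norm s Q L" by (rule T_norm_le[OF L'(1)])
  finally show ?thesis
    using sobolev_norm_nonneg[of s Q L] by (simp add: zero_less_mult_iff)
qed

text \<open>
  Let \<open>w\<close> be a best approximation of \<open>v\<close> and \<open>u\<^sub>\<rho>\<close> the combination of the \<open>G j\<close> with the same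
  coefficients.  On the features the weak derivatives are the classical ones, so \<open>u - u\<^sub>\<rho> = T (v - w)\<close>
  almost everywhere, and the operator norm controls the error.
\<close>

lemma exists_structure_preserving_approximation:
  fixes F :: "nat \<Rightarrow> (real^'n) \<times> real \<Rightarrow> 'b" and G :: "nat \<Rightarrow> (real^'n) \<times> real \<Rightarrow> 'c"
  assumes F: "\<And>j. j < m \<Longrightarrow> F j \<in> sobolev s Q"
    and d: "\<And>j z. j < m \<Longrightarrow> z \<in> Q \<Longrightarrow> F j differentiable (at z)"
    and c: "\<And>j i. j < m \<Longrightarrow> continuous_on Q (partial_deriv (space_dir i) (F j))"
    and G: "\<And>j z. j < m \<Longrightarrow> z \<in> Q \<Longrightarrow> G j z = (\<Sum>i\<in>UNIV. A i (partial_deriv (space_dir i) (F j) z))"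
    and v: "v \<in> sobolev s Q" and u: "AE z in lebesgue_on Q. u z = T v z"
  shows "\<exists>u\<^sub>\<rho>\<in>feature_span m G. (\<lambda>z. u z - u\<^sub>\<rho> z) \<in> sobolev (s - 1) Q \<and>
    sobolev_norm (s - 1) Q (\<lambda>z. u z - u\<^sub>\<rho> z)
      \<le> C * (INF w\<^sub>\<rho>\<in>feature_span m F. sobolev_norm s Q (\<lambda>z. v z - w\<^sub>\<rho> z))"
proof -
  obtain \<alpha> where \<alpha>: "\<And>\<beta>. sobolev_norm s Q (\<lambda>z. v z - (\<Sum>j<m. \<alpha> j *\<^sub>R F j z))
      \<le> sobolev_norm s Q (\<lambda>z. v z - (\<Sum>j<m. \<beta> j *\<^sub>R F j z))"
  proof -
    have "\<exists>\<alpha>. \<forall>\<beta>. sobolev_norm s Q (\<lambda>z. v z - (\<Sum>j<m. \<alpha> j *\<^sub>R F j z))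
      \<le> sobolev_norm s Q (\<lambda>z. v z - (\<Sum>j<m. \<beta> j *\<^sub>R F j z))"
      by (rule best_approximation[where S = "sobolev s Q"])
        (use sobolev_add[OF Q(1)] sobolev_scaleR[OF Q(1)] sobolev_norm_nonneg F v in auto)
    then show ?thesis using that by blast
  qed
  define w where "w = (\<lambda>z. \<Sum>j<m. \<alpha> j *\<^sub>R F j z)"
  define u\<^sub>\<rho> where "u\<^sub>\<rho> = (\<lambda>z. \<Sum>j<m. \<alpha> j *\<^sub>R G j z)"
  have "k \<le> m \<Longrightarrow> has_weak_deriv Q {#space_dir i#} (\<lambda>z. \<Sum>j<k. \<alpha> j *\<^sub>R F j z)
      (\<lambda>z. \<Sum>j<k. \<alpha> j *\<^sub>R partial_deriv (space_dir i) (F j) z)" for k i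
  proof (induction k)
    case (Suc k)
    have "has_weak_deriv Q {#space_dir i#} (F k) (partial_deriv (space_dir i) (F k))"
      by (rule has_weak_deriv_classical[OF Q(1) space_dir_Basis d c]) (use Suc.prems in auto)
    then have "has_weak_deriv Q {#space_dir i#} (\<lambda>z. \<alpha> k *\<^sub>R F k z)
        (\<lambda>z. \<alpha> k *\<^sub>R partial_deriv (space_dir i) (F k) z)"
      by (intro has_weak_deriv_linear[where A = "\<lambda>x. \<alpha> k *\<^sub>R x"] Q_lebesgue
          bounded_linear_scaleR_right) (simp_all add: space_dir_Basis)
    then show ?case
      using has_weak_deriv_add[OF Q_lebesgue, of "{#space_dir i#}"] Suc by (simp add: space_dir_Basis)
  qed (simp add: has_weak_deriv_zero)
  then have "has_weak_deriv Q {#space_dir i#} w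
      (\<lambda>z. \<Sum>j<m. \<alpha> j *\<^sub>R partial_deriv (space_dir i) (F j) z)" for i
    unfolding w_def by blast
  from T_diff[OF v this]
  have ae: "AE z in lebesgue_on Q. T (\<lambda>z. v z - w z) z = u z - u\<^sub>\<rho> z"
    using u AE_space
  proof eventually_elim
    case (elim z)
    have "(\<Sum>i\<in>UNIV. A i (\<Sum>j<m. \<alpha> j *\<^sub>R partial_deriv (space_dir i) (F j) z))
        = (\<Sum>i\<in>UNIV. \<Sum>j<m. \<alpha> j *\<^sub>R A i (partial_deriv (space_dir i) (F j) z))"
      by (simp add: linear_sum linear_scale bounded_linear.linear[OF A(1)])
    also have "\<dots> = (\<Sum>j<m. \<alpha> j *\<^sub>R (\<Sum>i\<in>UNIV. A i (partial_deriv (space_dir i) (F j) z)))"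
      by (subst sum.swap) (simp add: scaleR_sum_right)
    also have "\<dots> = u\<^sub>\<rho> z" unfolding u\<^sub>\<rho>_def using elim(3) by (intro sum.cong) (auto simp: G)
    finally show ?case using elim by simp
  qed
  have wS: "w \<in> sobolev s Q"
  proof (cases m)
    case 0
    then show ?thesis by (simp add: w_def zero_in_sobolev[OF Q(1)])
  next
    case (Suc n)
    then show ?thesis unfolding w_def
      by (intro sobolev_sum(1)[OF Q(1)] sobolev_scaleR[OF Q(1)] F) auto
  qed
  then have vw: "(\<lambda>z. v z - w z) \<in> sobolev s Q"
    using sobolev_add(1)[OF Q(1) v sobolev_scaleR(1)[OF Q(1), of w s "- 1"]] by simp
  note cong = sobolev_cong_AE[OF Q(1) T_sobolev(1)[OF vw] ae]
  have "sobolev_norm (s - 1) Q (\<lambda>z. u z - u\<^sub>\<rho> z) \<le> C * sobolev_norm s Q (\<lambda>z. v z - w z)"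
    unfolding cong(2) by (rule T_norm_le[OF vw])
  also have "\<dots> \<le> C * (INF w\<^sub>\<rho>\<in>feature_span m F. sobolev_norm s Q (\<lambda>z. v z - w\<^sub>\<rho> z))"
  proof (rule mult_left_mono)
    show "sobolev_norm s Q (\<lambda>z. v z - w z)
        \<le> (INF w\<^sub>\<rho>\<in>feature_span m F. sobolev_norm s Q (\<lambda>z. v z - w\<^sub>\<rho> z))"
      by (rule cINF_greatest) (use \<alpha> in \<open>auto simp: feature_span_def w_def\<close>)
    show "C \<ge> 0" using C_pos by simp
  qed
  finally show ?thesis
    using cong(1) by (intro bexI[of _ u\<^sub>\<rho>]) (auto simp: feature_span_def u\<^sub>\<rho>_def)
qed

end

section \<open>Convergence with high probability\<close>

text \<open>
  On the event that some \<open>w\<close> is closer than \<open>\<epsilon> / C\<close>, the quasi-optimality estimate yields an error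
  below \<open>\<epsilon>\<close>.
\<close>

lemma with_high_prob_transfer:
  fixes err :: "nat \<Rightarrow> 'w \<Rightarrow> real" and dist :: "nat \<Rightarrow> 'w \<Rightarrow> 'v \<Rightarrow> real"
  assumes C: "C > 0" and nonneg: "\<And>k \<omega> w. dist k \<omega> w \<ge> 0"
    and quasi: "\<And>k \<omega>. \<omega> \<in> space M \<Longrightarrow> err k \<omega> \<le> C * (INF w\<in>W k \<omega>. dist k \<omega> w)"
    and approx: "\<And>\<epsilon>. \<epsilon> > 0 \<Longrightarrow> with_high_prob M (\<lambda>k \<omega>. \<exists>w\<in>W k \<omega>. dist k \<omega> w < \<epsilon>)"
    and \<epsilon>: "\<epsilon> > 0"
  shows "with_high_prob M (\<lambda>k \<omega>. err k \<omega> < \<epsilon>)"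
proof -
  have "err k \<omega> < \<epsilon>" if \<omega>: "\<omega> \<in> space M" and w: "\<exists>w\<in>W k \<omega>. dist k \<omega> w < \<epsilon> / C" for k \<omega>
  proof -
    obtain w where w: "w \<in> W k \<omega>" "dist k \<omega> w < \<epsilon> / C" using w by blast
    have "(INF w\<in>W k \<omega>. dist k \<omega> w) \<le> dist k \<omega> w"
      by (rule cINF_lower[OF _ w(1)]) (auto intro!: bdd_belowI[of _ 0] nonneg)
    then have "C * (INF w\<in>W k \<omega>. dist k \<omega> w) < \<epsilon>"
      using w(2) C by (simp add: pos_less_divide_eq mult.commute) (smt (verit) mult_left_mono)
    then show ?thesis using quasi[OF \<omega>, of k] by simp
  qed
  note imp = this
  show ?thesis unfolding with_high_prob_def
  proof (intro allI impI)
    fix \<delta> :: real assume "\<delta> > 0"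
    then have "\<forall>\<^sub>F k in sequentially. \<exists>A\<in>sets M. measure M A \<ge> 1 - \<delta> \<and>
        (\<forall>\<omega>\<in>A. \<exists>w\<in>W k \<omega>. dist k \<omega> w < \<epsilon> / C)"
      using approx[of "\<epsilon> / C"] C \<epsilon> unfolding with_high_prob_def by simp
    then show "\<forall>\<^sub>F k in sequentially. \<exists>A\<in>sets M. measure M A \<ge> 1 - \<delta> \<and> (\<forall>\<omega>\<in>A. err k \<omega> < \<epsilon>)"
    proof eventually_elim
      case (elim k)
      then obtain A where A: "A \<in> sets M" "measure M A \<ge> 1 - \<delta>" "\<forall>\<omega>\<in>A. \<exists>w\<in>W k \<omega>. dist k \<omega> w < \<epsilon> / C"
        by blast
      then have "\<forall>\<omega>\<in>A. err k \<omega> < \<epsilon>" using imp sets.sets_into_space by blast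
      with A show ?case by blast
    qed
  qed
qed


section \<open>Derivatives of network features\<close>

text \<open>The linear part of the affine function \<open>hidden p\<close>.\<close>

definition hidden_deriv :: "'n::finite params \<Rightarrow> (real^'n) \<times> real \<Rightarrow> real" where
  "hidden_deriv p y = fst p \<bullet> fst y + fst (snd p) * snd y"

lemma hidden_add: "hidden p (z + y) = hidden p z + hidden_deriv p y"
  by (cases p; cases z; cases y) (simp add: hidden_def hidden_deriv_def inner_add_right algebra_simps)

lemma bounded_linear_hidden_deriv: "bounded_linear (hidden_deriv p)"
  unfolding hidden_deriv_def[abs_def]
  by (intro bounded_linear_add bounded_linear_compose[OF bounded_linear_inner_right bounded_linear_fst]
      bounded_linear_compose[OF bounded_linear_mult_right bounded_linear_snd])

lemma hidden_has_derivative: "(hidden p has_derivative hidden_deriv p) (at z)"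
proof -
  have eq: "hidden p = (\<lambda>z. hidden p 0 + hidden_deriv p z)"
    by (rule ext) (simp add: hidden_add[symmetric])
  have "((\<lambda>z. hidden p 0 + hidden_deriv p z) has_derivative (\<lambda>y. 0 + hidden_deriv p y)) (at z)"
    by (intro has_derivative_add has_derivative_const bounded_linear_imp_has_derivative
        bounded_linear_hidden_deriv)
  then show ?thesis by (subst eq) simp
qed

lemma hidden_deriv_space_dir: "hidden_deriv p (space_dir k) = fst p $ k"
  by (simp add: hidden_deriv_def space_dir_def inner_axis)

text \<open>
  If the spatial weights do not vanish, the hidden variable sweeps out an interval along the
  direction \<open>w\<close>, so differentiability of the feature is inherited by the activation function.
\<close>

lemma activation_differentiable:
  assumes w: "fst p \<noteq> 0" and d: "scalar_feature \<Theta> p differentiable (at z)"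
  shows "(\<Theta> has_real_derivative deriv \<Theta> (hidden p z)) (at (hidden p z))"
proof -
  \<comment> \<open>Along \<open>e\<close> the hidden variable grows with unit speed.\<close>
  define e :: "(real^'a) \<times> real" where "e = ((1 / (fst p \<bullet> fst p)) *\<^sub>R fst p, 0)"
  have e: "hidden_deriv p (t *\<^sub>R e) = t" for t using w by (simp add: hidden_deriv_def e_def)
  let ?g = "\<lambda>y. z + (y - hidden p z) *\<^sub>R e"
  have \<Theta>: "\<Theta> = (\<lambda>y. scalar_feature \<Theta> p (?g y))"
    by (simp add: scalar_feature_def hidden_add e)
  obtain D where D: "(scalar_feature \<Theta> p has_derivative D) (at z)"
    using d unfolding differentiable_def by blast
  have "(?g has_derivative (\<lambda>t. t *\<^sub>R e)) (at (hidden p z))"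
    by (auto intro!: derivative_eq_intros)
  moreover have "(scalar_feature \<Theta> p has_derivative D) (at (?g (hidden p z)))" using D by simp
  ultimately have "((\<lambda>y. scalar_feature \<Theta> p (?g y)) has_derivative (\<lambda>t. D (t *\<^sub>R e))) (at (hidden p z))"
    by (rule has_derivative_compose)
  then have "\<Theta> differentiable (at (hidden p z))"
    unfolding \<Theta>[symmetric] differentiable_def by blast
  then show ?thesis by (simp add: real_differentiable_def DERIV_deriv_iff_real_differentiable)
qed

text \<open>
  This is the chain rule if the spatial weights do not all vanish.  Otherwise \<open>\<Theta>\<close> need not be
  differentiable at the hidden variable, but both sides are zero: the feature is constant in space.
\<close>

lemma partial_deriv_scalar_feature:
  assumes d: "scalar_feature \<Theta> p differentiable (at z)"
  shows "partial_deriv (space_dir k) (scalar_feature \<Theta> p) z = fst p $ k * deriv \<Theta> (hidden p z)"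
proof (cases "fst p = 0")
  case True
  obtain D where D: "(scalar_feature \<Theta> p has_derivative D) (at z)"
    using d unfolding differentiable_def by blast
  have "((\<lambda>t. z + t *\<^sub>R space_dir k) has_derivative (\<lambda>t. t *\<^sub>R space_dir k)) (at 0)"
    by (auto intro!: derivative_eq_intros)
  moreover have "(scalar_feature \<Theta> p has_derivative D) (at (z + 0 *\<^sub>R space_dir k))" using D by simp
  ultimately have "((\<lambda>t. scalar_feature \<Theta> p (z + t *\<^sub>R space_dir k)) has_derivative
      (\<lambda>t. D (t *\<^sub>R space_dir k))) (at 0)"
    by (rule has_derivative_compose)
  moreover have "(\<lambda>t. scalar_feature \<Theta> p (z + t *\<^sub>R space_dir k)) = (\<lambda>_. scalar_feature \<Theta> p z)"
    using True by (simp add: scalar_feature_def hidden_add hidden_deriv_def space_dir_def)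
  ultimately have "(\<lambda>t. D (t *\<^sub>R space_dir k)) = (\<lambda>_. 0)"
    using has_derivative_unique[OF _ has_derivative_const] by metis
  then have "D (space_dir k) = 0" by (metis scaleR_one)
  then show ?thesis using True partial_deriv_eqI[OF D] by simp
next
  case False
  have "((\<lambda>z. \<Theta> (hidden p z)) has_derivative
      (\<lambda>y. hidden_deriv p y * deriv \<Theta> (hidden p z))) (at z)"
    using has_derivative_compose[OF hidden_has_derivative
      activation_differentiable[OF False d, unfolded has_field_derivative_def]]
    by (simp add: mult.commute)
  from partial_deriv_eqI[OF this, of "space_dir k"] show ?thesis
    by (simp add: scalar_feature_def[abs_def] hidden_deriv_space_dir)
qed

lemma admissible_featureD:
  assumes "admissible_feature s Q \<Theta> p"
  shows "scalar_feature \<Theta> p \<in> sobolev s Q"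
    and "z \<in> Q \<Longrightarrow> scalar_feature \<Theta> p differentiable (at z)"
    and "z \<in> Q \<Longrightarrow> partial_deriv (space_dir k) (scalar_feature \<Theta> p) differentiable (at z)"
    and "continuous_on Q (partial_deriv (space_dir k) (scalar_feature \<Theta> p))"
proof -
  have B: "space_dir k \<in> Basis"
    by (simp add: space_dir_def Basis_prod_def axis_in_Basis_iff)
  have C2: "Ck_on (Suc (Suc 0)) (scalar_feature \<Theta> p) Q"
    using assms by (simp add: admissible_feature_def numeral_2_eq_2)
  show "scalar_feature \<Theta> p \<in> sobolev s Q" using assms by (simp add: admissible_feature_def)
  show "z \<in> Q \<Longrightarrow> scalar_feature \<Theta> p differentiable (at z)" using C2 by simp
  have C1: "Ck_on (Suc 0) (partial_deriv (space_dir k) (scalar_feature \<Theta> p)) Q" using C2 B by simp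
  then show "z \<in> Q \<Longrightarrow> partial_deriv (space_dir k) (scalar_feature \<Theta> p) differentiable (at z)" by simp
  show "continuous_on Q (partial_deriv (space_dir k) (scalar_feature \<Theta> p))"
    using Ck_on_SucD[OF C1] by simp
qed

text \<open>
  If some spatial weight \<open>w\<^sub>l\<close> is nonzero, then \<open>\<Theta>' = \<partial>\<^sub>l (feature) / w\<^sub>l\<close> is itself a differentiable
  feature, and \<open>r\<close> is \<open>\<Theta>''\<close> at the hidden variable.  Otherwise the products vanish identically, and
  \<open>r = 0\<close> serves.
\<close>

lemma weighted_activation_has_derivative:
  assumes Q: "open Q" and ad: "admissible_feature s Q \<Theta> p" and z: "z \<in> Q"
  shows "\<exists>r. \<forall>k. ((\<lambda>z. fst p $ k * deriv \<Theta> (hidden p z)) has_derivative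
    (\<lambda>y. fst p $ k * r * hidden_deriv p y)) (at z)"
proof (cases "fst p = 0")
  case True
  then show ?thesis by (auto intro!: exI[of _ 0])
next
  case False
  then obtain l where l: "fst p $ l \<noteq> 0" by (auto simp: vec_eq_iff)
  note ad' = admissible_featureD[OF ad]
  have eq: "scalar_feature (deriv \<Theta>) p y
      = (1 / fst p $ l) * partial_deriv (space_dir l) (scalar_feature \<Theta> p) y" if "y \<in> Q" for y
    using partial_deriv_scalar_feature[OF ad'(2)[OF that], of l] l by (simp add: scalar_feature_def)
  obtain D where "(partial_deriv (space_dir l) (scalar_feature \<Theta> p) has_derivative D) (at z)"
    using ad'(3)[OF z, of l] unfolding differentiable_def by blast
  then have "((\<lambda>y. (1 / fst p $ l) * partial_deriv (space_dir l) (scalar_feature \<Theta> p) y)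
      has_derivative (\<lambda>y. (1 / fst p $ l) * D y)) (at z)"
    by (rule has_derivative_mult_right)
  then have "(scalar_feature (deriv \<Theta>) p has_derivative (\<lambda>y. (1 / fst p $ l) * D y)) (at z)"
    by (rule has_derivative_transform_within_open[OF _ Q z]) (simp add: eq)
  then have "scalar_feature (deriv \<Theta>) p differentiable (at z)" unfolding differentiable_def by blast
  from activation_differentiable[OF False this]
  have "((\<lambda>z. deriv \<Theta> (hidden p z)) has_derivative
      (\<lambda>y. deriv (deriv \<Theta>) (hidden p z) * hidden_deriv p y)) (at z)"
    using has_derivative_compose[OF hidden_has_derivative] unfolding has_field_derivative_def by blast
  from has_derivative_mult_right[OF this] show ?thesis
    by (intro exI[of _ "deriv (deriv \<Theta>) (hidden p z)"]) (simp add: mult.assoc)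
qed

section \<open>Divergence-free features\<close>

definition div_free_at ::
  "((real^'n::finite) \<times> real \<Rightarrow> real^'n) \<Rightarrow> (real^'n) \<times> real \<Rightarrow> bool" where
  "div_free_at u z \<longleftrightarrow> u differentiable (at z) \<and> spatial_div u z = 0"

lemma div_free_atI:
  assumes D: "(u has_derivative D) (at z)" and "(\<Sum>i\<in>UNIV. D (space_dir i) $ i) = 0"
  shows "div_free_at u z"
  using assms partial_deriv_eqI[OF D] by (auto simp: div_free_at_def spatial_div_def differentiable_def)

lemma div_free_feature_span:
  assumes G: "\<And>j. j < m \<Longrightarrow> div_free_at (G j) z" and u: "u \<in> feature_span m G"
  shows "div_free_at u z"
proof -
  obtain \<alpha> where u: "u = (\<lambda>z. \<Sum>j<m. \<alpha> j *\<^sub>R G j z)" using u by (auto simp: feature_span_def)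
  let ?D = "\<lambda>j. frechet_derivative (G j) (at z)"
  have "(u has_derivative (\<lambda>y. \<Sum>j<m. \<alpha> j *\<^sub>R ?D j y)) (at z)"
    unfolding u using G
    by (intro has_derivative_sum has_derivative_scaleR_right)
      (auto simp: div_free_at_def frechet_derivative_works)
  moreover have "(\<Sum>i\<in>UNIV. (\<Sum>j<m. \<alpha> j *\<^sub>R ?D j (space_dir i)) $ i) = 0"
  proof -
    have "(\<Sum>i\<in>UNIV. (\<Sum>j<m. \<alpha> j *\<^sub>R ?D j (space_dir i)) $ i)
        = (\<Sum>j<m. \<alpha> j * (\<Sum>i\<in>UNIV. ?D j (space_dir i) $ i))"
      by (simp add: sum_distrib_left) (rule sum.swap)
    also have "\<dots> = 0"
      using G by (intro sum.neutral) (auto simp: div_free_at_def spatial_div_def partial_deriv_def)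
    finally show ?thesis .
  qed
  ultimately show ?thesis by (rule div_free_atI)
qed

lemma vector_2_axis: "(vector [a, b] :: real^2) = a *\<^sub>R axis 1 1 + b *\<^sub>R axis 2 1"
  by (simp add: vec_eq_iff forall_2 axis_def)

lemma vector_3_axis:
  "(vector [a, b, c] :: real^3) = a *\<^sub>R axis 1 1 + b *\<^sub>R axis 2 1 + c *\<^sub>R axis 3 1"
  by (simp add: vec_eq_iff forall_3 axis_def)

text \<open>
  All derivatives of \<open>w\<^sub>k \<Theta>'\<close> share the factor \<open>r\<close>, so the divergence is \<open>r (w\<^sub>2 w\<^sub>1 - w\<^sub>1 w\<^sub>2) = 0\<close>; in three
  dimensions each \<open>r i\<close> is multiplied by such a difference.
\<close>

lemma sp_feature2_div_free:
  assumes Q: "open Q" and ad: "admissible_feature s Q \<Theta> p" and z: "z \<in> Q"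
  shows "div_free_at (sp_feature2 \<Theta> p) z"
proof -
  obtain r where r: "\<And>k. ((\<lambda>z. fst p $ k * deriv \<Theta> (hidden p z)) has_derivative
      (\<lambda>y. fst p $ k * r * hidden_deriv p y)) (at z)"
    using weighted_activation_has_derivative[OF Q ad z] by blast
  have "(sp_feature2 \<Theta> p has_derivative
      (\<lambda>y. (fst p $ 2 * r * hidden_deriv p y) *\<^sub>R axis 1 1
        + (- (fst p $ 1 * r * hidden_deriv p y)) *\<^sub>R axis 2 1)) (at z)"
    unfolding sp_feature2_def[abs_def] vector_2_axis mult_minus_left
    by (intro has_derivative_add has_derivative_scaleR_left has_derivative_minus r)
  then show ?thesis
    by (rule div_free_atI) (simp add: sum_2 axis_def hidden_deriv_space_dir)
qed

lemma sp_feature3_div_free: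
  assumes Q: "open Q" and ad: "\<And>i. admissible_feature s Q (\<Theta> i) (p i)" and z: "z \<in> Q"
  shows "div_free_at (sp_feature3 \<Theta> p) z"
proof -
  have "\<forall>i. \<exists>r. \<forall>k. ((\<lambda>z. fst (p i) $ k * deriv (\<Theta> i) (hidden (p i) z)) has_derivative
      (\<lambda>y. fst (p i) $ k * r * hidden_deriv (p i) y)) (at z)"
    using weighted_activation_has_derivative[OF Q ad z] by blast
  then obtain r where r: "\<And>i k. ((\<lambda>z. fst (p i) $ k * deriv (\<Theta> i) (hidden (p i) z)) has_derivative
      (\<lambda>y. fst (p i) $ k * r i * hidden_deriv (p i) y)) (at z)"
    by metis
  have "(sp_feature3 \<Theta> p has_derivative
      (\<lambda>y. (fst (p 3) $ 2 * r 3 * hidden_deriv (p 3) y - fst (p 2) $ 3 * r 2 * hidden_deriv (p 2) y) *\<^sub>R axis 1 1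
        + (fst (p 1) $ 3 * r 1 * hidden_deriv (p 1) y - fst (p 3) $ 1 * r 3 * hidden_deriv (p 3) y) *\<^sub>R axis 2 1
        + (fst (p 2) $ 1 * r 2 * hidden_deriv (p 2) y - fst (p 1) $ 2 * r 1 * hidden_deriv (p 1) y) *\<^sub>R axis 3 1)) (at z)"
    unfolding sp_feature3_def[abs_def] Let_def vector_3_axis
    by (intro has_derivative_add has_derivative_scaleR_left has_derivative_diff r)
  then show ?thesis
    by (rule div_free_atI) (simp add: sum_3 axis_def hidden_deriv_space_dir)
qed

section \<open>The perpendicular gradient and the curl\<close>

definition grad_perp_coeff :: "2 \<Rightarrow> real \<Rightarrow> real^2" where
  "grad_perp_coeff i r = r *\<^sub>R (if i = 1 then - axis 2 1 else axis 1 1)"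

definition curl_coeff :: "3 \<Rightarrow> real^3 \<Rightarrow> real^3" where
  "curl_coeff i w = cross3 (axis i 1) w"

lemma first_order_operator_grad_perp:
  assumes "s \<ge> 1" "open Q" "bounded Q" "Q \<noteq> {}"
  shows "first_order_operator s Q grad_perp_coeff (grad_perp Q)"
proof (rule first_order_operator.intro)
  show "bounded_linear (grad_perp_coeff i)" for i
    unfolding grad_perp_coeff_def[abs_def] by (rule bounded_linear_scaleR_left)
  show "norm (grad_perp_coeff i w) \<le> norm w" for i w
    by (simp add: grad_perp_coeff_def)
  show "grad_perp Q v = (\<lambda>z. \<Sum>i\<in>UNIV. grad_perp_coeff i (weak_spatial Q i v z))" for v
    by (simp add: grad_perp_def grad_perp_coeff_def sum_2 vector_2_axis fun_eq_iff)
  \<comment> \<open>The stream function \<open>x\<close> has the image \<open>(0, -1)\<close>.\<close>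
  have "bounded_linear (\<lambda>z :: (real^2) \<times> real. fst z $ 1)"
    by (rule bounded_linear_compose[OF bounded_linear_vec_nth bounded_linear_fst])
  moreover have "(\<Sum>i\<in>UNIV. grad_perp_coeff i (fst (space_dir i) $ 1)) \<noteq> 0"
    by (simp add: grad_perp_coeff_def space_dir_def sum_2 vec_eq_iff forall_2 axis_def)
  ultimately show "\<exists>L. bounded_linear L \<and> (\<Sum>i\<in>UNIV. grad_perp_coeff i (L (space_dir i))) \<noteq> 0"
    by blast
qed (use assms in auto)

lemma norm_cross3_axis_le: "norm (cross3 (axis i 1) w) \<le> norm w"
proof (rule power2_le_imp_le)
  have "(norm (cross3 (axis i 1) w))\<^sup>2 = (norm w)\<^sup>2 - (axis i 1 \<bullet> w)\<^sup>2"
    using norm_cross[of "axis i 1" w] by simp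
  then show "(norm (cross3 (axis i 1) w))\<^sup>2 \<le> (norm w)\<^sup>2" by simp
qed simp

lemma curl_coeff_sum:
  "(\<Sum>i\<in>UNIV. curl_coeff i (W i)) =
    vector [W 2 $ 3 - W 3 $ 2, W 3 $ 1 - W 1 $ 3, W 1 $ 2 - W 2 $ 1]"
  by (simp add: curl_coeff_def cross3_def sum_3 vec_eq_iff forall_3 axis_def)

lemma first_order_operator_curl:
  assumes "s \<ge> 1" "open Q" "bounded Q" "Q \<noteq> {}"
  shows "first_order_operator s Q curl_coeff (curl Q)"
proof (rule first_order_operator.intro)
  show "bounded_linear (curl_coeff i)" for i
    unfolding curl_coeff_def[abs_def]
    by (rule bounded_bilinear.bounded_linear_right[OF bilinear_conv_bounded_bilinear[THEN iffD1, OF bilinear_cross]])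
  show "norm (curl_coeff i w) \<le> norm w" for i w
    unfolding curl_coeff_def by (rule norm_cross3_axis_le)
  show "curl Q v = (\<lambda>z. \<Sum>i\<in>UNIV. curl_coeff i (weak_spatial Q i v z))" for v
    by (simp add: curl_def curl_coeff_sum)
  \<comment> \<open>The vector potential \<open>(0, x, 0)\<close> has the image \<open>(0, 0, 1)\<close>.\<close>
  have "bounded_linear (\<lambda>z :: (real^3) \<times> real. (fst z $ 1) *\<^sub>R (axis 2 1 :: real^3))"
    by (intro bounded_linear_compose[OF bounded_linear_scaleR_left]
        bounded_linear_compose[OF bounded_linear_vec_nth bounded_linear_fst])
  moreover have "(\<Sum>i\<in>UNIV. curl_coeff i ((fst (space_dir i) $ 1) *\<^sub>R (axis 2 1 :: real^3))) \<noteq> 0"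
    unfolding curl_coeff_sum by (simp add: space_dir_def vec_eq_iff forall_3 axis_def)
  ultimately show "\<exists>L. bounded_linear L \<and> (\<Sum>i\<in>UNIV. curl_coeff i (L (space_dir i))) \<noteq> 0"
    by blast
qed (use assms in auto)

lemma sp_feature2_eq:
  assumes "scalar_feature \<Theta> p differentiable (at z)"
  shows "sp_feature2 \<Theta> p z = (\<Sum>i\<in>UNIV. grad_perp_coeff i (partial_deriv (space_dir i) (scalar_feature \<Theta> p) z))"
  unfolding partial_deriv_scalar_feature[OF assms]
  by (simp add: sp_feature2_def grad_perp_coeff_def sum_2 vector_2_axis)

lemma vector_feature_axis:
  "vector_feature \<Theta> p = (\<lambda>z. \<Sum>i\<in>UNIV. scalar_feature (\<Theta> i) (p i) z *\<^sub>R axis i 1)"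
  by (simp add: vector_feature_def fun_eq_iff vec_eq_iff axis_def if_distrib cong: if_cong)

lemma vector_feature_differentiable:
  assumes d: "\<And>i. scalar_feature (\<Theta> i) (p i) differentiable (at z)"
  shows "vector_feature \<Theta> p differentiable (at z)"
    and "partial_deriv e (vector_feature \<Theta> p) z
      = (\<Sum>i\<in>UNIV. partial_deriv e (scalar_feature (\<Theta> i) (p i)) z *\<^sub>R axis i 1)"
proof -
  have D: "(vector_feature \<Theta> p has_derivative
      (\<lambda>y. \<Sum>i\<in>UNIV. frechet_derivative (scalar_feature (\<Theta> i) (p i)) (at z) y *\<^sub>R axis i 1)) (at z)"
    unfolding vector_feature_axis
    by (intro has_derivative_sum has_derivative_scaleR_left) (use d frechet_derivative_works in blast)
  then show "vector_feature \<Theta> p differentiable (at z)" unfolding differentiable_def by blast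
  show "partial_deriv e (vector_feature \<Theta> p) z
      = (\<Sum>i\<in>UNIV. partial_deriv e (scalar_feature (\<Theta> i) (p i)) z *\<^sub>R axis i 1)"
    unfolding partial_deriv_eqI[OF D] by (simp add: partial_deriv_def)
qed

lemma sp_feature3_eq:
  assumes d: "\<And>i. scalar_feature (\<Theta> i) (p i) differentiable (at z)"
  shows "sp_feature3 \<Theta> p z = (\<Sum>i\<in>UNIV. curl_coeff i (partial_deriv (space_dir i) (vector_feature \<Theta> p) z))"
proof -
  have "partial_deriv (space_dir k) (vector_feature \<Theta> p) z $ i
      = fst (p i) $ k * deriv (\<Theta> i) (hidden (p i) z)" for k i
    unfolding vector_feature_differentiable(2)[OF d] partial_deriv_scalar_feature[OF d]
    by (simp add: axis_def if_distrib cong: if_cong)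
  then show ?thesis by (simp add: curl_coeff_sum sp_feature3_def Let_def)
qed

lemma vector_feature_sobolev:
  assumes Q: "open Q" and f: "\<And>i. scalar_feature (\<Theta> i) (p i) \<in> sobolev s Q"
  shows "vector_feature \<Theta> p \<in> sobolev s Q"
  unfolding vector_feature_axis
  by (intro sobolev_sum(1)[OF Q] sobolev_linear(1)[OF Q f bounded_linear_scaleR_left, where B = 1]) auto

lemma admissible_vector_featureD:
  assumes Q: "open Q" and ad: "\<And>i. admissible_feature s Q (\<Theta> i) (p i)"
  shows "vector_feature \<Theta> p \<in> sobolev s Q"
    and "z \<in> Q \<Longrightarrow> vector_feature \<Theta> p differentiable (at z)"
    and "continuous_on Q (partial_deriv (space_dir k) (vector_feature \<Theta> p))"
proof -
  note ad' = admissible_featureD[OF ad]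
  show "vector_feature \<Theta> p \<in> sobolev s Q" by (intro vector_feature_sobolev Q ad')
  show "z \<in> Q \<Longrightarrow> vector_feature \<Theta> p differentiable (at z)"
    by (intro vector_feature_differentiable ad')
  have "continuous_on Q (\<lambda>z. \<Sum>i\<in>UNIV. partial_deriv (space_dir k) (scalar_feature (\<Theta> i) (p i)) z
      *\<^sub>R (axis i 1 :: real^3))"
    by (intro continuous_on_sum continuous_on_scaleR ad' continuous_on_const)
  then show "continuous_on Q (partial_deriv (space_dir k) (vector_feature \<Theta> p))"
    using vector_feature_differentiable(2)[OF ad'(2)]
      continuous_on_cong[OF refl, of Q "partial_deriv (space_dir k) (vector_feature \<Theta> p)"] by simp
qed

section \<open>Structure-preserving approximation\<close>

theorem theorem3p18:
  fixes s t0 t1 :: real and M :: "'w measure"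
  assumes "s \<ge> 1" and "t0 < t1" and "prob_space M"
  shows
    "(\<forall>\<Omega> :: (real^2) set. open \<Omega> \<and> connected \<Omega> \<and> bounded \<Omega> \<and> \<Omega> \<noteq> {} \<longrightarrow>
      (let Q = \<Omega> \<times> {t0<..<t1}; C = operator_norm s Q (grad_perp Q) in
        C > 0 \<and>
        (\<forall>v\<in>sobolev s Q. grad_perp Q v \<in> sobolev (s - 1) Q \<and>
           sobolev_norm (s - 1) Q (grad_perp Q v) \<le> C * sobolev_norm s Q v) \<and>
        (\<forall>u v. weakly_div_free Q u \<and> v \<in> sobolev s Q \<and>
               (AE z in lebesgue_on Q. u z = grad_perp Q v z) \<longrightarrow>
          (\<forall>(m :: nat) (\<Theta> :: nat \<Rightarrow> real \<Rightarrow> real) (p :: nat \<Rightarrow> 2 params).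
             (\<forall>j<m. admissible_feature s Q (\<Theta> j) (p j)) \<longrightarrow>
             (\<exists>u\<^sub>\<rho>\<in>sp_space2 m \<Theta> p.
                (\<forall>z\<in>Q. u\<^sub>\<rho> differentiable (at z) \<and> spatial_div u\<^sub>\<rho> z = 0) \<and>
                (\<lambda>z. u z - u\<^sub>\<rho> z) \<in> sobolev (s - 1) Q \<and>
                sobolev_norm (s - 1) Q (\<lambda>z. u z - u\<^sub>\<rho> z)
                  \<le> C * (INF w\<^sub>\<rho>\<in>potential_space2 m \<Theta> p. sobolev_norm s Q (\<lambda>z. v z - w\<^sub>\<rho> z)))) \<and>
          (\<forall>(m :: nat \<Rightarrow> nat) (\<Theta> :: nat \<Rightarrow> nat \<Rightarrow> real \<Rightarrow> real)
             (P :: nat \<Rightarrow> nat \<Rightarrow> 'w \<Rightarrow> 2 params)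
             (u\<^sub>\<rho> :: nat \<Rightarrow> 'w \<Rightarrow> (real^2) \<times> real \<Rightarrow> real^2).
             filterlim m at_top sequentially \<and>
             (\<forall>k. \<forall>j<m k. P k j \<in> borel_measurable M \<and>
                (\<forall>\<omega>\<in>space M. admissible_feature s Q (\<Theta> k j) (P k j \<omega>))) \<and>
             (\<forall>k. \<forall>\<omega>\<in>space M.
                u\<^sub>\<rho> k \<omega> \<in> sp_space2 (m k) (\<Theta> k) (\<lambda>j. P k j \<omega>) \<and>
                sobolev_norm (s - 1) Q (\<lambda>z. u z - u\<^sub>\<rho> k \<omega> z)
                  \<le> C * (INF w\<^sub>\<rho>\<in>potential_space2 (m k) (\<Theta> k) (\<lambda>j. P k j \<omega>).
                           sobolev_norm s Q (\<lambda>z. v z - w\<^sub>\<rho> z))) \<and>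
             (\<forall>\<epsilon>>0. with_high_prob M (\<lambda>k \<omega>.
                \<exists>w\<^sub>\<rho>\<in>potential_space2 (m k) (\<Theta> k) (\<lambda>j. P k j \<omega>).
                  sobolev_norm s Q (\<lambda>z. v z - w\<^sub>\<rho> z) < \<epsilon>)) \<longrightarrow>
             (\<forall>\<epsilon>>0. with_high_prob M (\<lambda>k \<omega>.
                sobolev_norm (s - 1) Q (\<lambda>z. u z - u\<^sub>\<rho> k \<omega> z) < \<epsilon>)))))) \<and>
     (\<forall>\<Omega> :: (real^3) set. open \<Omega> \<and> connected \<Omega> \<and> bounded \<Omega> \<and> \<Omega> \<noteq> {} \<longrightarrow>
      (let Q = \<Omega> \<times> {t0<..<t1}; C = operator_norm s Q (curl Q) in
        C > 0 \<and>
        (\<forall>v\<in>sobolev s Q. curl Q v \<in> sobolev (s - 1) Q \<and>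
           sobolev_norm (s - 1) Q (curl Q v) \<le> C * sobolev_norm s Q v) \<and>
        (\<forall>u v. weakly_div_free Q u \<and> v \<in> sobolev s Q \<and>
               (AE z in lebesgue_on Q. u z = curl Q v z) \<longrightarrow>
          (\<forall>(m :: nat) (\<Theta> :: nat \<Rightarrow> 3 \<Rightarrow> real \<Rightarrow> real) (p :: nat \<Rightarrow> 3 \<Rightarrow> 3 params).
             (\<forall>j<m. \<forall>i. admissible_feature s Q (\<Theta> j i) (p j i)) \<longrightarrow>
             (\<exists>u\<^sub>\<rho>\<in>sp_space3 m \<Theta> p.
                (\<forall>z\<in>Q. u\<^sub>\<rho> differentiable (at z) \<and> spatial_div u\<^sub>\<rho> z = 0) \<and>
                (\<lambda>z. u z - u\<^sub>\<rho> z) \<in> sobolev (s - 1) Q \<and>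
                sobolev_norm (s - 1) Q (\<lambda>z. u z - u\<^sub>\<rho> z)
                  \<le> C * (INF w\<^sub>\<rho>\<in>potential_space3 m \<Theta> p. sobolev_norm s Q (\<lambda>z. v z - w\<^sub>\<rho> z)))) \<and>
          (\<forall>(m :: nat \<Rightarrow> nat) (\<Theta> :: nat \<Rightarrow> nat \<Rightarrow> 3 \<Rightarrow> real \<Rightarrow> real)
             (P :: nat \<Rightarrow> nat \<Rightarrow> 3 \<Rightarrow> 'w \<Rightarrow> 3 params)
             (u\<^sub>\<rho> :: nat \<Rightarrow> 'w \<Rightarrow> (real^3) \<times> real \<Rightarrow> real^3).
             filterlim m at_top sequentially \<and>
             (\<forall>k. \<forall>j<m k. \<forall>i. P k j i \<in> borel_measurable M \<and>
                (\<forall>\<omega>\<in>space M. admissible_feature s Q (\<Theta> k j i) (P k j i \<omega>))) \<and>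
             (\<forall>k. \<forall>\<omega>\<in>space M.
                u\<^sub>\<rho> k \<omega> \<in> sp_space3 (m k) (\<Theta> k) (\<lambda>j i. P k j i \<omega>) \<and>
                sobolev_norm (s - 1) Q (\<lambda>z. u z - u\<^sub>\<rho> k \<omega> z)
                  \<le> C * (INF w\<^sub>\<rho>\<in>potential_space3 (m k) (\<Theta> k) (\<lambda>j i. P k j i \<omega>).
                           sobolev_norm s Q (\<lambda>z. v z - w\<^sub>\<rho> z))) \<and>
             (\<forall>\<epsilon>>0. with_high_prob M (\<lambda>k \<omega>.
                \<exists>w\<^sub>\<rho>\<in>potential_space3 (m k) (\<Theta> k) (\<lambda>j i. P k j i \<omega>).
                  sobolev_norm s Q (\<lambda>z. v z - w\<^sub>\<rho> z) < \<epsilon>)) \<longrightarrow>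
             (\<forall>\<epsilon>>0. with_high_prob M (\<lambda>k \<omega>.
                sobolev_norm (s - 1) Q (\<lambda>z. u z - u\<^sub>\<rho> k \<omega> z) < \<epsilon>))))))"
proof (intro conjI allI impI, goal_cases)
  case (1 \<Omega>)
  define Q where "Q = \<Omega> \<times> {t0<..<t1}"
  have Q: "open Q" "bounded Q" "Q \<noteq> {}"
    using 1 \<open>t0 < t1\<close> by (auto simp: Q_def intro: open_Times bounded_Times)
  interpret first_order_operator s Q grad_perp_coeff "grad_perp Q"
    by (rule first_order_operator_grad_perp[OF \<open>s \<ge> 1\<close> Q])
  show ?case
    unfolding Let_def Q_def[symmetric]
  proof (intro conjI ballI allI impI, goal_cases)
    case 1
    show ?case by (rule C_pos)
  next
    case (2 v)
    then show ?case by (rule T_sobolev(1))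
  next
    case (3 v)
    then show ?case by (rule T_norm_le)
  next
    \<comment> \<open>The error estimate for fixed hidden-layer parameters.\<close>
    case (4 u v m \<Theta> p)
    note feature = admissible_featureD[OF 4(2)[rule_format]]
    have "\<exists>u\<^sub>\<rho>\<in>sp_space2 m \<Theta> p. (\<lambda>z. u z - u\<^sub>\<rho> z) \<in> sobolev (s - 1) Q \<and>
        sobolev_norm (s - 1) Q (\<lambda>z. u z - u\<^sub>\<rho> z)
          \<le> C * (INF w\<^sub>\<rho>\<in>potential_space2 m \<Theta> p. sobolev_norm s Q (\<lambda>z. v z - w\<^sub>\<rho> z))"
      unfolding sp_space2_def potential_space2_def
      by (rule exists_structure_preserving_approximation) (use 4(1) feature sp_feature2_eq in auto)
    moreover have "div_free_at u\<^sub>\<rho> z" if "u\<^sub>\<rho> \<in> sp_space2 m \<Theta> p" "z \<in> Q" for u\<^sub>\<rho> z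
      by (rule div_free_feature_span[OF sp_feature2_div_free[OF Q(1) 4(2)[rule_format] that(2)]
            that(1)[unfolded sp_space2_def]])
    ultimately show ?case unfolding div_free_at_def by blast
  next
    \<comment> \<open>Its consequence for random hidden-layer parameters.\<close>
    case (5 u v m \<Theta> P u\<^sub>\<rho> \<epsilon>)
    show ?case
      by (rule with_high_prob_transfer[where C = C
            and dist = "\<lambda>k \<omega> w. sobolev_norm s Q (\<lambda>z. v z - w z)"
            and W = "\<lambda>k \<omega>. potential_space2 (m k) (\<Theta> k) (\<lambda>j. P k j \<omega>)"])
        (use 5 C_pos sobolev_norm_nonneg in blast)+
  qed
next
  case (2 \<Omega>)
  define Q where "Q = \<Omega> \<times> {t0<..<t1}"
  have Q: "open Q" "bounded Q" "Q \<noteq> {}"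
    using 2 \<open>t0 < t1\<close> by (auto simp: Q_def intro: open_Times bounded_Times)
  interpret first_order_operator s Q curl_coeff "curl Q"
    by (rule first_order_operator_curl[OF \<open>s \<ge> 1\<close> Q])
  show ?case
    unfolding Let_def Q_def[symmetric]
  proof (intro conjI ballI allI impI, goal_cases)
    case 1
    show ?case by (rule C_pos)
  next
    case (2 v)
    then show ?case by (rule T_sobolev(1))
  next
    case (3 v)
    then show ?case by (rule T_norm_le)
  next
    \<comment> \<open>The error estimate for fixed hidden-layer parameters.\<close>
    case (4 u v m \<Theta> p)
    note feature = admissible_vector_featureD[OF Q(1) 4(2)[rule_format]]
    have "\<exists>u\<^sub>\<rho>\<in>sp_space3 m \<Theta> p. (\<lambda>z. u z - u\<^sub>\<rho> z) \<in> sobolev (s - 1) Q \<and>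
        sobolev_norm (s - 1) Q (\<lambda>z. u z - u\<^sub>\<rho> z)
          \<le> C * (INF w\<^sub>\<rho>\<in>potential_space3 m \<Theta> p. sobolev_norm s Q (\<lambda>z. v z - w\<^sub>\<rho> z))"
      unfolding sp_space3_def potential_space3_def
      by (rule exists_structure_preserving_approximation) (use 4(1) feature sp_feature3_eq admissible_featureD(2)[OF 4(2)[rule_format]] in auto)
    moreover have "div_free_at u\<^sub>\<rho> z" if "u\<^sub>\<rho> \<in> sp_space3 m \<Theta> p" "z \<in> Q" for u\<^sub>\<rho> z
      by (rule div_free_feature_span[OF sp_feature3_div_free[OF Q(1) 4(2)[rule_format] that(2)]
            that(1)[unfolded sp_space3_def]])
    ultimately show ?case unfolding div_free_at_def by blast
  next
    \<comment> \<open>Its consequence for random hidden-layer parameters.\<close>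
    case (5 u v m \<Theta> P u\<^sub>\<rho> \<epsilon>)
    show ?case
      by (rule with_high_prob_transfer[where C = C
            and dist = "\<lambda>k \<omega> w. sobolev_norm s Q (\<lambda>z. v z - w z)"
            and W = "\<lambda>k \<omega>. potential_space3 (m k) (\<Theta> k) (\<lambda>j i. P k j i \<omega>)"])
        (use 5 C_pos sobolev_norm_nonneg in blast)+
  qed
qed

end
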